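(* Let $$\kappa_0 = \lim_{p\to\infty} \frac1p\,\#\{z\in\mathbb{C} : |z| = 1 \text{ and } f_p(z) = 0\},\qquad \kappa_1=\lim_{J\to\infty}\frac{\#\{g \in \mathcal{F}_J : g(x) = 0 \text{ for some } x \in (0,1)\}}{\#\mathcal{F}_J},$$ where $p$ runs through primes. (Both limits exist.) Then $\kappa_0 = \frac12 + \kappa_1$.
   Context: For an odd prime $p$, $\left(\frac{\cdot}{p}\right)$ denotes the Legendre symbol and the Fekete polynomial is $f_p(t) := \sum_{a=0}^{p-1} \left(\frac{a}{p}\right) t^a$. For a positive integer $J$, $\mathcal{F}_J$ denotes the (finite) set of rational functions of the form $$g(x) = \frac{1}{x} + \frac{1}{1-x} + \sum_{\substack{|j| < J \\ j\ne 0,-1}} \frac{\delta_j}{x+j},$$ where $j$ runs over integers and each $\delta_j$ is allowed to take the value $+1$ or $-1$. *)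

theory Defs
  imports Complex_Main
    "HOL-Computational_Algebra.Polynomial"
    "HOL-Number_Theory.Number_Theory"
begin

definition fekete_poly :: "nat \<Rightarrow> complex poly" where
  "fekete_poly p = (\<Sum>a<p. Polynomial.monom (of_int (Legendre (int a) (int p))) a)"

definition odd_primes_at_top :: "nat filter" where
  "odd_primes_at_top = inf at_top (principal {p. prime p \<and> odd p})"

definition F_indices :: "nat \<Rightarrow> int set" where
  "F_indices J = {j. \<bar>j\<bar> < int J \<and> j \<noteq> 0 \<and> j \<noteq> -1}"

definition F_fun :: "nat \<Rightarrow> (int \<Rightarrow> real) \<Rightarrow> real \<Rightarrow> real" where
  "F_fun J \<delta> x = 1 / x + 1 / (1 - x) + (\<Sum>j\<in>F_indices J. \<delta> j / (x + of_int j))"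

text \<open>A rational function is represented by its values on all of \<^typ>\<open>real\<close>; at a pole, division
  by zero gives the offending summand the value 0. Rational functions that agree at all but finitely
  many points are equal, so this identifies no two members. None has a pole in the open interval (0,1).\<close>

definition F_set :: "nat \<Rightarrow> (real \<Rightarrow> real) set" where
  "F_set J = {F_fun J \<delta> | \<delta>. \<forall>j\<in>F_indices J. \<delta> j \<in> {1, -1}}"

lemma finite_F_indices: "finite (F_indices J)"
  by (rule finite_subset[of _ "{- int J..int J}"]) (auto simp: F_indices_def)

lemma finite_F_set: "finite (F_set J)"
proof (rule finite_subset)
  show "F_set J \<subseteq> F_fun J ` (F_indices J \<rightarrow>\<^sub>E {1, -1})"
  proof
    fix g assume "g \<in> F_set J"
    then obtain \<delta> where g: "g = F_fun J \<delta>" and \<delta>: "\<forall>j\<in>F_indices J. \<delta> j \<in> {1, -1}"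
      by (auto simp: F_set_def)
    have "g = F_fun J (restrict \<delta> (F_indices J))"
      unfolding g F_fun_def by simp
    moreover have "restrict \<delta> (F_indices J) \<in> F_indices J \<rightarrow>\<^sub>E {1, -1}"
      unfolding restrict_PiE_iff using \<delta> .
    ultimately show "g \<in> F_fun J ` (F_indices J \<rightarrow>\<^sub>E {1, -1})"
      by (rule image_eqI)
  qed
  show "finite (F_fun J ` (F_indices J \<rightarrow>\<^sub>E {1, -1 :: real}))"
    by (intro finite_imageI finite_PiE finite_F_indices) auto
qed

end

theory Submission
  imports Defs "Berlekamp_Zassenhaus.Finite_Field" "HOL-Analysis.Complex_Transcendental"
begin

text \<open>
  Let \<open>\<chi>\<close> be the Legendre symbol modulo \<open>p\<close> and \<open>\<tau>\<close> its Gauss sum, and write \<open>e(u)\<close> for the point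
  of the unit circle with argument \<open>2\<pi>u\<close>.  The Fekete polynomial takes the value \<open>\<chi>(k)\<tau>\<close> at
  \<open>e(k/p)\<close>, and a polynomial of degree below \<open>p\<close> is determined by its values at the \<open>p\<close>-th roots
  of unity.  Written out, interpolation says that at \<open>z = e(t/p)\<close>, with \<open>t\<close> not an integer,
  \<open>f\<^sub>p(z)\<close> is a nonzero multiple of the real number \<open>\<Sum>\<^sub>k \<chi>(k) cot(\<pi>(t-k)/p)\<close>
  (\<open>fekete_interpolation\<close>).  On the arc between \<open>e(m/p)\<close> and \<open>e((m+1)/p)\<close>, with \<open>t = m + x\<close>,
  the zeros are therefore the zeros in \<open>(0,1)\<close> of \<open>\<Sum>\<^sub>j \<chi>(m)\<chi>(m-j) (\<pi>/p) cot(\<pi>(x+j)/p)\<close>, where \<open>j\<close> runs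
  through the residues of least absolute value; this is close to \<open>\<Sum>\<^sub>j \<chi>(m)\<chi>(m-j)/(x+j)\<close>.

  The terms \<open>j = 0\<close> and \<open>j = -1\<close> dominate.  The first tends to \<open>+\<infinity>\<close> at \<open>0\<close>; the second
  has its pole at \<open>1\<close> and the coefficient \<open>\<chi>(m)\<chi>(m+1)\<close>.  If this coefficient is \<open>+1\<close>, the function decreases from \<open>+\<infinity>\<close> to \<open>-\<infinity>\<close> and has exactly one
  zero (\<open>cot_sum_zeros_same_sign\<close>).  If it is \<open>-1\<close>, the function is strictly convex and tends to
  \<open>+\<infinity>\<close> at both ends, so it has at most two zeros, exactly two if it takes a negative value and none if it
  is positive (\<open>cot_sum_zeros_opposite_sign\<close>).  Both cases occur for asymptotically half of the \<open>m\<close>.  The first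
  contributes \<open>1/2\<close> to the density of zeros.  In the second the function resembles a member of
  \<open>\<F>\<^sub>J\<close> with random signs, so the contribution is \<open>1/2 * 2\<close> times the proportion of those members that have
  a zero, which is \<open>\<kappa>\<^sub>1\<close>.

  Three facts turn this heuristic into a proof.  First, for a fixed finite set of shifts all sign
  patterns of \<open>\<chi>\<close> are equally likely in the limit (\<open>pattern_class_density\<close>).  This needs \<open>o(p)\<close> bounds for the sums
  \<open>\<Sum>\<^sub>m \<chi>((m-j\<^sub>1)...(m-j\<^sub>n))\<close>, which come from Stepanov's method (\<open>stepanov_bound\<close>).  Second, the terms with
  \<open>|j| \<ge> J\<close> are small for most \<open>m\<close>, by a second moment computation that needs only sums with two factors
  (\<open>Legendre_large_deviation\<close>).  Third, the minimum of a random member of \<open>\<F>\<^sub>J\<close> is rarely close to \<open>0\<close>, uniformly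
  in \<open>J\<close> (\<open>anticoncentration\<close>).  Together they show that, for large \<open>J\<close> and then
  \<open>p \<rightarrow> \<infinity>\<close>, the density of zeros of \<open>f\<^sub>p\<close> differs from \<open>1/2\<close> plus the proportion for \<open>J\<close> by an
  arbitrarily small amount (\<open>fekete_density_near_zero_ratio\<close>).  Such a comparison between two families forces both
  limits to exist and to agree up to the summand \<open>1/2\<close> (\<open>common_limit\<close>).
\<close>

hide_const (open) up_ring.coeff up_ring.monom Coset.order Module.smult

section \<open>Stepanov's bound for hyperelliptic curves\<close>

text \<open>
  The Taylor coefficients at \<open>a\<close> are the derivatives divided by factorials, and \<open>l!\<close> is invertible
  for \<open>l < M \<le> CHAR('a)\<close>.  In positive characteristic this restriction cannot be dropped.
\<close>
lemma order_ge_of_higher_pderiv_zero: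
  fixes R :: "'a :: field_prime_char poly"
  assumes "R \<noteq> 0" and "M \<le> CHAR('a)"
    and zero: "\<And>l. l < M \<Longrightarrow> poly ((pderiv ^^ l) R) a = 0"
  shows "M \<le> Polynomial.order a R"
proof -
  define Q where "Q = pcompose R [:a, 1:]"
  have D: "(pderiv ^^ l) Q = pcompose ((pderiv ^^ l) R) [:a, 1:]" for l
    by (induction l) (simp_all add: Q_def pderiv_pcompose pderiv_pCons)
  have "coeff Q l = 0" if "l < M" for l
  proof -
    have "0 = poly ((pderiv ^^ l) Q) 0"
      using zero[OF that] by (simp add: D poly_pcompose)
    also have "\<dots> = of_nat (fact l) * coeff Q l"
      using pochhammer_of_nat[where ?'a = 'a, of 1 l]
      by (simp add: poly_0_coeff_0 coeff_higher_pderiv pochhammer_fact)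
    finally have "of_nat (fact l) * coeff Q l = 0" by simp
    moreover have "(of_nat (fact l) :: 'a) \<noteq> 0"
    proof -
      have "\<not> CHAR('a) dvd fact l"
        using that assms(2) by (subst prime_dvd_fact_iff) auto
      thus ?thesis by (simp add: of_nat_eq_0_iff_char_dvd)
    qed
    ultimately show ?thesis by simp
  qed
  hence "monom 1 M dvd Q"
    by (simp add: monom_1_dvd_iff')
  then obtain S where S: "Q = monom 1 M * S" by blast
  have "R = pcompose Q [:-a, 1:]"
    unfolding Q_def pcompose_assoc[symmetric] by (simp add: pcompose_pCons)
  also have "\<dots> = [:-a, 1:] ^ M * pcompose S [:-a, 1:]"
  proof -
    have "pcompose (monom 1 n) [:-a, 1:] = [:-a, 1:] ^ n" for n
      by (induction n) (simp_all add: monom_Suc pcompose_pCons monom_0)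
    thus ?thesis by (simp add: S pcompose_mult)
  qed
  finally have "[:-a, 1:] ^ M dvd R" by simp
  thus ?thesis using assms(1) by (simp add: order_divides)
qed

text \<open>
  What remains of the \<open>l\<close>-th derivative of \<open>f\<^sup>e u\<close> after the power \<open>f\<^sup>e\<^sup>-\<^sup>l\<close> has been split off; it
  is linear in \<open>u\<close>, and its degree grows by at most \<open>degree f\<close> per derivative, however large \<open>e\<close> is.
\<close>
fun deriv_cofactor :: "'a::idom poly \<Rightarrow> nat \<Rightarrow> nat \<Rightarrow> 'a poly \<Rightarrow> 'a poly" where
  "deriv_cofactor f e 0 u = u"
| "deriv_cofactor f e (Suc l) u =
     of_nat (e - l) * pderiv f * deriv_cofactor f e l u + f * pderiv (deriv_cofactor f e l u)"

lemma higher_pderiv_power_mult: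
  "l \<le> e \<Longrightarrow> (pderiv ^^ l) (f ^ e * u) = f ^ (e - l) * deriv_cofactor f e l u"
proof (induction l)
  case (Suc l)
  define k where "k = e - Suc l"
  have k: "e - l = Suc k" using Suc.prems by (auto simp: k_def)
  show ?case
    using Suc
    by (simp add: k pderiv_mult pderiv_power_Suc algebra_simps flip: k_def del: power_Suc)
       (simp add: of_nat_mult_conv_smult smult_add_left algebra_simps)
qed simp

lemma deriv_cofactor_diff:
  "deriv_cofactor f e l (u - v) = deriv_cofactor f e l u - deriv_cofactor f e l v"
proof (induction l)
  case (Suc l)
  show ?case
    unfolding deriv_cofactor.simps Suc pderiv_diff right_diff_distrib by (rule add_diff_add[symmetric])
qed simp

lemma degree_deriv_cofactor:
  fixes u :: "'a::idom poly"
  shows "degree u < A \<Longrightarrow> degree (deriv_cofactor f e l u) < A + l * degree f"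
proof (induction l)
  case (Suc l)
  let ?U = "deriv_cofactor f e l u"
  have dle: "degree (pderiv g) \<le> degree g" for g :: "'a poly"
    by (rule degree_le) (auto simp: coeff_pderiv coeff_eq_0)
  have "degree (of_nat (e - l) * pderiv f * ?U) \<le> degree f + degree ?U"
    by (simp add: of_nat_mult_conv_smult)
       (meson add_mono_thms_linordered_semiring(3) degree_mult_le degree_smult_le dle order_trans)
  moreover have "degree (f * pderiv ?U) \<le> degree f + degree ?U"
    by (meson add_left_mono degree_mult_le dle order_trans)
  ultimately have "degree (deriv_cofactor f e (Suc l) u) \<le> degree f + degree ?U"
    using degree_add_le by (simp add: degree_add_le)
  with Suc show ?case by simp
qed simp

lemma higher_pderiv_mult_deriv_zero:
  "pderiv Y = 0 \<Longrightarrow> (pderiv ^^ l) (Y * u) = Y * (pderiv ^^ l) u"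
  by (induction l) (simp_all add: pderiv_mult)

lemma card_poly_degree_less:
  fixes n :: nat assumes "n > 0"
  shows "finite {q :: 'a::{finite,comm_ring_1} poly. degree q < n}" (is "finite ?P")
    and "card {q :: 'a poly. degree q < n} = CARD('a) ^ n"
proof -
  have eq: "?P = Poly ` {xs :: 'a list. set xs \<subseteq> UNIV \<and> length xs = n}"
  proof (intro equalityI subsetI)
    fix q :: "'a poly" assume q: "q \<in> ?P"
    have "q = Poly (map (coeff q) [0..<n])"
      using q by (intro poly_eqI) (auto simp: nth_default_def coeff_eq_0)
    thus "q \<in> Poly ` {xs :: 'a list. set xs \<subseteq> UNIV \<and> length xs = n}"
      by (rule image_eqI) auto
  next
    fix q :: "'a poly" assume "q \<in> Poly ` {xs :: 'a list. set xs \<subseteq> UNIV \<and> length xs = n}"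
    then obtain xs where xs: "q = Poly xs" "length xs = n" by auto
    have "degree q \<le> n - 1"
      by (rule degree_le) (use xs assms in \<open>auto simp: nth_default_def\<close>)
    thus "q \<in> ?P" using assms by auto
  qed
  have inj: "inj_on Poly {xs :: 'a list. set xs \<subseteq> UNIV \<and> length xs = n}"
  proof (rule inj_onI, rule nth_equalityI)
    fix xs ys :: "'a list" and i
    assume "xs \<in> {xs. set xs \<subseteq> UNIV \<and> length xs = n}" "ys \<in> {xs. set xs \<subseteq> UNIV \<and> length xs = n}"
      and "Poly xs = Poly ys"
    hence "length xs = length ys" and "nth_default 0 xs i = nth_default 0 ys i"
      by (simp, metis coeff_Poly_eq)
    thus "length xs = length ys" and "i < length xs \<Longrightarrow> xs ! i = ys ! i"
      by (auto simp: nth_default_nth)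
  qed
  show "finite ?P" unfolding eq by (intro finite_imageI finite_lists_length_eq) auto
  show "card {q :: 'a poly. degree q < n} = CARD('a) ^ n"
    unfolding eq card_image[OF inj] by (subst card_lists_length_eq) auto
qed

lemma sum_distinct_degrees_nonzero:
  fixes t :: "'i \<Rightarrow> 'a::comm_ring_1 poly"
  assumes "finite I" "\<exists>i\<in>I. t i \<noteq> 0"
    and dist: "\<And>i j. i \<in> I \<Longrightarrow> j \<in> I \<Longrightarrow> t i \<noteq> 0 \<Longrightarrow> t j \<noteq> 0 \<Longrightarrow> degree (t i) = degree (t j) \<Longrightarrow> i = j"
  shows "sum t I \<noteq> 0"
proof -
  define I' where "I' = {i \<in> I. t i \<noteq> 0}"
  have I': "finite I'" "I' \<noteq> {}" using assms by (auto simp: I'_def)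
  obtain m where m: "m \<in> I'" "\<And>i. i \<in> I' \<Longrightarrow> degree (t i) \<le> degree (t m)"
    using Max_in[of "(\<lambda>i. degree (t i)) ` I'"] Max_ge[of "(\<lambda>i. degree (t i)) ` I'"] I'
    by (smt (verit) finite_imageI image_iff image_is_empty)
  have "coeff (sum t I) (degree (t m)) = (\<Sum>i\<in>I. coeff (t i) (degree (t m)))"
    by (simp add: coeff_sum)
  also have "\<dots> = (\<Sum>i\<in>{m}. coeff (t i) (degree (t m)))"
  proof (rule sum.mono_neutral_right)
    show "\<forall>i\<in>I - {m}. coeff (t i) (degree (t m)) = 0"
    proof
      fix i assume i: "i \<in> I - {m}"
      show "coeff (t i) (degree (t m)) = 0"
      proof (cases "t i = 0")
        case False
        hence "degree (t i) < degree (t m)"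
          using i m dist[of i m] by (force simp: I'_def le_less)
        thus ?thesis by (rule coeff_eq_0)
      qed simp
    qed
  qed (use m assms in \<open>auto simp: I'_def\<close>)
  also have "\<dots> \<noteq> 0" using m by (simp add: I'_def)
  finally show ?thesis by auto
qed

text \<open>
  Stepanov's method for the curve \<open>y\<^sup>2 = f(x)\<close>.  If a nonzero polynomial \<open>R\<close> vanishes to order \<open>M = 2\<mu>\<close> at
  every \<open>a\<close> with \<open>f(a)\<^sup>h = \<epsilon>\<close>, where \<open>h = (p-1)/2\<close>, then there are at most \<open>degree R / M\<close> such points.  Take
  \<open>R = f\<^sup>M \<Sum>\<^sub>j\<^sub><\<^sub>K X\<^sup>j\<^sup>p (r\<^sub>j + f\<^sup>h s\<^sub>j)\<close> with unknown \<open>r\<^sub>j\<close>, \<open>s\<^sub>j\<close> of degree below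
  \<open>A\<close>.  The derivative of \<open>X\<^sup>p\<close> is zero, and at the points in question \<open>X\<^sup>p = X\<close> and \<open>f\<^sup>h = \<epsilon>\<close>, so each vanishing
  condition becomes an identity between polynomials of degree about \<open>A\<close>: roughly \<open>M A\<close> linear
  equations for \<open>2 K A\<close> unknowns.  With \<open>K = \<mu> + 1\<close> there is a nontrivial solution, found here by
  the pigeonhole principle because the field is finite.  Since \<open>degree f\<close> is odd, the degrees of the terms
  \<open>X\<^sup>j\<^sup>p r\<^sub>j\<close> and \<open>X\<^sup>j\<^sup>p f\<^sup>h s\<^sub>j\<close> lie in disjoint ranges modulo \<open>p\<close>, so \<open>R\<close> does not collapse to zero.
  For fixed \<open>\<mu>\<close> the bound is \<open>p/2 (1 + O(1/\<mu>)) + O(1)\<close>.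
\<close>
theorem stepanov_bound:
  fixes f :: "'a::finite_field poly" and \<epsilon> :: 'a
  assumes card: "CARD('a) = 2 * h + 1" and char: "CHAR('a) = 2 * h + 1"
    and deg: "degree f = 2 * e + 1" and \<mu>: "\<mu> > 0"
    and large: "e < h" "\<mu> * (2 * \<mu> * (2 * e + 1) + \<mu> + 1) < h - e"
    and \<epsilon>: "\<epsilon> \<noteq> 0"
  shows "card {a. poly f a ^ h = \<epsilon>} * (2 * \<mu>) \<le> 2 * \<mu> * (2 * e + 1) + (\<mu> + 1 + e) * (2 * h + 1)"
proof -
  define p M K A d B where defs: "p = 2 * h + 1" "M = 2 * \<mu>" "K = \<mu> + 1" "A = h - e"
    "d = 2 * e + 1" "B = A + M * d + K"
  have "f \<noteq> 0" using deg by auto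
  have "A > 0" using large(1) by (simp add: defs(4))
  hence "B > 0" by (simp add: defs(6))
  define P where "P = (\<lambda>n. {q :: 'a poly. degree q < n})"
  define E where "E = (\<lambda>c l. \<Sum>j<K. monom 1 j * (deriv_cofactor f M l (c j)
                        + smult \<epsilon> (deriv_cofactor f (M + h) l (c (K + j)))))"
  define D where "D = (\<Pi>\<^sub>E i\<in>{..<2 * K}. P A)"
  define C where "C = (\<Pi>\<^sub>E l\<in>{..<M}. P B)"
  define \<Phi> where "\<Phi> = (\<lambda>c. restrict (E c) {..<M})"
  have "\<Phi> ` D \<subseteq> C"
  proof safe
    fix c assume c: "c \<in> D"
    have "degree (E c l) < B" if l: "l < M" for l
      unfolding E_def
    proof (rule degree_sum_less)
      fix j assume j: "j \<in> {..<K}"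
      have "degree (deriv_cofactor f M l (c j)) < A + l * d"
        using degree_deriv_cofactor[of "c j" A f M l] c j unfolding D_def P_def deg defs(5)
        by (auto dest!: PiE_mem[where x = j])
      moreover have "degree (deriv_cofactor f (M + h) l (c (K + j))) < A + l * d"
        using degree_deriv_cofactor[of "c (K + j)" A f "M + h" l] c j unfolding D_def P_def deg defs(5)
        by (auto dest!: PiE_mem[where x = "K + j"])
      ultimately have "degree (deriv_cofactor f M l (c j)
           + smult \<epsilon> (deriv_cofactor f (M + h) l (c (K + j)))) < A + l * d"
        by (intro degree_add_less) (auto simp: \<epsilon>)
      moreover have "l * d \<le> M * d" using l by simp
      ultimately show "degree (monom 1 j * (deriv_cofactor f M l (c j)
           + smult \<epsilon> (deriv_cofactor f (M + h) l (c (K + j))))) < B"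
        using j degree_monom_le[of "1 :: 'a" j] unfolding defs(6) lessThan_iff
        by (intro le_less_trans[OF degree_mult_le]) linarith
    qed (use \<open>B > 0\<close> in auto)
    thus "\<Phi> c \<in> C" by (auto simp: \<Phi>_def C_def P_def)
  qed
  moreover have "finite C" "card C = p ^ (B * M)"
    using card_poly_degree_less[OF \<open>B > 0\<close>, where ?'a = 'a]
    by (auto simp: C_def P_def card_PiE power_mult card defs(1) intro: finite_PiE)
  moreover have "card D = p ^ (A * (2 * K))"
    using card_poly_degree_less[OF \<open>A > 0\<close>, where ?'a = 'a]
    by (simp add: D_def P_def card_PiE card defs(1) power_mult)
  \<comment> \<open>fewer equations than unknowns\<close>
  moreover have "B * M < A * (2 * K)"
  proof -
    have "M * (M * d + K) = 2 * (\<mu> * (2 * \<mu> * (2 * e + 1) + \<mu> + 1))"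
      by (simp add: defs(2,3,5))
    hence "M * (M * d + K) < 2 * A" using large(2) by (simp add: defs(4))
    moreover have "A * (2 * K) = A * M + 2 * A" by (simp add: defs(2,3) algebra_simps)
    ultimately show ?thesis by (simp add: defs(6) algebra_simps)
  qed
  hence "p ^ (B * M) < p ^ (A * (2 * K))"
    using large(1) by (intro power_strict_increasing) (simp_all add: defs(1))
  ultimately have "card (\<Phi> ` D) < card D"
    by (metis card_mono le_less_trans)
  hence "\<not> inj_on \<Phi> D" by (rule pigeonhole)
  then obtain c1 c2 where c12: "c1 \<in> D" "c2 \<in> D" "c1 \<noteq> c2" "\<Phi> c1 = \<Phi> c2"
    by (auto simp: inj_on_def)
  define c where "c = (\<lambda>j. c1 j - c2 j)"
  have E0: "E c l = 0" if "l < M" for l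
  proof -
    have "E c1 l = E c2 l" using fun_cong[OF c12(4), of l] that by (simp add: \<Phi>_def)
    moreover have "E c l = E c1 l - E c2 l"
      unfolding E_def sum_subtractf[symmetric] c_def deriv_cofactor_diff smult_diff_right
      by (intro sum.cong refl) (simp add: algebra_simps)
    ultimately show ?thesis by simp
  qed
  have degc: "degree (c i) < A" if "i < 2 * K" for i
    unfolding c_def using c12(1,2) that by (intro degree_diff_less) (auto simp: D_def P_def)
  have "\<exists>i<2*K. c i \<noteq> 0"
    using c12(1-3) unfolding c_def D_def by (metis PiE_ext eq_iff_diff_eq_0 lessThan_iff)
  then obtain i0 where i0: "i0 < 2 * K" "c i0 \<noteq> 0" by blast
  define t where "t = (\<lambda>i. if i < K then monom 1 (p * i) * c i
                           else monom 1 (p * (i - K)) * (f ^ h * c i))"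
  \<comment> \<open>hence the two kinds of terms have degrees in \<open>[0,A)\<close> and \<open>[A,2A)\<close> modulo \<open>p\<close>, and \<open>2A < p\<close>\<close>
  have hd: "h * d = e * p + A" using large(1) by (simp add: defs(1,4,5) algebra_simps)
  have degt: "degree (t i) = (if i < K then i * p + degree (c i)
                 else (i - K + e) * p + (A + degree (c i)))" if "c i \<noteq> 0" for i
    using that \<open>f \<noteq> 0\<close> hd deg
    by (auto simp: t_def degree_mult_eq degree_monom_eq degree_power_eq defs(5) algebra_simps)
  have t0: "t i = 0 \<longleftrightarrow> c i = 0" for i
    using \<open>f \<noteq> 0\<close> by (auto simp: t_def)
  have A2: "2 * A < p" by (simp add: defs(1,4))
  define Q where "Q = (\<Sum>i<2*K. t i)"
  have "Q \<noteq> 0" unfolding Q_def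
  proof (rule sum_distinct_degrees_nonzero)
    fix i j assume ij: "i \<in> {..<2*K}" "j \<in> {..<2*K}" "t i \<noteq> 0" "t j \<noteq> 0"
      and eq: "degree (t i) = degree (t j)"
    define q r where "q = (\<lambda>i. if i < K then i else i - K + e)"
      and "r = (\<lambda>i. if i < K then degree (c i) else A + degree (c i))"
    have dt: "degree (t k) = q k * p + r k" if "t k \<noteq> 0" for k
      using degt[of k] that by (simp add: t0 q_def r_def)
    have rp: "r k < p" "r k < A \<longleftrightarrow> k < K" if "k < 2 * K" for k
      using degc[OF that] A2 by (auto simp: r_def)
    have "q i = (q i * p + r i) div p" using rp(1)[of i] ij by simp
    also have "\<dots> = (q j * p + r j) div p" using dt eq ij by simp
    also have "\<dots> = q j" using rp(1)[of j] ij by simp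
    finally have qq: "q i = q j" .
    hence "r i = r j" using dt eq ij by simp
    hence "i < K \<longleftrightarrow> j < K" using rp(2)[of i] rp(2)[of j] ij by simp
    with qq show "i = j" by (auto simp: q_def split: if_splits)
  qed (use i0 t0 in auto)
  define R where "R = f ^ M * Q"
  have "R \<noteq> 0" using \<open>Q \<noteq> 0\<close> \<open>f \<noteq> 0\<close> by (simp add: R_def)
  have "degree Q \<le> (K + e) * p"
    unfolding Q_def
  proof (rule degree_sum_le)
    fix i assume i: "i \<in> {..<2*K}"
    show "degree (t i) \<le> (K + e) * p"
    proof (cases "c i = 0")
      case False
      define m where "m = (if i < K then i else i - K + e)"
      have "degree (t i) \<le> m * p + p"
        using degt[OF False] degc[of i] i A2 by (auto simp: m_def)
      also have "\<dots> = (m + 1) * p" by simp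
      also have "\<dots> \<le> (K + e) * p" using i by (intro mult_right_mono) (auto simp: m_def)
      finally show ?thesis .
    qed (use t0[of i] in simp)
  qed simp
  hence degR: "degree R \<le> M * d + (K + e) * p"
    using \<open>f \<noteq> 0\<close> \<open>Q \<noteq> 0\<close> by (simp add: R_def degree_mult_eq degree_power_eq deg defs(5))
  have R_eq: "R = (\<Sum>j<K. monom 1 (p * j) * (f ^ M * c j + f ^ (M + h) * c (K + j)))"
  proof -
    have "Q = (\<Sum>j<K. t j) + (\<Sum>j<K. t (K + j))"
    proof -
      have "sum t {..<K + n} = (\<Sum>j<K. t j) + (\<Sum>j<n. t (K + j))" for n
        by (induction n) (simp_all add: add.assoc)
      thus ?thesis by (simp add: Q_def mult_2)
    qed
    thus ?thesis
      by (simp add: R_def t_def distrib_left sum_distrib_left sum.distrib power_add algebra_simps)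
  qed
  have order: "M \<le> Polynomial.order a R" if a: "poly f a ^ h = \<epsilon>" for a
  proof (rule order_ge_of_higher_pderiv_zero)
    fix l assume l: "l < M"
    have Y: "pderiv (monom 1 (p * j) :: 'a poly) = 0" for j
    proof -
      have "(of_nat p :: 'a) = 0" using of_nat_CHAR[where ?'a = 'a] char by (simp add: defs(1))
      thus ?thesis by (simp add: pderiv_monom)
    qed
    have ap: "a ^ p = a" using finite_field_power_card_eq_same[of a] card by (simp add: defs(1))
    have "(pderiv ^^ l) R = (\<Sum>j<K. monom 1 (p * j) * (f ^ (M - l) * deriv_cofactor f M l (c j)
              + f ^ (M + h - l) * deriv_cofactor f (M + h) l (c (K + j))))"
      using l unfolding R_eq
      by (simp add: higher_pderiv_sum higher_pderiv_mult_deriv_zero[OF Y] higher_pderiv_add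
                    higher_pderiv_power_mult)
    also have "poly \<dots> a = poly f a ^ (M - l) * poly (E c l) a"
      unfolding poly_sum E_def sum_distrib_left
    proof (rule sum.cong)
      fix j
      have "M + h - l = (M - l) + h" using l by simp
      thus "poly (monom 1 (p * j) * (f ^ (M - l) * deriv_cofactor f M l (c j)
              + f ^ (M + h - l) * deriv_cofactor f (M + h) l (c (K + j)))) a =
            poly f a ^ (M - l) * poly (monom 1 j * (deriv_cofactor f M l (c j)
              + smult \<epsilon> (deriv_cofactor f (M + h) l (c (K + j))))) a"
        using a by (simp add: poly_monom power_mult ap power_add distrib_left)
    qed simp
    also have "\<dots> = 0" using E0[OF l] by simp
    finally show "poly ((pderiv ^^ l) R) a = 0" .
  next
    have "1 * (2 * \<mu>) \<le> \<mu> * (2 * \<mu> * (2 * e + 1) + \<mu> + 1)"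
      using \<mu> by (intro mult_mono) auto
    hence "2 * \<mu> \<le> \<mu> * (2 * \<mu> * (2 * e + 1) + \<mu> + 1)" by simp
    thus "M \<le> CHAR('a)" using large(2) char unfolding defs(2) by linarith
  qed (fact \<open>R \<noteq> 0\<close>)
  define S where "S = {a. poly f a ^ h = \<epsilon>}"
  have "card S * M = (\<Sum>a\<in>S. M)" by simp
  also have "\<dots> \<le> (\<Sum>a\<in>S. Polynomial.order a R)" by (intro sum_mono order) (auto simp: S_def)
  also have "\<dots> \<le> (\<Sum>a | poly R a = 0. Polynomial.order a R)"
  proof (rule sum_mono2)
    show "S \<subseteq> {a. poly R a = 0}"
    proof
      fix a assume "a \<in> S"
      hence "order a R \<noteq> 0" using order[of a] \<mu> by (auto simp: S_def defs(2))
      thus "a \<in> {a. poly R a = 0}" using order_root[of R a] \<open>R \<noteq> 0\<close> by auto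
    qed
  qed auto
  also have "\<dots> \<le> degree R" by (rule sum_order_le_degree[OF \<open>R \<noteq> 0\<close>])
  also note degR
  finally show ?thesis by (simp add: S_def defs)
qed

section \<open>Character sums over a prime field\<close>

text \<open>
  By Euler's criterion this is the quadratic character of a field with \<open>2h + 1\<close> elements.
\<close>
definition quad_char :: "nat \<Rightarrow> 'a::field \<Rightarrow> int" where
  "quad_char h x = (if x ^ h = 1 then 1 else if x ^ h = -1 then -1 else 0)"

lemma quad_char_0: "h > 0 \<Longrightarrow> (1::'a) \<noteq> -1 \<Longrightarrow> quad_char h (0::'a::field) = 0"
  by (simp add: quad_char_def power_0_left)

lemma quad_char_1 [simp]: "quad_char h 1 = 1"
  by (simp add: quad_char_def)

context
  fixes h :: nat
  assumes card: "CARD('a :: finite_field) = 2 * h + 1" and char: "CHAR('a) = 2 * h + 1"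
begin

lemma h_pos: "h > 0"
  using CHAR_prime[where ?'a = 'a] char by (cases h) auto

lemma one_neq_minus_one: "(1 :: 'a) \<noteq> -1"
proof
  assume "(1 :: 'a) = -1"
  hence "of_nat 2 = (0 :: 'a)" by (simp add: eq_neg_iff_add_eq_0)
  hence "2 * h + 1 dvd 2" by (simp only: of_nat_eq_0_iff_char_dvd char)
  thus False using h_pos by (auto dest: dvd_imp_le)
qed

lemma power_half: "x \<noteq> 0 \<Longrightarrow> x ^ h = 1 \<or> x ^ h = (-1 :: 'a)"
proof -
  assume x: "x \<noteq> 0"
  have "x * x ^ (2 * h) = x * 1"
    using finite_field_power_card_eq_same[of x] card by simp
  hence "x ^ (2 * h) = 1" using x by (simp only: mult_cancel_left) simp
  hence "(x ^ h) ^ 2 = 1" by (simp add: power_mult mult.commute)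
  thus ?thesis by (simp add: power2_eq_1_iff)
qed

lemma quad_char_mult: "quad_char h (x * y) = quad_char h x * quad_char h (y :: 'a)"
proof (cases "x = 0 \<or> y = 0")
  case True
  thus ?thesis using quad_char_0[OF h_pos one_neq_minus_one] by auto
next
  case False
  thus ?thesis using power_half[of x] power_half[of y] one_neq_minus_one
    by (auto simp: quad_char_def power_mult_distrib)
qed

lemma quad_char_prod: "quad_char h (prod f A) = (\<Prod>i\<in>A. quad_char h (f i :: 'a))"
  by (induction A rule: infinite_finite_induct) (simp_all add: quad_char_mult)

lemma sum_quad_char: "(\<Sum>x\<in>UNIV. quad_char h (x :: 'a)) = 0"
proof -
  have "\<exists>y::'a. quad_char h y = -1"
  proof (rule ccontr)
    assume neg: "\<not> ?thesis"
    \<comment> \<open>otherwise all \<open>2h\<close> nonzero elements would be roots of a polynomial of degree \<open>h\<close>\<close>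
    define g :: "'a poly" where "g = monom 1 h - 1"
    have g0: "g \<noteq> 0"
    proof
      assume "g = 0"
      hence "coeff g h = 0" by simp
      thus False using h_pos by (simp add: g_def)
    qed
    have "degree g \<le> h" unfolding g_def by (intro degree_diff_le degree_monom_le) auto
    have "UNIV - {0} \<subseteq> {x. poly g x = 0}"
    proof
      fix x :: 'a assume "x \<in> UNIV - {0}"
      hence "x ^ h = 1"
        using power_half[of x] neg one_neq_minus_one by (auto simp: quad_char_def split: if_splits)
      thus "x \<in> {x. poly g x = 0}" by (simp add: g_def poly_monom)
    qed
    hence "card (UNIV - {0::'a}) \<le> card {x. poly g x = 0}" by (intro card_mono poly_roots_finite g0)
    also have "\<dots> \<le> h" using card_poly_roots_bound[OF g0] \<open>degree g \<le> h\<close> by simp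
    finally show False using card h_pos by (simp add: card_Diff_singleton)
  qed
  then obtain y :: 'a where y: "quad_char h y = -1" by blast
  hence "y \<noteq> 0" using quad_char_0[OF h_pos one_neq_minus_one] by auto
  have "(\<Sum>x\<in>UNIV. quad_char h (x :: 'a)) = (\<Sum>x\<in>UNIV. quad_char h (y * x))"
    by (rule sum.reindex_bij_witness[of _ "\<lambda>x. y * x" "\<lambda>x. x / y"]) (use \<open>y \<noteq> 0\<close> in auto)
  also have "\<dots> = - (\<Sum>x\<in>UNIV. quad_char h (x :: 'a))"
    by (simp add: quad_char_mult y sum_negf)
  finally show ?thesis by simp
qed

text \<open>
  Stepanov's bound is only an upper bound, but it applies to both values \<open>\<plusminus>1\<close> of the character, and
  the two counts together exhaust all points that are not roots of \<open>f\<close>.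
\<close>
lemma sum_quad_char_poly_bound:
  fixes f :: "'a poly"
  assumes deg: "degree f = 2 * e + 1" and \<mu>: "\<mu> > 0"
    and large: "e < h" "\<mu> * (2 * \<mu> * (2 * e + 1) + \<mu> + 1) < h - e"
  shows "\<bar>\<Sum>x\<in>UNIV. quad_char h (poly f x)\<bar> * int \<mu> \<le> 3 * int \<mu> * (2 * e + 1) + int (1 + e) * (2 * h + 1)"
proof -
  define N where "N = (\<lambda>\<epsilon>. {x. poly f x ^ h = \<epsilon>})"
  have "f \<noteq> 0" using deg by auto
  have disj: "N 1 \<inter> N (-1) = {}" using one_neq_minus_one by (auto simp: N_def)
  have "(\<Sum>x\<in>UNIV. quad_char h (poly f x)) = (\<Sum>x\<in>N 1 \<union> N (-1). quad_char h (poly f x))"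
    by (rule sum.mono_neutral_right) (auto simp: N_def quad_char_def)
  also have "\<dots> = (\<Sum>x\<in>N 1. quad_char h (poly f x)) + (\<Sum>x\<in>N (-1). quad_char h (poly f x))"
    by (rule sum.union_disjoint) (use disj in auto)
  also have "(\<Sum>x\<in>N 1. quad_char h (poly f x)) = (\<Sum>x\<in>N 1. 1)"
    by (rule sum.cong) (auto simp: N_def quad_char_def)
  also have "(\<Sum>x\<in>N (-1). quad_char h (poly f x)) = (\<Sum>x\<in>N (-1). -1)"
    by (rule sum.cong) (use one_neq_minus_one in \<open>auto simp: N_def quad_char_def\<close>)
  finally have eq: "(\<Sum>x\<in>UNIV. quad_char h (poly f x)) = int (card (N 1)) - int (card (N (-1)))"
    by simp
  have "UNIV = N 1 \<union> N (-1) \<union> {x. poly f x = 0}"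
    using power_half by (auto simp: N_def)
  hence "CARD('a) \<le> card (N 1) + card (N (-1)) + card {x. poly f x = 0}"
    by (metis (no_types, lifting) card_Un_le order_trans add_right_mono)
  moreover have "card {x. poly f x = 0} \<le> 2 * e + 1"
    using card_poly_roots_bound[OF \<open>f \<noteq> 0\<close>] deg by simp
  ultimately have tot: "2 * int h + 1 \<le> int (card (N 1)) + int (card (N (-1))) + (2 * int e + 1)"
    using card by linarith
  have "int (card (N \<epsilon>)) * (2 * int \<mu>) \<le> 2 * int \<mu> * (2 * e + 1) + (int \<mu> + 1 + e) * (2 * h + 1)"
    if "\<epsilon> \<noteq> 0" for \<epsilon>
  proof -
    have "int (card (N \<epsilon>) * (2 * \<mu>)) \<le> int (2 * \<mu> * (2 * e + 1) + (\<mu> + 1 + e) * (2 * h + 1))"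
      using stepanov_bound[OF card char deg \<mu> large that] unfolding N_def by (simp only: of_nat_le_iff)
    thus ?thesis by (simp add: algebra_simps)
  qed
  from this[of 1] this[of "-1"]
  have *: "int (card (N 1)) * (2 * int \<mu>) \<le> 2 * int \<mu> * (2 * e + 1) + (int \<mu> + 1 + e) * (2 * h + 1)"
    "int (card (N (-1))) * (2 * int \<mu>) \<le> 2 * int \<mu> * (2 * e + 1) + (int \<mu> + 1 + e) * (2 * h + 1)"
    by simp_all
  have "int \<mu> * (2 * int h + 1) \<le> int \<mu> * (int (card (N 1)) + int (card (N (-1))) + (2 * int e + 1))"
    using tot by (intro mult_left_mono) auto
  thus ?thesis using * unfolding eq
    by (cases "int (card (N 1)) \<ge> int (card (N (-1)))") (simp_all add: algebra_simps abs_if)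
qed

text \<open>
  The substitution \<open>x = t\<^sub>0 + 1/u\<close> sends the root \<open>t\<^sub>0\<close> to infinity and multiplies the product by
  \<open>u\<^sup>-\<^sup>n\<close>, \<open>n = card T\<close>, which is a square if \<open>n\<close> is even.  It reduces even degree to odd degree,
  and two factors to one.  The value \<open>1\<close> at \<open>u = 0\<close>, which corresponds to no \<open>x\<close>, is subtracted.
\<close>
lemma sum_quad_char_invert:
  fixes T :: "'a set"
  assumes "finite T" "t0 \<in> T" "even (card T)"
  shows "(\<Sum>x\<in>UNIV. \<Prod>t\<in>T. quad_char h (x - t))
           = (\<Sum>u\<in>UNIV. \<Prod>t\<in>T - {t0}. quad_char h (1 + (t0 - t) * u)) - 1"
proof -
  have 0: "quad_char h (0::'a) = 0" by (rule quad_char_0[OF h_pos one_neq_minus_one])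
  have pm: "quad_char h x * quad_char h x = 1" if "x \<noteq> 0" for x :: 'a
    using power_half[OF that] by (auto simp: quad_char_def)
  have "(\<Sum>x\<in>UNIV. \<Prod>t\<in>T. quad_char h (x - t)) = (\<Sum>x\<in>UNIV-{t0}. \<Prod>t\<in>T. quad_char h (x - t))"
    by (rule sum.mono_neutral_right) (use assms 0 in \<open>auto intro!: prod_zero bexI[of _ t0]\<close>)
  also have "\<dots> = (\<Sum>u\<in>UNIV-{0}. \<Prod>t\<in>T. quad_char h (1 + (t0 - t) * u))"
  proof (rule sum.reindex_bij_witness[of _ "\<lambda>u. t0 + 1 / u" "\<lambda>x. 1 / (x - t0)"])
    fix x assume x: "x \<in> UNIV - {t0}"
    have "(\<Prod>t\<in>T. quad_char h (1 + (t0 - t) * (1 / (x - t0)))) =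
          (\<Prod>t\<in>T. quad_char h (1 / (x - t0)) * quad_char h (x - t))"
      using x by (intro prod.cong refl) (simp add: field_simps flip: quad_char_mult)
    also have "\<dots> = quad_char h (1 / (x - t0)) ^ card T * (\<Prod>t\<in>T. quad_char h (x - t))"
      by (simp add: prod.distrib)
    also have "quad_char h (1 / (x - t0)) ^ card T = 1"
      using assms(3) x pm[of "1 / (x - t0)"] by (elim evenE) (simp add: power_mult power2_eq_square)
    finally show "(\<Prod>t\<in>T. quad_char h (1 + (t0 - t) * (1 / (x - t0)))) = (\<Prod>t\<in>T. quad_char h (x - t))"
      by simp
  qed auto
  also have "\<dots> = (\<Sum>u\<in>UNIV-{0}. \<Prod>t\<in>T-{t0}. quad_char h (1 + (t0 - t) * u))"
    using assms by (intro sum.cong refl) (simp add: prod.remove[of T t0])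
  also have "\<dots> = (\<Sum>u\<in>UNIV. \<Prod>t\<in>T - {t0}. quad_char h (1 + (t0 - t) * u)) - 1"
    by (subst sum.remove[of UNIV 0]) auto
  finally show ?thesis .
qed

lemma sum_quad_char_two:
  assumes "s \<noteq> (t :: 'a)"
  shows "(\<Sum>x\<in>UNIV. quad_char h (x - s) * quad_char h (x - t)) = -1"
proof -
  have "(\<Sum>x\<in>UNIV. quad_char h (x - s) * quad_char h (x - t))
          = (\<Sum>u\<in>UNIV. quad_char h (1 + (s - t) * u)) - 1"
    using sum_quad_char_invert[of "{s, t}" s] assms by (simp add: insert_Diff_if)
  also have "(\<Sum>u\<in>UNIV. quad_char h (1 + (s - t) * u)) = (\<Sum>u\<in>UNIV. quad_char h (u :: 'a))"
    by (rule sum.reindex_bij_witness[of _ "\<lambda>x. (x - 1) / (s - t)" "\<lambda>u. 1 + (s - t) * u"])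
       (use assms in auto)
  finally show ?thesis by (simp add: sum_quad_char)
qed

lemma sum_quad_char_prod_bound:
  fixes T :: "'a set" and \<mu> :: nat
  assumes T: "finite T" "T \<noteq> {}" and \<mu>: "\<mu> > 0"
    and large: "\<mu> * (2 * \<mu> * card T + \<mu> + 1) + card T < h"
  shows "\<bar>\<Sum>x\<in>UNIV. \<Prod>t\<in>T. quad_char h (x - t)\<bar> * int \<mu>
           \<le> int \<mu> * (1 + 3 * card T) + card T * (2 * h + 1)"
proof -
  define n where "n = card T"
  have n: "n > 0" using T by (auto simp: n_def card_gt_0_iff)
  have *: "\<bar>\<Sum>x\<in>UNIV. quad_char h (poly f x)\<bar> * int \<mu> \<le> int \<mu> * (3 * n) + n * (2 * h + 1)"
    if f: "degree f = 2 * e + 1" "2 * e + 1 \<le> n" for f :: "'a poly" and e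
  proof -
    have "\<mu> * (2 * \<mu> * (2 * e + 1) + \<mu> + 1) \<le> \<mu> * (2 * \<mu> * n + \<mu> + 1)"
      using f by (intro mult_left_mono add_right_mono) auto
    hence l: "e < h" "\<mu> * (2 * \<mu> * (2 * e + 1) + \<mu> + 1) < h - e"
      using large f unfolding n_def[symmetric] by linarith+
    have "\<bar>\<Sum>x\<in>UNIV. quad_char h (poly f x)\<bar> * int \<mu> \<le> 3 * int \<mu> * (2 * e + 1) + int (1 + e) * (2 * h + 1)"
      by (rule sum_quad_char_poly_bound[OF f(1) \<mu> l])
    also have "int (1 + e) * (2 * h + 1) \<le> int n * (2 * h + 1)"
      by (rule mult_right_mono) (use f in auto)
    also have "3 * int \<mu> * (2 * e + 1) \<le> 3 * int \<mu> * n"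
      by (rule mult_left_mono) (use f in auto)
    finally show ?thesis by (simp add: algebra_simps)
  qed
  show ?thesis
  proof (cases "odd n")
    case True
    then obtain e where e: "n = 2 * e + 1" by (elim oddE)
    define f where "f = (\<Prod>t\<in>T. [:- t, 1:])"
    have "degree f = n" unfolding f_def by (subst degree_prod_eq_sum_degree) (auto simp: n_def)
    hence "\<bar>\<Sum>x\<in>UNIV. quad_char h (poly f x)\<bar> * int \<mu> \<le> int \<mu> * (3 * n) + n * (2 * h + 1)"
      using * e by simp
    thus ?thesis by (simp add: f_def poly_prod quad_char_prod n_def algebra_simps)
  next
    case False
    then obtain e where e: "n = 2 * e + 2" using n
      by (metis evenE less_not_refl2 mult_Suc_right Suc_pred nat_0_less_mult_iff add.commute)
    obtain t0 where t0: "t0 \<in> T" using T by auto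
    define f where "f = (\<Prod>t\<in>T-{t0}. [:1, t0 - t:])"
    have "degree f = 2 * e + 1" unfolding f_def
    proof (subst degree_prod_eq_sum_degree)
      have "card (T - {t0}) = 2 * e + 1" using e t0 T by (simp add: n_def)
      moreover have "(\<Sum>t\<in>T - {t0}. degree [:1, t0 - t:]) = (\<Sum>t\<in>T - {t0}. 1)"
        by (rule sum.cong) auto
      ultimately show "(\<Sum>t\<in>T - {t0}. degree [:1, t0 - t:]) = 2 * e + 1" by simp
    qed auto
    hence "\<bar>\<Sum>x\<in>UNIV. quad_char h (poly f x)\<bar> * int \<mu> \<le> int \<mu> * (3 * n) + n * (2 * h + 1)"
      using * e by simp
    moreover have "(\<Sum>x\<in>UNIV. \<Prod>t\<in>T. quad_char h (x - t)) = (\<Sum>x\<in>UNIV. quad_char h (poly f x)) - 1"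
      (is "?L = ?R - 1")
      using sum_quad_char_invert[OF T(1) t0] False
      by (simp add: n_def f_def poly_prod quad_char_prod mult.commute)
    moreover have "\<bar>?R - 1\<bar> * int \<mu> \<le> (\<bar>?R\<bar> + 1) * int \<mu>"
      by (rule mult_right_mono) auto
    ultimately have "\<bar>?L\<bar> * int \<mu> \<le> int \<mu> * (3 * n) + n * (2 * h + 1) + int \<mu>"
      by (simp only: distrib_right)
    thus ?thesis by (simp add: n_def algebra_simps)
  qed
qed

end

section \<open>Transfer to Legendre symbols\<close>

text \<open>
  For fixed \<open>S\<close> the first conjunct says that the sum is \<open>o(p)\<close>: the bound is \<open>card S * p / \<mu>\<close> up to a constant,
  and \<open>\<mu>\<close> may be any number that \<open>p\<close> is large enough for.
\<close>
definition legendre_sums_small :: "nat \<Rightarrow> bool" where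
  "legendre_sums_small p \<longleftrightarrow>
     (\<forall>S :: int set. \<forall>\<mu> :: nat. finite S \<longrightarrow> S \<noteq> {} \<longrightarrow> inj_on (\<lambda>j. j mod int p) S \<longrightarrow> \<mu> > 0 \<longrightarrow>
        \<mu> * (2 * \<mu> * card S + \<mu> + 1) + card S < p div 2 \<longrightarrow>
        \<bar>\<Sum>m<p. \<Prod>j\<in>S. Legendre (int m - j) (int p)\<bar> * int \<mu> \<le> int \<mu> * (1 + 3 * card S) + card S * p) \<and>
     (\<forall>i j :: int. [i \<noteq> j] (mod int p) \<longrightarrow>
        (\<Sum>m<p. Legendre (int m - i) (int p) * Legendre (int m - j) (int p)) = -1)"

lemma legendre_sums_small_card:
  assumes odd: "odd CARD('b :: prime_card)"
  shows "legendre_sums_small CARD('b)"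
proof -
  define p where "p = CARD('b)"
  have prime: "prime p" by (simp add: p_def prime_card)
  hence "p > 2" using odd prime_gt_1_nat[of p] by (cases "p = 2") (auto simp: p_def)
  define h where "h = p div 2"
  have ph: "p = 2 * h + 1" using odd by (simp add: h_def p_def)
  have card: "CARD('b mod_ring) = 2 * h + 1" "CHAR('b mod_ring) = 2 * h + 1"
    using ph by (simp_all add: p_def)
  have leg: "Legendre a (int p) = quad_char h (of_int a :: 'b mod_ring)" for a
  proof -
    have "[Legendre a (int p) = a ^ h] (mod int p)"
      using euler_criterion[OF prime \<open>p > 2\<close>, of a] by (simp add: ph)
    hence *: "of_int a ^ h = (of_int (Legendre a (int p)) :: 'b mod_ring)"
      using of_int_eq_iff_cong_CHAR[where ?'a = "'b mod_ring", of "Legendre a (int p)" "a ^ h"] card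
      by (simp add: ph)
    show ?thesis using one_neq_minus_one[OF card]
      unfolding quad_char_def * by (auto simp: Legendre_def)
  qed
  have bij: "bij_betw (\<lambda>m. of_nat m :: 'b mod_ring) {..<p} UNIV"
  proof -
    have "(\<lambda>m. of_nat m :: 'b mod_ring) ` {..<p} = UNIV"
      using surj_of_nat_mod_ring[where ?'a = 'b] by (force simp: p_def)
    thus ?thesis unfolding bij_betw_def
      by (intro conjI eq_card_imp_inj_on) (simp_all add: p_def)
  qed
  have sum_eq: "(\<Sum>m<p. g (of_int (int m))) = (\<Sum>x\<in>UNIV. g (x :: 'b mod_ring))" for g :: "'b mod_ring \<Rightarrow> int"
    using sum.reindex_bij_betw[OF bij, of g] by simp
  show ?thesis
    unfolding legendre_sums_small_def p_def[symmetric]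
  proof (intro conjI allI impI)
    fix S :: "int set" and \<mu> :: nat
    assume S: "finite S" "S \<noteq> {}" "inj_on (\<lambda>j. j mod int p) S" "\<mu> > 0"
      and large: "\<mu> * (2 * \<mu> * card S + \<mu> + 1) + card S < p div 2"
    define T :: "'b mod_ring set" where "T = of_int ` S"
    have inj: "inj_on (of_int :: int \<Rightarrow> 'b mod_ring) S"
      using S(3) by (auto simp: inj_on_def of_int_eq_iff_cong_CHAR cong_def p_def)
    have cT: "card T = card S" using inj by (simp add: T_def card_image)
    have "(\<Sum>m<p. \<Prod>j\<in>S. Legendre (int m - j) (int p)) =
          (\<Sum>x\<in>UNIV. \<Prod>t\<in>T. quad_char h (x - t))"
      using sum_eq[of "\<lambda>x. \<Prod>t\<in>T. quad_char h (x - t)"]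
      by (simp add: leg T_def prod.reindex[OF inj])
    thus "\<bar>\<Sum>m<p. \<Prod>j\<in>S. Legendre (int m - j) (int p)\<bar> * int \<mu>
        \<le> int \<mu> * (1 + 3 * card S) + card S * p"
      using sum_quad_char_prod_bound[OF card, of T \<mu>] S large cT
      by (simp add: T_def ph)
  next
    fix i j :: int assume ij: "[i \<noteq> j] (mod int p)"
    hence "(of_int i :: 'b mod_ring) \<noteq> of_int j"
      by (simp add: of_int_eq_iff_cong_CHAR p_def)
    from sum_quad_char_two[OF card this]
    show "(\<Sum>m<p. Legendre (int m - i) (int p) * Legendre (int m - j) (int p)) = -1"
      using sum_eq[of "\<lambda>x. quad_char h (x - of_int i) * quad_char h (x - of_int j)"]
      by (simp add: leg)
  qed
qed

text \<open>
  The bounds are proved for a field whose number of elements is the cardinality of a type, but they are needed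
  for every prime, and a type cannot depend on the variable \<open>p\<close>.  It is enough to treat one prime: a
  counterexample if there is one, and \<open>3\<close> otherwise.
\<close>
definition critical_prime :: nat where
  "critical_prime = (if \<exists>p. prime p \<and> odd p \<and> \<not> legendre_sums_small p
     then SOME p. prime p \<and> odd p \<and> \<not> legendre_sums_small p else 3)"

lemma critical_prime: "prime critical_prime" "odd critical_prime"
  using someI_ex[of "\<lambda>p. prime p \<and> odd p \<and> \<not> legendre_sums_small p"]
  by (auto simp: critical_prime_def)

typedef critical_index = "{..<critical_prime}"
  using prime_gt_0_nat[OF critical_prime(1)] by auto

lemma card_critical_index: "CARD(critical_index) = critical_prime"
  by (simp add: type_definition.card[OF type_definition_critical_index])

instance critical_index :: prime_card
  by standard (simp add: card_critical_index critical_prime)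

theorem legendre_sums_small:
  assumes "prime p" "odd p"
  shows "legendre_sums_small p"
proof (rule ccontr)
  assume "\<not> legendre_sums_small p"
  hence ex: "\<exists>p. prime p \<and> odd p \<and> \<not> legendre_sums_small p" using assms by blast
  hence "\<not> legendre_sums_small critical_prime"
    using someI_ex[OF ex] by (simp add: critical_prime_def)
  moreover have "legendre_sums_small critical_prime"
    using legendre_sums_small_card[where ?'b = critical_index] critical_prime
    by (simp add: card_critical_index)
  ultimately show False by contradiction
qed

section \<open>The cotangent kernel\<close>

text \<open>
  The kernel \<open>(\<pi>/p) cot(\<pi>y/p)\<close>, which approximates \<open>1/y\<close>, with the negative of its derivative and its second
  derivative.
\<close>
definition cot_kernel :: "nat \<Rightarrow> real \<Rightarrow> real" where
  "cot_kernel p y = pi / p * cot (pi / p * y)"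

definition cot_kernel1 :: "nat \<Rightarrow> real \<Rightarrow> real" where
  "cot_kernel1 p y = (pi / p)\<^sup>2 / (sin (pi / p * y))\<^sup>2"

definition cot_kernel2 :: "nat \<Rightarrow> real \<Rightarrow> real" where
  "cot_kernel2 p y = 2 * cot_kernel p y * cot_kernel1 p y"

text \<open>
  The arguments \<open>\<pi>y/p\<close> that occur may exceed \<open>\<pi>/2\<close> by the small amount \<open>\<pi>/(2p)\<close>; the range
  \<open>u\<^sup>2 \<le> 3\<close> leaves room for this.  Since \<open>sin u \<ge> u (1 - u\<^sup>2/6)\<close>, the upper bound reduces to
  \<open>(1 + v)(1 - v/6)\<^sup>2 \<ge> 1\<close> for \<open>v = u\<^sup>2 \<le> 3\<close>.
\<close>
lemma inverse_sin_squared_bounds: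
  fixes u :: real
  assumes "u \<noteq> 0" "u\<^sup>2 \<le> 3"
  shows "sin u \<noteq> 0" "1 / u\<^sup>2 \<le> 1 / (sin u)\<^sup>2" "1 / (sin u)\<^sup>2 \<le> 1 / u\<^sup>2 + 1"
proof -
  have pos: "sin v \<ge> v * (1 - v\<^sup>2 / 6)" if "v \<ge> 0" for v :: real
  proof -
    have "\<bar>sin v - (\<Sum>m<3. sin_coeff m * v ^ m)\<bar> \<le> inverse (fact 3) * \<bar>v\<bar> ^ 3"
      by (rule Maclaurin_sin_bound)
    moreover have "(\<Sum>m<3. sin_coeff m * v ^ m) = v"
      by (simp add: sin_coeff_def eval_nat_numeral)
    ultimately have "\<bar>sin v - v\<bar> \<le> v ^ 3 / 6" using that by (simp add: fact_numeral)
    hence "v - v ^ 3 / 6 \<le> sin v" by linarith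
    thus ?thesis by (simp add: algebra_simps power2_eq_square power3_eq_cube)
  qed
  define q where "q = 1 - u\<^sup>2 / 6"
  have q: "q \<ge> 1 / 2" using assms by (simp add: q_def)
  have "sin \<bar>u\<bar> \<ge> \<bar>u\<bar> * q" using pos[of "\<bar>u\<bar>"] by (simp add: q_def)
  hence "(\<bar>u\<bar> * q)\<^sup>2 \<le> (sin \<bar>u\<bar>)\<^sup>2" using q by (intro power_mono) auto
  hence low: "u\<^sup>2 * q\<^sup>2 \<le> (sin u)\<^sup>2" by (cases "u \<ge> 0") (auto simp: power_mult_distrib)
  have u2: "u\<^sup>2 > 0" using assms by simp
  have q2: "q\<^sup>2 > 0" using q by simp
  have s2: "(sin u)\<^sup>2 > 0" using low u2 q2 by (smt (verit) mult_pos_pos)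
  thus "sin u \<noteq> 0" by auto
  have "\<bar>sin u\<bar>\<^sup>2 \<le> \<bar>u\<bar>\<^sup>2" using abs_sin_x_le_abs_x[of u] by (intro power_mono) auto
  thus "1 / u\<^sup>2 \<le> 1 / (sin u)\<^sup>2" using s2 by (simp add: frac_le)
  define v where "v = u\<^sup>2"
  have "0 \<le> v * ((3 - v) * (8 - v)) / 36"
    using assms by (intro divide_nonneg_pos mult_nonneg_nonneg) (auto simp: v_def)
  also have "\<dots> = (1 + v) * (1 - v / 6)\<^sup>2 - 1"
    by (simp add: field_simps power2_eq_square)
  finally have "1 \<le> (1 + u\<^sup>2) * q\<^sup>2" by (simp add: v_def q_def)
  hence "1 * u\<^sup>2 \<le> ((1 + u\<^sup>2) * q\<^sup>2) * u\<^sup>2" by (intro mult_right_mono) auto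
  also have "\<dots> = (1 + u\<^sup>2) * (u\<^sup>2 * q\<^sup>2)" by simp
  also have "\<dots> \<le> (1 + u\<^sup>2) * (sin u)\<^sup>2" using low by (intro mult_left_mono) auto
  finally show "1 / (sin u)\<^sup>2 \<le> 1 / u\<^sup>2 + 1"
    using s2 u2 by (simp add: field_simps)
qed

lemma cot_bounds:
  fixes u :: real
  assumes "u \<noteq> 0" "u\<^sup>2 \<le> 3"
  shows "\<bar>cot u\<bar> \<le> 1 / \<bar>u\<bar>" "\<bar>u\<bar> \<le> pi / 2 \<Longrightarrow> \<bar>cot u - 1 / u\<bar> \<le> \<bar>u\<bar>"
proof -
  note b = inverse_sin_squared_bounds[OF assms]
  have cot2: "(cot u)\<^sup>2 = 1 / (sin u)\<^sup>2 - 1"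
    using b(1) by (simp add: cot_def power_divide cos_squared_eq field_simps)
  have "\<bar>cot u\<bar>\<^sup>2 \<le> (1 / \<bar>u\<bar>)\<^sup>2" using b(3) cot2 by (simp add: power_divide)
  thus *: "\<bar>cot u\<bar> \<le> 1 / \<bar>u\<bar>" by (rule power2_le_imp_le) auto
  assume u: "\<bar>u\<bar> \<le> pi / 2"
  define v where "v = \<bar>u\<bar>"
  have v: "v > 0" using assms(1) by (simp add: v_def)
  have c: "cot v \<ge> 0"
    using u v cos_ge_zero[of v] sin_ge_zero[of v] pi_gt_zero by (simp add: cot_def v_def)
  have cv: "\<bar>cot u\<bar> = cot v" and "(cot v)\<^sup>2 = (cot u)\<^sup>2"
    using c by (cases "u \<ge> 0"; simp add: v_def)+
  hence "(1 / v)\<^sup>2 - (cot v)\<^sup>2 \<le> 1" using cot2 b(2) by (simp add: v_def power_divide)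
  hence "(1 / v - cot v) * (1 / v + cot v) \<le> 1" by (simp add: power2_eq_square algebra_simps)
  moreover have "0 \<le> 1 / v - cot v" using * cv by (simp add: v_def)
  ultimately have "(1 / v - cot v) * (1 / v) \<le> 1"
    using c by (smt (verit) mult_left_mono)
  hence "1 / v - cot v \<le> v" using v by (simp add: field_simps)
  hence "\<bar>cot v - 1 / v\<bar> \<le> v" using \<open>0 \<le> 1 / v - cot v\<close> by simp
  thus "\<bar>cot u - 1 / u\<bar> \<le> \<bar>u\<bar>"
    by (cases "u \<ge> 0") (auto simp: v_def)
qed

lemma pi_over_p_squared_le:
  fixes p :: nat
  assumes "p > 0" shows "(pi / p)\<^sup>2 \<le> 10 / (real p)\<^sup>2"
proof -
  have "pi\<^sup>2 \<le> (3.15 :: real)\<^sup>2" using pi_approx by (intro power_mono) auto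
  also have "\<dots> \<le> 10" by (simp add: power2_eq_square)
  finally show ?thesis by (simp add: power_divide divide_right_mono)
qed

lemma cot_kernel_minus: "cot_kernel p (- y) = - cot_kernel p y" "cot_kernel1 p (- y) = cot_kernel1 p y"
    "cot_kernel2 p (- y) = - cot_kernel2 p y"
  by (simp_all add: cot_kernel_def cot_kernel1_def cot_kernel2_def)

context
  fixes p :: nat
  assumes p: "p \<ge> 100"
begin

lemma scaled_arg_small:
  assumes "\<bar>y\<bar> \<le> (real p + 1) / 2"
  shows "(pi / p * y)\<^sup>2 \<le> 3"
proof -
  have "\<bar>pi / p * y\<bar> = pi / p * \<bar>y\<bar>" by (simp add: abs_mult)
  also have "\<dots> \<le> pi / p * ((real p + 1) / 2)" by (intro mult_left_mono assms) simp
  also have "\<dots> \<le> (3.15 :: real) / p * ((real p + 1) / 2)"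
    using pi_approx by (intro mult_right_mono divide_right_mono) auto
  also have "\<dots> \<le> 1.7" using p by (simp add: field_simps)
  finally have "\<bar>pi / p * y\<bar>\<^sup>2 \<le> (1.7 :: real)\<^sup>2" by (intro power_mono) auto
  also have "\<dots> \<le> 3" by (simp add: power2_eq_square)
  finally show ?thesis by (simp only: power2_abs)
qed

lemma cot_kernel_sin_nz:
  assumes "y \<noteq> 0" "\<bar>y\<bar> \<le> (real p + 1) / 2"
  shows "sin (pi / p * y) \<noteq> 0"
  using inverse_sin_squared_bounds(1)[OF _ scaled_arg_small[OF assms(2)]] assms p by simp

lemma cot_kernel1_bounds:
  assumes "y \<noteq> 0" "\<bar>y\<bar> \<le> (real p + 1) / 2"
  shows "1 / y\<^sup>2 \<le> cot_kernel1 p y" "cot_kernel1 p y \<le> 1 / y\<^sup>2 + 10 / (real p)\<^sup>2"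
proof -
  define a where "a = pi / p"
  have a: "a > 0" "a\<^sup>2 \<le> 10 / (real p)\<^sup>2"
    using p pi_over_p_squared_le[of p] by (auto simp: a_def)
  have nz: "a * y \<noteq> 0" using assms a by auto
  note b = inverse_sin_squared_bounds[OF nz] scaled_arg_small[OF assms(2)]
  have "a\<^sup>2 * (1 / (a * y)\<^sup>2) \<le> a\<^sup>2 * (1 / (sin (a * y))\<^sup>2)"
    by (intro mult_left_mono b(2)) (use b(4) in \<open>auto simp: a_def\<close>)
  thus "1 / y\<^sup>2 \<le> cot_kernel1 p y" using a by (simp add: cot_kernel1_def power_mult_distrib flip: a_def)
  have "a\<^sup>2 * (1 / (sin (a * y))\<^sup>2) \<le> a\<^sup>2 * (1 / (a * y)\<^sup>2 + 1)"
    by (intro mult_left_mono b(3)) (use b(4) in \<open>auto simp: a_def\<close>)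
  also have "\<dots> = 1 / y\<^sup>2 + a\<^sup>2" using a by (simp add: power_mult_distrib field_simps)
  finally show "cot_kernel1 p y \<le> 1 / y\<^sup>2 + 10 / (real p)\<^sup>2"
    using a by (simp add: cot_kernel1_def flip: a_def)
qed

lemma cot_kernel_bounds:
  assumes "y \<noteq> 0" "\<bar>y\<bar> \<le> (real p + 1) / 2"
  shows "\<bar>cot_kernel p y\<bar> \<le> 1 / \<bar>y\<bar>"
    "\<bar>y\<bar> \<le> p / 2 \<Longrightarrow> \<bar>cot_kernel p y - 1 / y\<bar> \<le> 10 / (real p)\<^sup>2 * \<bar>y\<bar>"
proof -
  define a where "a = pi / p"
  have a: "a > 0" "a\<^sup>2 \<le> 10 / (real p)\<^sup>2"
    using p pi_over_p_squared_le[of p] by (auto simp: a_def)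
  have nz: "a * y \<noteq> 0" using assms a by auto
  have s: "(a * y)\<^sup>2 \<le> 3" using scaled_arg_small[OF assms(2)] by (simp add: a_def)
  note b = cot_bounds[OF nz s]
  have "a * \<bar>cot (a * y)\<bar> \<le> a * (1 / \<bar>a * y\<bar>)" using a b by (intro mult_left_mono) auto
  thus "\<bar>cot_kernel p y\<bar> \<le> 1 / \<bar>y\<bar>" using a by (simp add: cot_kernel_def abs_mult flip: a_def)
  assume "\<bar>y\<bar> \<le> p / 2"
  hence "a * \<bar>y\<bar> \<le> a * (p / 2)" using a by (intro mult_left_mono) auto
  hence "\<bar>a * y\<bar> \<le> pi / 2" using a p by (simp add: abs_mult a_def)
  hence "a * \<bar>cot (a * y) - 1 / (a * y)\<bar> \<le> a * \<bar>a * y\<bar>"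
    using a b(2) by (intro mult_left_mono) auto
  also have "\<dots> = a\<^sup>2 * \<bar>y\<bar>" using a by (simp add: abs_mult power2_eq_square)
  also have "\<dots> \<le> 10 / (real p)\<^sup>2 * \<bar>y\<bar>" using a by (intro mult_right_mono) auto
  also have "a * \<bar>cot (a * y) - 1 / (a * y)\<bar> = \<bar>a * (cot (a * y) - 1 / (a * y))\<bar>"
    using a by (simp add: abs_mult)
  also have "a * (cot (a * y) - 1 / (a * y)) = cot_kernel p y - 1 / y"
    using a nz by (simp add: cot_kernel_def field_simps flip: a_def)
  finally show "\<bar>cot_kernel p y - 1 / y\<bar> \<le> 10 / (real p)\<^sup>2 * \<bar>y\<bar>" .
qed

lemma cot_kernel2_le:
  assumes "\<bar>y\<bar> \<ge> 1" "\<bar>y\<bar> \<le> (real p + 1) / 2"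
  shows "\<bar>cot_kernel2 p y\<bar> \<le> 2 / \<bar>y\<bar> ^ 3 + 20 / (real p)\<^sup>2"
proof -
  have nz: "y \<noteq> 0" using assms by auto
  have pos: "0 \<le> 1 / y\<^sup>2" by simp
  have "\<bar>cot_kernel2 p y\<bar> = 2 * \<bar>cot_kernel p y\<bar> * cot_kernel1 p y"
    using order_trans[OF pos cot_kernel1_bounds(1)[OF nz assms(2)]] by (simp add: cot_kernel2_def abs_mult)
  also have "\<dots> \<le> 2 * (1 / \<bar>y\<bar>) * (1 / y\<^sup>2 + 10 / (real p)\<^sup>2)"
    by (intro mult_mono cot_kernel_bounds(1) cot_kernel1_bounds(2) nz assms mult_nonneg_nonneg
              order_trans[OF pos cot_kernel1_bounds(1)[OF nz assms(2)]]) auto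
  also have "\<dots> = 2 / \<bar>y\<bar> ^ 3 + 20 / (real p)\<^sup>2 / \<bar>y\<bar>"
    using nz by (simp add: field_simps power3_eq_cube power2_eq_square)
  also have "20 / (real p)\<^sup>2 / \<bar>y\<bar> \<le> 20 / (real p)\<^sup>2 / 1"
    using assms by (intro divide_left_mono) auto
  finally show ?thesis by simp
qed

lemma cot_kernel2_ge:
  assumes "0 < y" "y \<le> 2"
  shows "9 / 5 / y ^ 3 \<le> cot_kernel2 p y"
proof -
  have y: "y \<noteq> 0" "\<bar>y\<bar> \<le> (real p + 1) / 2" "\<bar>y\<bar> \<le> p / 2" using assms p by auto
  have "10 / (real p)\<^sup>2 * \<bar>y\<bar> \<le> 1 / 20 * (1 / y)"
  proof -
    have "10 / (real p)\<^sup>2 * (y * y) \<le> 10 / 100\<^sup>2 * (2 * 2)"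
      using assms p by (intro mult_mono frac_le power_mono) auto
    hence "10 / (real p)\<^sup>2 * (y * y) \<le> 1 / 20" by simp
    thus ?thesis using assms by (simp add: field_simps)
  qed
  hence "cot_kernel p y \<ge> 9 / 10 * (1 / y)" using cot_kernel_bounds(2)[OF y] by (simp add: abs_le_iff)
  moreover have "1 / y\<^sup>2 \<le> cot_kernel1 p y" by (rule cot_kernel1_bounds(1)[OF y(1,2)])
  ultimately have "9 / 10 * (1 / y) * (1 / y\<^sup>2) \<le> cot_kernel p y * cot_kernel1 p y"
    using assms by (intro mult_mono) (auto intro: order_trans[rotated])
  thus ?thesis by (simp add: cot_kernel2_def power3_eq_cube power2_eq_square)
qed

lemma DERIV_cot_kernel:
  assumes "y \<noteq> 0" "\<bar>y\<bar> \<le> (real p + 1) / 2"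
  shows "(cot_kernel p has_real_derivative - cot_kernel1 p y) (at y)"
  unfolding cot_kernel_def[abs_def] using cot_kernel_sin_nz[OF assms]
  by (auto intro!: derivative_eq_intros DERIV_chain2[OF DERIV_cot]
           simp: cot_kernel1_def power2_eq_square field_simps)

lemma DERIV_cot_kernel1:
  assumes "y \<noteq> 0" "\<bar>y\<bar> \<le> (real p + 1) / 2"
  shows "(cot_kernel1 p has_real_derivative - cot_kernel2 p y) (at y)"
  unfolding cot_kernel1_def[abs_def] using cot_kernel_sin_nz[OF assms]
  by (auto intro!: derivative_eq_intros
           simp: cot_kernel2_def cot_kernel_def cot_kernel1_def cot_def power2_eq_square field_simps)

end

section \<open>Sums of inverse powers and zero counting\<close>

text \<open>
  The distance from the integer \<open>-j\<close> to the interval \<open>(0,1)\<close>; every value is taken for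
  exactly two \<open>j\<close>, exchanged by the reflection \<open>j \<mapsto> -1 - j\<close>.
\<close>
definition gap :: "int \<Rightarrow> int" where
  "gap j = (if j \<ge> 0 then j else -1 - j)"

lemma gap_le_abs_shift:
  assumes "0 < x" "x < 1"
  shows "real_of_int (gap j) \<le> \<bar>x + of_int j\<bar>"
proof (cases "j \<ge> 0")
  case False
  hence "real_of_int j \<le> -1" by simp
  thus ?thesis using assms False by (simp add: gap_def)
qed (use assms in \<open>auto simp: gap_def\<close>)

lemma gap_ge_1: "j \<noteq> 0 \<Longrightarrow> j \<noteq> -1 \<Longrightarrow> gap j \<ge> 1"
  by (auto simp: gap_def)

lemma shift_nz: "0 < x \<Longrightarrow> x < 1 \<Longrightarrow> x + real_of_int j \<noteq> 0"
proof
  assume "0 < x" "x < 1" "x + real_of_int j = 0"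
  hence "0 < real_of_int (- j)" "real_of_int (- j) < 1" by linarith+
  hence "0 < - j" "- j < 1" by (simp_all only: of_int_0_less_iff of_int_less_1_iff)
  thus False by linarith
qed

lemma sum_inverse_squares_le:
  assumes "n \<ge> 1"
  shows "(\<Sum>k=n..N. 1 / (real k)\<^sup>2) \<le> 2 / n"
proof -
  have "(\<Sum>k=n..N. 1 / (real k)\<^sup>2) \<le> 2 / n - 1 / N" if "N \<ge> n"
    using that
  proof (induction N rule: dec_induct)
    case base
    have "1 / (real n)\<^sup>2 \<le> 1 / n" using assms by (simp add: field_simps power2_eq_square)
    thus ?case by simp
  next
    case (step m)
    have m: "real m > 0" using step(1) assms by simp
    have "1 / (1 + real m)\<^sup>2 \<le> 1 / (real m * (1 + real m))"
      using m by (intro divide_left_mono) (auto simp: power2_eq_square)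
    also have "\<dots> = 1 / m - 1 / (1 + real m)" using m by (simp add: field_simps)
    finally have "1 / (1 + real m)\<^sup>2 \<le> 1 / m - 1 / (1 + real m)" .
    thus ?case using step by simp
  qed
  moreover have "1 / real N \<ge> 0" by simp
  ultimately show ?thesis by (cases "N \<ge> n") (auto intro: order_trans)
qed

lemma sum_inverse_gap_squares_le:
  assumes "finite B" "n \<ge> 1" "\<And>j. j \<in> B \<Longrightarrow> gap j \<ge> int n"
  shows "(\<Sum>j\<in>B. 1 / (real_of_int (gap j))\<^sup>2) \<le> 4 / n"
proof -
  obtain N where N: "\<And>j. j \<in> B \<Longrightarrow> \<bar>j\<bar> \<le> int N"
  proof -
    define N where "N = nat (Max (abs ` B))"
    have "\<bar>j\<bar> \<le> int N" if "j \<in> B" for j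
    proof -
      have "\<bar>j\<bar> \<le> Max (abs ` B)" using assms(1) that by (intro Max_ge) auto
      moreover from this have "0 \<le> Max (abs ` B)" by (rule order_trans[OF abs_ge_zero])
      ultimately show ?thesis by (simp add: N_def)
    qed
    thus ?thesis using that by blast
  qed
  let ?P = "(\<lambda>k. int k) ` {n..N}" and ?M = "(\<lambda>k. -1 - int k) ` {n..N}"
  have "B \<subseteq> ?P \<union> ?M"
  proof
    fix j assume j: "j \<in> B"
    show "j \<in> ?P \<union> ?M"
    proof (cases "j \<ge> 0")
      case True
      hence "j = int (nat j)" "nat j \<in> {n..N}" using N[OF j] assms(3)[OF j] by (auto simp: gap_def)
      thus ?thesis by blast
    next
      case False
      hence "j = -1 - int (nat (-1 - j))" "nat (-1 - j) \<in> {n..N}"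
        using N[OF j] assms(3)[OF j] by (auto simp: gap_def)
      thus ?thesis by blast
    qed
  qed
  hence "(\<Sum>j\<in>B. 1 / (real_of_int (gap j))\<^sup>2) \<le> (\<Sum>j\<in>?P \<union> ?M. 1 / (real_of_int (gap j))\<^sup>2)"
    by (intro sum_mono2) auto
  also have "\<dots> = (\<Sum>j\<in>?P. 1 / (real_of_int (gap j))\<^sup>2) + (\<Sum>j\<in>?M. 1 / (real_of_int (gap j))\<^sup>2)"
    by (intro sum.union_disjoint) auto
  also have "(\<Sum>j\<in>?P. 1 / (real_of_int (gap j))\<^sup>2) = (\<Sum>k=n..N. 1 / (real k)\<^sup>2)"
    by (subst sum.reindex) (auto simp: inj_on_def gap_def)
  also have "(\<Sum>j\<in>?M. 1 / (real_of_int (gap j))\<^sup>2) = (\<Sum>k=n..N. 1 / (real k)\<^sup>2)"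
    by (subst sum.reindex) (auto simp: inj_on_def gap_def)
  finally show ?thesis using sum_inverse_squares_le[OF assms(2), of N] by linarith
qed

lemma abs_inverse_shift_le:
  fixes x :: real
  assumes "0 < x" "x < 1" "gap j \<ge> 1"
  shows "1 / \<bar>x + of_int j\<bar> ^ n \<le> 1 / of_int (gap j) ^ n"
  using gap_le_abs_shift[OF assms(1,2), of j] assms(3)
  by (intro divide_left_mono power_mono) (auto intro!: mult_pos_pos)

lemma sum_inverse_shift_squares_le:
  fixes x :: real
  assumes "finite B" "n \<ge> 1" "\<And>j. j \<in> B \<Longrightarrow> gap j \<ge> int n" "0 < x" "x < 1"
  shows "(\<Sum>j\<in>B. 1 / (x + of_int j)\<^sup>2) \<le> 4 / n"
proof -
  have "(\<Sum>j\<in>B. 1 / (x + of_int j)\<^sup>2) \<le> (\<Sum>j\<in>B. 1 / (real_of_int (gap j))\<^sup>2)"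
  proof (rule sum_mono)
    fix j assume "j \<in> B"
    hence "gap j \<ge> 1" using assms(2,3) by fastforce
    from abs_inverse_shift_le[OF assms(4,5) this, of 2]
    show "1 / (x + of_int j)\<^sup>2 \<le> 1 / (real_of_int (gap j))\<^sup>2" by simp
  qed
  also have "\<dots> \<le> 4 / n" by (rule sum_inverse_gap_squares_le[OF assms(1-3)])
  finally show ?thesis .
qed

lemma sum_inverse_shift_cubes_le:
  fixes x :: real
  assumes "finite B" "\<And>j. j \<in> B \<Longrightarrow> gap j \<ge> 1" "0 < x" "x < 1"
  shows "(\<Sum>j\<in>B. 1 / \<bar>x + of_int j\<bar> ^ 3) \<le> 4"
proof -
  have "(\<Sum>j\<in>B. 1 / \<bar>x + of_int j\<bar> ^ 3) \<le> (\<Sum>j\<in>B. 1 / (real_of_int (gap j))\<^sup>2)"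
  proof (rule sum_mono)
    fix j assume j: "j \<in> B"
    have "1 / \<bar>x + of_int j\<bar> ^ 3 \<le> 1 / real_of_int (gap j) ^ 3"
      by (rule abs_inverse_shift_le) (use assms j in auto)
    also have "\<dots> \<le> 1 / (real_of_int (gap j))\<^sup>2"
      using assms(2)[OF j] by (intro divide_left_mono power_increasing) auto
    finally show "1 / \<bar>x + of_int j\<bar> ^ 3 \<le> 1 / (real_of_int (gap j))\<^sup>2" .
  qed
  also have "\<dots> \<le> 4" using sum_inverse_gap_squares_le[OF assms(1), of 1] assms(2) by simp
  finally show ?thesis .
qed

lemma at_most_one_zero:
  fixes f :: "real \<Rightarrow> real"
  assumes "\<And>x. a < x \<Longrightarrow> x < b \<Longrightarrow> (f has_real_derivative f' x) (at x)"
    and "\<And>x. a < x \<Longrightarrow> x < b \<Longrightarrow> f' x \<noteq> 0"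
    and "a < x" "x < y" "y < b" "f x = 0" "f y = 0"
  shows False
proof -
  have "\<exists>z>x. z < y \<and> f y - f x = (y - x) * f' z"
    using assms by (intro MVT2) auto
  then obtain z where "x < z" "z < y" "f y - f x = (y - x) * f' z" by blast
  thus False using assms by auto
qed

lemma card_le_2I:
  fixes Z :: "real set"
  assumes "\<And>x y z. x \<in> Z \<Longrightarrow> y \<in> Z \<Longrightarrow> z \<in> Z \<Longrightarrow> x < y \<Longrightarrow> y < z \<Longrightarrow> False"
  shows "finite Z \<and> card Z \<le> 2"
proof (rule ccontr)
  assume neg: "\<not> ?thesis"
  hence "\<exists>T\<subseteq>Z. card T = 3"
    by (metis One_nat_def Suc_1 infinite_arbitrarily_large not_less_eq_eq numeral_3_eq_3 obtain_subset_with_card_n)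
  then obtain T where T: "T \<subseteq> Z" "card T = 3" by blast
  define xs where "xs = sorted_list_of_set T"
  have xs: "length xs = 3" "sorted_wrt (<) xs" "set xs = T"
    using T by (auto simp: xs_def strict_sorted_list_of_set card_ge_0_finite)
  have "xs ! 0 < xs ! 1" "xs ! 1 < xs ! 2" using xs by (auto simp: sorted_wrt_iff_nth_less)
  moreover have "xs ! 0 \<in> Z" "xs ! 1 \<in> Z" "xs ! 2 \<in> Z"
    using xs T nth_mem[of 0 xs] nth_mem[of 1 xs] nth_mem[of 2 xs] by auto
  ultimately show False using assms by blast
qed

lemma at_most_two_zeros:
  fixes f :: "real \<Rightarrow> real"
  assumes f': "\<And>x. a < x \<Longrightarrow> x < b \<Longrightarrow> (f has_real_derivative f' x) (at x)"
    and f'': "\<And>x. a < x \<Longrightarrow> x < b \<Longrightarrow> (f' has_real_derivative f'' x) (at x)"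
    and nz: "\<And>x. a < x \<Longrightarrow> x < b \<Longrightarrow> f'' x \<noteq> 0"
  shows "finite {x. a < x \<and> x < b \<and> f x = 0} \<and> card {x. a < x \<and> x < b \<and> f x = 0} \<le> 2"
proof (rule card_le_2I)
  fix x y z assume Z: "x \<in> {x. a < x \<and> x < b \<and> f x = 0}" "y \<in> {x. a < x \<and> x < b \<and> f x = 0}"
    "z \<in> {x. a < x \<and> x < b \<and> f x = 0}" "x < y" "y < z"
  have "\<exists>c>x. c < y \<and> f y - f x = (y - x) * f' c" using Z by (intro MVT2 f') auto
  then obtain c where c: "x < c" "c < y" "f' c = 0" using Z by auto
  have "\<exists>d>y. d < z \<and> f z - f y = (z - y) * f' d" using Z by (intro MVT2 f') auto
  then obtain d where d: "y < d" "d < z" "f' d = 0" using Z by auto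
  show False
    by (rule at_most_one_zero[of a b f' f'' c d]) (use c d Z f'' nz in auto)
qed

lemma zero_between:
  fixes f :: "real \<Rightarrow> real"
  assumes "continuous_on {a<..<b} f" "a < x" "x < y" "y < b" "f x * f y < 0"
  shows "\<exists>z. x < z \<and> z < y \<and> f z = 0"
proof -
  have c: "continuous_on {x..y} f" by (rule continuous_on_subset[OF assms(1)]) (use assms in auto)
  have "\<exists>z. x \<le> z \<and> z \<le> y \<and> f z = 0"
  proof (cases "f x < 0")
    case True
    thus ?thesis using IVT'[of f x 0 y] c assms by (auto simp: mult_less_0_iff)
  next
    case False
    thus ?thesis using IVT2'[of f y 0 x] c assms by (auto simp: mult_less_0_iff)
  qed
  then obtain z where "x \<le> z" "z \<le> y" "f z = 0" by blast
  thus ?thesis using assms by (intro exI[of _ z]) (auto simp: less_le)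
qed

section \<open>Sign sums of the cotangent kernel on the unit interval\<close>

definition cot_sum :: "nat \<Rightarrow> int set \<Rightarrow> (int \<Rightarrow> real) \<Rightarrow> real \<Rightarrow> real" where
  "cot_sum p B \<delta> x = (\<Sum>j\<in>B. \<delta> j * cot_kernel p (x + of_int j))"

definition cot_sum1 :: "nat \<Rightarrow> int set \<Rightarrow> (int \<Rightarrow> real) \<Rightarrow> real \<Rightarrow> real" where
  "cot_sum1 p B \<delta> x = (\<Sum>j\<in>B. \<delta> j * cot_kernel1 p (x + of_int j))"

definition cot_sum2 :: "nat \<Rightarrow> int set \<Rightarrow> (int \<Rightarrow> real) \<Rightarrow> real \<Rightarrow> real" where
  "cot_sum2 p B \<delta> x = (\<Sum>j\<in>B. \<delta> j * cot_kernel2 p (x + of_int j))"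

text \<open>
  Both this bound and the next one add up tangent lines at \<open>1/2\<close>.
\<close>
lemma inverse_squares_sum_ge_8:
  fixes x :: real assumes "0 < x" "x < 1"
  shows "1 / x\<^sup>2 + 1 / (1 - x)\<^sup>2 \<ge> 8"
proof -
  have c: "1 / z\<^sup>2 \<ge> 12 - 16 * z" if "z > 0" for z :: real
  proof -
    have "0 \<le> (2 * z - 1)\<^sup>2 * (4 * z + 1)" using that by (intro mult_nonneg_nonneg) auto
    hence "(12 - 16 * z) * z\<^sup>2 \<le> 1" by (simp add: power2_eq_square algebra_simps)
    thus ?thesis using that by (simp add: field_simps)
  qed
  show ?thesis using c[of x] c[of "1 - x"] assms by simp
qed

lemma inverse_cubes_sum_ge_16:
  fixes x :: real assumes "0 < x" "x < 1"
  shows "1 / x ^ 3 + 1 / (1 - x) ^ 3 \<ge> 16"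
proof -
  have c: "1 / z ^ 3 \<ge> 32 - 48 * z" if "z > 0" for z :: real
  proof -
    have "0 \<le> (2 * z - 1)\<^sup>2 * (12 * z\<^sup>2 + 4 * z + 1)" using that by (intro mult_nonneg_nonneg) auto
    hence "(32 - 48 * z) * z ^ 3 \<le> 1" by (simp add: power2_eq_square power3_eq_cube algebra_simps)
    thus ?thesis using that by (simp add: field_simps)
  qed
  show ?thesis using c[of x] c[of "1 - x"] assms by simp
qed

context
  fixes p :: nat and B :: "int set"
  assumes p: "p \<ge> 100" and B: "\<And>j. j \<in> B \<Longrightarrow> 2 * \<bar>j\<bar> + 1 \<le> int p"
begin

lemma finite_B: "finite B"
  by (rule finite_subset[of _ "{- int p..int p}"]) (use B in fastforce)+

lemma card_B_le: "card B \<le> p"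
proof -
  have "B \<subseteq> {- int ((p - 1) div 2)..int ((p - 1) div 2)}"
  proof
    fix j assume "j \<in> B"
    from B[OF this] show "j \<in> {- int ((p - 1) div 2)..int ((p - 1) div 2)}" by auto
  qed
  hence "card B \<le> card {- int ((p - 1) div 2)..int ((p - 1) div 2)}" by (intro card_mono) auto
  also have "\<dots> = 2 * ((p - 1) div 2) + 1" by simp
  also have "\<dots> \<le> p" using p by linarith
  finally show ?thesis .
qed

lemma shift_in_range:
  assumes "-1 < x" "x < 1" "j \<in> B"
  shows "\<bar>x + of_int j\<bar> \<le> (real p + 1) / 2"
proof -
  have "2 * \<bar>real_of_int j\<bar> + 1 \<le> real p" using B[OF assms(3)] by linarith
  moreover have "\<bar>x\<bar> \<le> 1" using assms by simp
  moreover have "\<bar>x + of_int j\<bar> \<le> \<bar>x\<bar> + \<bar>real_of_int j\<bar>" by (rule abs_triangle_ineq)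
  ultimately show ?thesis by argo
qed

lemma
  assumes x: "-1 < x" "x < 1" and nz: "\<And>j. j \<in> B \<Longrightarrow> x + of_int j \<noteq> 0"
  shows DERIV_cot_sum: "(cot_sum p B \<delta> has_real_derivative - cot_sum1 p B \<delta> x) (at x)"
    and DERIV_cot_sum1: "(cot_sum1 p B \<delta> has_real_derivative - cot_sum2 p B \<delta> x) (at x)"
proof -
  have a: "((\<lambda>x. x + real_of_int j) has_real_derivative 1) (at x)" for j
    by (auto intro!: derivative_eq_intros)
  have "((\<lambda>x. cot_kernel p (x + of_int j)) has_real_derivative - cot_kernel1 p (x + of_int j)) (at x)"
    if "j \<in> B" for j
    using DERIV_chain2[OF DERIV_cot_kernel[OF p nz[OF that] shift_in_range[OF x that]] a] by simp
  thus "(cot_sum p B \<delta> has_real_derivative - cot_sum1 p B \<delta> x) (at x)"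
    unfolding cot_sum_def[abs_def] cot_sum1_def sum_negf[symmetric]
    by (intro DERIV_sum) (auto intro!: derivative_eq_intros)
  have "((\<lambda>x. cot_kernel1 p (x + of_int j)) has_real_derivative - cot_kernel2 p (x + of_int j)) (at x)"
    if "j \<in> B" for j
    using DERIV_chain2[OF DERIV_cot_kernel1[OF p nz[OF that] shift_in_range[OF x that]] a] by simp
  thus "(cot_sum1 p B \<delta> has_real_derivative - cot_sum2 p B \<delta> x) (at x)"
    unfolding cot_sum1_def[abs_def] cot_sum2_def sum_negf[symmetric]
    by (intro DERIV_sum) (auto intro!: derivative_eq_intros)
qed

lemma continuous_cot_sum: "continuous_on {0<..<1} (cot_sum p B \<delta>)"
  by (intro continuous_at_imp_continuous_on ballI DERIV_isCont[OF DERIV_cot_sum])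
     (auto simp: shift_nz)

lemma sum_cot_kernel1_le:
  assumes "C \<subseteq> B" "\<And>j. j \<in> C \<Longrightarrow> \<bar>\<delta> j\<bar> \<le> 1" "-1 < x" "x < 1" "\<And>j. j \<in> C \<Longrightarrow> x + of_int j \<noteq> 0"
  shows "\<bar>\<Sum>j\<in>C. \<delta> j * cot_kernel1 p (x + of_int j)\<bar> \<le> (\<Sum>j\<in>C. 1 / (x + of_int j)\<^sup>2) + 10 / p"
proof -
  have "\<bar>\<Sum>j\<in>C. \<delta> j * cot_kernel1 p (x + of_int j)\<bar> \<le> (\<Sum>j\<in>C. 1 / (x + of_int j)\<^sup>2 + 10 / (real p)\<^sup>2)"
  proof (rule order_trans[OF sum_abs sum_mono])
    fix j assume j: "j \<in> C"
    have r: "x + of_int j \<noteq> 0" "\<bar>x + of_int j\<bar> \<le> (real p + 1) / 2"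
      using shift_in_range[of x j] assms j by auto
    have "0 \<le> cot_kernel1 p (x + of_int j)" by (simp add: cot_kernel1_def)
    hence "\<bar>\<delta> j * cot_kernel1 p (x + of_int j)\<bar> \<le> 1 * cot_kernel1 p (x + of_int j)"
      unfolding abs_mult using assms(2)[OF j] by (intro mult_mono) auto
    thus "\<bar>\<delta> j * cot_kernel1 p (x + of_int j)\<bar> \<le> 1 / (x + of_int j)\<^sup>2 + 10 / (real p)\<^sup>2"
      using cot_kernel1_bounds(2)[OF p r] by linarith
  qed
  also have "\<dots> = (\<Sum>j\<in>C. 1 / (x + of_int j)\<^sup>2) + card C * (10 / (real p)\<^sup>2)"
    by (simp add: sum.distrib)
  also have "card C * (10 / (real p)\<^sup>2) \<le> p * (10 / (real p)\<^sup>2)"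
    using card_mono[OF finite_B assms(1)] card_B_le by (intro mult_right_mono) auto
  also have "\<dots> = 10 / p" using p by (simp add: power2_eq_square)
  finally show ?thesis by simp
qed

lemma sum_cot_kernel1_gap_le:
  assumes "C \<subseteq> B" "\<And>j. j \<in> C \<Longrightarrow> \<bar>\<delta> j\<bar> \<le> 1" "n \<ge> 1" "\<And>j. j \<in> C \<Longrightarrow> gap j \<ge> int n" "0 < x" "x < 1"
  shows "\<bar>\<Sum>j\<in>C. \<delta> j * cot_kernel1 p (x + of_int j)\<bar> \<le> 4 / n + 10 / p"
proof -
  have fin: "finite C" using finite_B assms(1) finite_subset by blast
  have "\<bar>\<Sum>j\<in>C. \<delta> j * cot_kernel1 p (x + of_int j)\<bar> \<le> (\<Sum>j\<in>C. 1 / (x + of_int j)\<^sup>2) + 10 / p"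
    by (rule sum_cot_kernel1_le) (use assms shift_nz in auto)
  moreover have "(\<Sum>j\<in>C. 1 / (x + of_int j)\<^sup>2) \<le> 4 / n"
    by (rule sum_inverse_shift_squares_le) (use fin assms in auto)
  ultimately show ?thesis by linarith
qed

text \<open>
  The two singular terms contribute at least \<open>8\<close>, all others together at most \<open>4 + 10/p\<close>.
\<close>
lemma cot_sum1_pos:
  assumes "0 \<in> B" "-1 \<in> B" "\<delta> 0 = 1" "\<delta> (-1) = 1" and \<delta>: "\<And>j. j \<in> B \<Longrightarrow> \<bar>\<delta> j\<bar> \<le> 1"
    and x: "0 < x" "x < 1"
  shows "cot_sum1 p B \<delta> x > 0"
proof -
  define C where "C = B - {0, -1}"
  have BC: "B = insert 0 (insert (-1) C)" using assms by (auto simp: C_def)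
  have eq: "cot_sum1 p B \<delta> x = cot_kernel1 p x + cot_kernel1 p (x - 1) + (\<Sum>j\<in>C. \<delta> j * cot_kernel1 p (x + of_int j))"
    unfolding cot_sum1_def BC using finite_B assms by (simp add: C_def)
  have "1 / x\<^sup>2 \<le> cot_kernel1 p x" using x p by (intro cot_kernel1_bounds(1)[OF p]) auto
  moreover have "1 / (x - 1)\<^sup>2 \<le> cot_kernel1 p (x - 1)" using x p by (intro cot_kernel1_bounds(1)[OF p]) auto
  moreover have "(x - 1)\<^sup>2 = (1 - x)\<^sup>2" by (simp add: power2_commute)
  moreover have "\<bar>\<Sum>j\<in>C. \<delta> j * cot_kernel1 p (x + of_int j)\<bar> \<le> 4 / real 1 + 10 / p"
    by (rule sum_cot_kernel1_gap_le) (use x \<delta> gap_ge_1 in \<open>auto simp: C_def\<close>)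
  moreover have "10 / real p \<le> 1" using p by simp
  ultimately show ?thesis using inverse_squares_sum_ge_8[OF x] unfolding eq by (simp add: abs_le_iff)
qed

lemma sum_cot_kernel2_le:
  assumes "C \<subseteq> B" "\<And>j. j \<in> C \<Longrightarrow> \<bar>\<delta> j\<bar> \<le> 1" "-1 < x" "x < 1" "\<And>j. j \<in> C \<Longrightarrow> \<bar>x + of_int j\<bar> \<ge> 1"
  shows "\<bar>\<Sum>j\<in>C. \<delta> j * cot_kernel2 p (x + of_int j)\<bar> \<le> 2 * (\<Sum>j\<in>C. 1 / \<bar>x + of_int j\<bar> ^ 3) + 20 / p"
proof -
  have fin: "finite C" using finite_B assms(1) finite_subset by blast
  have "\<bar>\<Sum>j\<in>C. \<delta> j * cot_kernel2 p (x + of_int j)\<bar> \<le> (\<Sum>j\<in>C. 2 * (1 / \<bar>x + of_int j\<bar> ^ 3) + 20 / (real p)\<^sup>2)"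
  proof (rule order_trans[OF sum_abs sum_mono])
    fix j assume j: "j \<in> C"
    have r: "1 \<le> \<bar>x + of_int j\<bar>" "\<bar>x + of_int j\<bar> \<le> (real p + 1) / 2"
      using shift_in_range[of x j] assms j by auto
    have "\<bar>\<delta> j * cot_kernel2 p (x + of_int j)\<bar> \<le> 1 * \<bar>cot_kernel2 p (x + of_int j)\<bar>"
      unfolding abs_mult using assms(2)[OF j] by (intro mult_mono) auto
    thus "\<bar>\<delta> j * cot_kernel2 p (x + of_int j)\<bar> \<le> 2 * (1 / \<bar>x + of_int j\<bar> ^ 3) + 20 / (real p)\<^sup>2"
      using cot_kernel2_le[OF p r] by simp
  qed
  also have "\<dots> = 2 * (\<Sum>j\<in>C. 1 / \<bar>x + of_int j\<bar> ^ 3) + card C * (20 / (real p)\<^sup>2)"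
    by (simp add: sum.distrib sum_distrib_left)
  also have "card C * (20 / (real p)\<^sup>2) \<le> p * (20 / (real p)\<^sup>2)"
    using card_mono[OF finite_B assms(1)] card_B_le by (intro mult_right_mono) auto
  also have "\<dots> = 20 / p" using p by (simp add: power2_eq_square)
  finally show ?thesis by simp
qed

text \<open>
  The two singular terms contribute at least \<open>16 * 9/5\<close>, all others together at most \<open>2 * 4 + 20/p\<close>.
\<close>
lemma cot_sum2_pos:
  assumes "0 \<in> B" "-1 \<in> B" "\<delta> 0 = 1" "\<delta> (-1) = -1" and \<delta>: "\<And>j. j \<in> B \<Longrightarrow> \<bar>\<delta> j\<bar> \<le> 1"
    and x: "0 < x" "x < 1"
  shows "cot_sum2 p B \<delta> x > 0"
proof -
  define C where "C = B - {0, -1}"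
  have BC: "B = insert 0 (insert (-1) C)" using assms by (auto simp: C_def)
  have fin: "finite C" using finite_B by (simp add: C_def)
  have "cot_kernel2 p (x - 1) = - cot_kernel2 p (1 - x)" using cot_kernel_minus(3)[of p "1 - x"] by simp
  hence eq: "cot_sum2 p B \<delta> x = cot_kernel2 p x + cot_kernel2 p (1 - x) + (\<Sum>j\<in>C. \<delta> j * cot_kernel2 p (x + of_int j))"
    unfolding cot_sum2_def BC using finite_B assms by (simp add: C_def)
  have ge1: "\<bar>x + of_int j\<bar> \<ge> 1" if "j \<in> C" for j
  proof -
    have "1 \<le> real_of_int (gap j)" using gap_ge_1[of j] that by (simp add: C_def)
    thus ?thesis using gap_le_abs_shift[OF x, of j] by linarith
  qed
  have "9 / 5 / x ^ 3 \<le> cot_kernel2 p x" using x by (intro cot_kernel2_ge[OF p]) auto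
  moreover have "9 / 5 / (1 - x) ^ 3 \<le> cot_kernel2 p (1 - x)" using x by (intro cot_kernel2_ge[OF p]) auto
  moreover have "\<bar>\<Sum>j\<in>C. \<delta> j * cot_kernel2 p (x + of_int j)\<bar> \<le> 2 * (\<Sum>j\<in>C. 1 / \<bar>x + of_int j\<bar> ^ 3) + 20 / p"
    by (rule sum_cot_kernel2_le) (use x \<delta> ge1 in \<open>auto simp: C_def\<close>)
  moreover have "(\<Sum>j\<in>C. 1 / \<bar>x + of_int j\<bar> ^ 3) \<le> 4"
    by (rule sum_inverse_shift_cubes_le[OF fin _ x]) (auto simp: C_def intro!: gap_ge_1)
  moreover have "20 / real p \<le> 1" using p by simp
  ultimately show ?thesis using inverse_cubes_sum_ge_16[OF x] unfolding eq by (simp add: abs_le_iff)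
qed

text \<open>
  This crude bound serves to locate the poles: within \<open>1/(4p)\<close> of a pole the singular term exceeds \<open>2p\<close> and
  so decides the sign of the sum.
\<close>
lemma sum_cot_kernel_le:
  assumes "C \<subseteq> B" "\<And>j. j \<in> C \<Longrightarrow> \<bar>\<delta> j\<bar> \<le> 1" "-1 < x" "x < 1" "\<And>j. j \<in> C \<Longrightarrow> \<bar>x + of_int j\<bar> \<ge> 1 / 2"
  shows "\<bar>\<Sum>j\<in>C. \<delta> j * cot_kernel p (x + of_int j)\<bar> \<le> 2 * real p"
proof -
  have "\<bar>\<Sum>j\<in>C. \<delta> j * cot_kernel p (x + of_int j)\<bar> \<le> (\<Sum>j\<in>C. 2)"
  proof (rule order_trans[OF sum_abs sum_mono])
    fix j assume j: "j \<in> C"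
    note h = assms(5)[OF j]
    have nz: "x + of_int j \<noteq> 0" using h by (intro notI) simp
    have "\<bar>\<delta> j * cot_kernel p (x + of_int j)\<bar> \<le> 1 * (1 / \<bar>x + of_int j\<bar>)"
      unfolding abs_mult using assms(1-4) j
      by (intro mult_mono cot_kernel_bounds(1)[OF p] shift_in_range nz) auto
    also have "\<dots> \<le> 1 / (1 / 2)" using frac_le[of 1 1 "1 / 2" "\<bar>x + of_int j\<bar>"] h by simp
    finally show "\<bar>\<delta> j * cot_kernel p (x + of_int j)\<bar> \<le> 2" by simp
  qed
  also have "\<dots> \<le> 2 * real p" using card_mono[OF finite_B assms(1)] card_B_le by simp
  finally show ?thesis .
qed

lemma cot_kernel_near_0:
  assumes "0 < x" "x \<le> 1 / (4 * real p)"
  shows "x \<le> 1 / 400" "cot_kernel p x > 2 * real p"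
proof -
  have "1 / (4 * real p) \<le> 1 / 400" using p by (intro divide_left_mono) auto
  thus x4: "x \<le> 1 / 400" using assms by linarith
  have "\<bar>cot_kernel p x - 1 / x\<bar> \<le> 10 / (real p)\<^sup>2 * \<bar>x\<bar>"
    using assms x4 p by (intro cot_kernel_bounds(2)[OF p]) auto
  also have "10 / (real p)\<^sup>2 \<le> 10 / 100\<^sup>2" using p by (intro frac_le power_mono) auto
  hence "10 / (real p)\<^sup>2 * \<bar>x\<bar> \<le> 1 * 1" using assms x4 by (intro mult_mono) auto
  finally have "cot_kernel p x \<ge> 1 / x - 1" by (simp add: abs_le_iff)
  moreover have "1 / x \<ge> 4 * real p" using assms p by (simp add: field_simps)
  ultimately show "cot_kernel p x > 2 * real p" using p by simp
qed

lemma cot_sum_near_0: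
  assumes "0 \<in> B" "\<delta> 0 = 1" and \<delta>: "\<And>j. j \<in> B \<Longrightarrow> \<bar>\<delta> j\<bar> \<le> 1"
    and x: "0 < x" "x \<le> 1 / (4 * real p)"
  shows "cot_sum p B \<delta> x > 0"
proof -
  note near = cot_kernel_near_0[OF x]
  have "\<bar>\<Sum>j\<in>B - {0}. \<delta> j * cot_kernel p (x + of_int j)\<bar> \<le> 2 * real p"
  proof (rule sum_cot_kernel_le)
    fix j assume "j \<in> B - {0}"
    hence "real_of_int j \<ge> 1 \<or> real_of_int j \<le> -1" by auto
    thus "\<bar>x + of_int j\<bar> \<ge> 1 / 2"
      using x near abs_ge_self[of "x + of_int j"] abs_ge_minus_self[of "x + of_int j"] by argo
  qed (use x near \<delta> in auto)
  moreover have "cot_sum p B \<delta> x = cot_kernel p x + (\<Sum>j\<in>B - {0}. \<delta> j * cot_kernel p (x + of_int j))"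
    unfolding cot_sum_def using finite_B assms by (simp add: sum.remove[of B 0])
  ultimately show ?thesis using near by (simp add: abs_le_iff)
qed

lemma cot_sum_near_1:
  assumes "-1 \<in> B" "\<delta> (-1) = s" "\<bar>s\<bar> = 1" and \<delta>: "\<And>j. j \<in> B \<Longrightarrow> \<bar>\<delta> j\<bar> \<le> 1"
    and x: "0 < x" "x \<le> 1 / (4 * real p)"
  shows "s * cot_sum p B \<delta> (1 - x) < 0"
proof -
  note near = cot_kernel_near_0[OF x]
  define S where "S = (\<Sum>j\<in>B - {-1}. \<delta> j * cot_kernel p (1 - x + of_int j))"
  have "\<bar>S\<bar> \<le> 2 * real p" unfolding S_def
  proof (rule sum_cot_kernel_le)
    fix j assume "j \<in> B - {-1}"
    hence "real_of_int j \<ge> 0 \<or> real_of_int j \<le> -2" by auto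
    thus "\<bar>1 - x + of_int j\<bar> \<ge> 1 / 2"
      using x near abs_ge_self[of "1 - x + of_int j"] abs_ge_minus_self[of "1 - x + of_int j"] by argo
  qed (use x near \<delta> in auto)
  hence "\<bar>s * S\<bar> \<le> 2 * real p" using assms(3) by (simp add: abs_mult)
  moreover have "cot_sum p B \<delta> (1 - x) = s * cot_kernel p (- x) + S"
    unfolding cot_sum_def S_def using finite_B assms by (simp add: sum.remove[of B "-1"])
  hence "s * cot_sum p B \<delta> (1 - x) = (s * s) * cot_kernel p (- x) + s * S" by (simp add: algebra_simps)
  moreover have "s * s = 1" using assms(3) by (metis abs_mult_self_eq mult_1)
  ultimately show ?thesis using near by (simp add: cot_kernel_minus abs_le_iff)
qed

lemma cot_sum_zeros_same_sign:
  assumes "0 \<in> B" "-1 \<in> B" "\<delta> 0 = 1" "\<delta> (-1) = 1" and \<delta>: "\<And>j. j \<in> B \<Longrightarrow> \<bar>\<delta> j\<bar> \<le> 1"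
  shows "card {x. 0 < x \<and> x < 1 \<and> cot_sum p B \<delta> x = 0} = 1"
proof -
  define e where "e = 1 / (4 * real p)"
  have e: "0 < e" "e < 1 - e" using p by (auto simp: e_def field_simps)
  have "cot_sum p B \<delta> e > 0" using cot_sum_near_0[of \<delta> e] assms e by (simp add: e_def)
  moreover have "cot_sum p B \<delta> (1 - e) < 0" using cot_sum_near_1[of \<delta> 1 e] assms e by (simp add: e_def)
  ultimately have "\<exists>z>e. z < 1 - e \<and> cot_sum p B \<delta> z = 0"
    using e by (intro zero_between[OF continuous_cot_sum]) (auto simp: mult_pos_neg)
  then obtain z where "e < z" "z < 1 - e" "cot_sum p B \<delta> z = 0" by blast
  hence z: "0 < z" "z < 1" "cot_sum p B \<delta> z = 0" using e by auto
  have unique: False if "0 < x" "x < y" "y < 1" "cot_sum p B \<delta> x = 0" "cot_sum p B \<delta> y = 0" for x y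
  proof (rule at_most_one_zero[of 0 1 "cot_sum p B \<delta>" "\<lambda>x. - cot_sum1 p B \<delta> x" x y])
    fix v :: real assume v: "0 < v" "v < 1"
    show "(cot_sum p B \<delta> has_real_derivative - cot_sum1 p B \<delta> v) (at v)"
      by (rule DERIV_cot_sum) (use v shift_nz[OF v] in auto)
    show "- cot_sum1 p B \<delta> v \<noteq> 0"
      using cot_sum1_pos[OF assms(1-4) \<delta> v] by simp
  qed (use that in auto)
  have "{x. 0 < x \<and> x < 1 \<and> cot_sum p B \<delta> x = 0} = {z}"
  proof safe
    fix x assume x: "0 < x" "x < 1" "cot_sum p B \<delta> x = 0"
    show "x = z" using unique[of x z] unique[of z x] x z by (cases x z rule: linorder_cases) auto
  qed (use z in auto)
  thus ?thesis by simp
qed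

lemma
  assumes B01: "0 \<in> B" "-1 \<in> B" "\<delta> 0 = 1" "\<delta> (-1) = -1" and \<delta>: "\<And>j. j \<in> B \<Longrightarrow> \<bar>\<delta> j\<bar> \<le> 1"
  defines "Z \<equiv> {x. 0 < x \<and> x < 1 \<and> cot_sum p B \<delta> x = 0}"
  shows cot_sum_zeros_opposite_sign: "finite Z \<and> card Z \<le> 2"
    and cot_sum_zeros_opposite_sign_eq_2: "0 < y \<Longrightarrow> y < 1 \<Longrightarrow> cot_sum p B \<delta> y < 0 \<Longrightarrow> card Z = 2"
proof -
  have d1: "(cot_sum p B \<delta> has_real_derivative - cot_sum1 p B \<delta> x) (at x)" if "0 < x" "x < 1" for x
    using that by (intro DERIV_cot_sum) (auto simp: shift_nz)
  have d2: "((\<lambda>x. - cot_sum1 p B \<delta> x) has_real_derivative cot_sum2 p B \<delta> x) (at x)" if "0 < x" "x < 1" for x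
    using DERIV_minus[OF DERIV_cot_sum1[of x \<delta>]] that by (auto simp: shift_nz)
  show le2: "finite Z \<and> card Z \<le> 2"
    unfolding Z_def by (rule at_most_two_zeros[OF d1 d2]) (use cot_sum2_pos[OF B01 \<delta>] in force)+
  assume y: "0 < y" "y < 1" "cot_sum p B \<delta> y < 0"
  define e where "e = 1 / (4 * real p)"
  have e: "0 < e" "e < 1" using p by (auto simp: e_def field_simps)
  have pe: "cot_sum p B \<delta> e > 0" using cot_sum_near_0[of \<delta> e] assms e by (simp add: e_def)
  have pe': "cot_sum p B \<delta> (1 - e) > 0" using cot_sum_near_1[of \<delta> "-1" e] assms e by (simp add: e_def)
  have "e < y"
    using cot_sum_near_0[of \<delta> y] assms y by (force simp: e_def not_less)
  moreover have "y < 1 - e"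
    using cot_sum_near_1[of \<delta> "-1" "1 - y"] assms y by (force simp: e_def not_less)
  ultimately have "\<exists>z>e. z < y \<and> cot_sum p B \<delta> z = 0" "\<exists>z>y. z < 1 - e \<and> cot_sum p B \<delta> z = 0"
    using e y pe pe' by (auto intro!: zero_between[OF continuous_cot_sum] simp: mult_pos_neg mult_neg_pos)
  then obtain z1 z2 where "e < z1" "z1 < y" "cot_sum p B \<delta> z1 = 0" "y < z2" "z2 < 1 - e" "cot_sum p B \<delta> z2 = 0"
    by blast
  hence "{z1, z2} \<subseteq> Z" "z1 \<noteq> z2" using e y by (auto simp: Z_def)
  hence "2 \<le> card Z" using card_mono[of Z "{z1, z2}"] le2 by simp
  thus "card Z = 2" using le2 by simp
qed

end

section \<open>The arcs next to the point 1\<close>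

text \<open>
  The terms \<open>j = n\<close> and \<open>j = -n\<close> are compared with the terms \<open>j = \<plusminus>1\<close>.  The left side is
  \<open>2 (n\<^sup>2 + x\<^sup>2) / (n\<^sup>2 - x\<^sup>2)\<^sup>2\<close>, and \<open>n\<^sup>2 + x\<^sup>2 \<le> n\<^sup>2 (1 + x\<^sup>2)\<close>, \<open>n\<^sup>2 - x\<^sup>2 \<ge> n\<^sup>2 (1 - x\<^sup>2)\<close>.
\<close>
lemma pair_inverse_squares_le:
  fixes n x :: real
  assumes "n \<ge> 1" "-1 < x" "x < 1"
  shows "1 / (n + x)\<^sup>2 + 1 / (n - x)\<^sup>2 \<le> 1 / n\<^sup>2 * (1 / (1 + x)\<^sup>2 + 1 / (1 - x)\<^sup>2)"
proof -
  have eq: "1 / (m + x)\<^sup>2 + 1 / (m - x)\<^sup>2 = 2 * (m\<^sup>2 + x\<^sup>2) / (m\<^sup>2 - x\<^sup>2)\<^sup>2" if "m \<ge> 1" for m :: real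
  proof -
    have "m + x \<noteq> 0" "m - x \<noteq> 0" using that assms by auto
    moreover have "m\<^sup>2 - x\<^sup>2 = (m + x) * (m - x)" by (simp add: power2_eq_square algebra_simps)
    ultimately show ?thesis by (simp add: power_mult_distrib divide_simps) (simp add: power2_eq_square algebra_simps)
  qed
  have x2: "x\<^sup>2 < 1" using assms by (simp add: abs_square_less_1)
  have n2: "n\<^sup>2 \<ge> 1" using assms by simp
  have nx: "1 * x\<^sup>2 \<le> n\<^sup>2 * x\<^sup>2" using n2 by (intro mult_right_mono) auto
  have "2 * (n\<^sup>2 + x\<^sup>2) / (n\<^sup>2 - x\<^sup>2)\<^sup>2 \<le> 2 * (n\<^sup>2 * (1 + x\<^sup>2)) / (n\<^sup>2 * (1 - x\<^sup>2))\<^sup>2"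
    using n2 x2 nx by (intro frac_le power_mono mult_nonneg_nonneg) (auto simp: algebra_simps)
  also have "\<dots> = 1 / n\<^sup>2 * (2 * (1\<^sup>2 + x\<^sup>2) / (1\<^sup>2 - x\<^sup>2)\<^sup>2)"
    using n2 x2 by (simp add: divide_simps) (simp add: eval_nat_numeral algebra_simps)
  finally show ?thesis using eq[of n] eq[of 1] assms by simp
qed

lemma pair_inverse_cubes_le:
  fixes n x :: real
  assumes "n \<ge> 1" "-1 < x" "x < 1"
  shows "1 / (n + x) ^ 3 + 1 / (n - x) ^ 3 \<le> 1 / n ^ 3 * (1 / (1 + x) ^ 3 + 1 / (1 - x) ^ 3)"
proof -
  have eq: "1 / (m + x) ^ 3 + 1 / (m - x) ^ 3 = 2 * m * (m\<^sup>2 + 3 * x\<^sup>2) / (m\<^sup>2 - x\<^sup>2) ^ 3" if "m \<ge> 1" for m :: real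
  proof -
    have "m + x \<noteq> 0" "m - x \<noteq> 0" using that assms by auto
    moreover have "m\<^sup>2 - x\<^sup>2 = (m + x) * (m - x)" by (simp add: power2_eq_square algebra_simps)
    ultimately show ?thesis
      by (simp add: power_mult_distrib divide_simps) (simp add: power2_eq_square power3_eq_cube algebra_simps)
  qed
  have x2: "x\<^sup>2 < 1" using assms by (simp add: abs_square_less_1)
  have n2: "n\<^sup>2 \<ge> 1" using assms by simp
  have nx: "1 * x\<^sup>2 \<le> n\<^sup>2 * x\<^sup>2" using n2 by (intro mult_right_mono) auto
  have "2 * n * (n\<^sup>2 + 3 * x\<^sup>2) / (n\<^sup>2 - x\<^sup>2) ^ 3 \<le> 2 * n * (n\<^sup>2 * (1 + 3 * x\<^sup>2)) / (n\<^sup>2 * (1 - x\<^sup>2)) ^ 3"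
    using n2 x2 nx assms
    by (intro frac_le power_mono mult_nonneg_nonneg mult_left_mono) (auto simp: algebra_simps)
  also have "\<dots> = 1 / n ^ 3 * (2 * 1 * (1\<^sup>2 + 3 * x\<^sup>2) / (1\<^sup>2 - x\<^sup>2) ^ 3)"
    using n2 x2 assms
    by (simp add: divide_simps) (simp add: eval_nat_numeral algebra_simps)
  finally show ?thesis using eq[of n] eq[of 1] assms by simp
qed

lemma sum_symmetric_ints:
  "(\<Sum>j | 2 \<le> \<bar>j\<bar> \<and> \<bar>j\<bar> \<le> int k. f j) = (\<Sum>n=2..k. f (int n) + f (- int n) :: real)"
proof -
  have "{j. 2 \<le> \<bar>j\<bar> \<and> \<bar>j\<bar> \<le> int k} = int ` {2..k} \<union> (\<lambda>n. - int n) ` {2..k}" (is "?L = ?R")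
  proof (intro equalityI subsetI)
    fix j assume j: "j \<in> ?L"
    show "j \<in> ?R"
    proof (cases "j \<ge> 0")
      case True
      hence "j = int (nat j)" "nat j \<in> {2..k}" using j by auto
      thus ?thesis by blast
    next
      case False
      hence "j = - int (nat (- j))" "nat (- j) \<in> {2..k}" using j by auto
      thus ?thesis by blast
    qed
  qed auto
  hence "sum f ?L = sum f (int ` {2..k}) + sum f ((\<lambda>n. - int n) ` {2..k})"
    by (simp only:) (rule sum.union_disjoint, auto)
  thus ?thesis by (simp add: sum.reindex inj_on_def sum.distrib)
qed

context
  fixes p k :: nat and \<delta> :: "int \<Rightarrow> real"
  assumes p: "p \<ge> 100" and k: "k \<ge> 1" "2 * k + 1 \<le> p"
    and \<delta>1: "\<bar>\<delta> 1\<bar> = 1" and \<delta>: "\<And>j. \<bar>\<delta> j\<bar> \<le> 1"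
begin

abbreviation (input) "sym_ints \<equiv> {j :: int. j \<noteq> 0 \<and> \<bar>j\<bar> \<le> int k}"
abbreviation (input) "far_ints \<equiv> {j :: int. 2 \<le> \<bar>j\<bar> \<and> \<bar>j\<bar> \<le> int k}"

lemma sym_ints_split: "sym_ints = insert 1 (insert (-1) far_ints)"
  using k by auto

lemma finite_far_ints: "finite far_ints"
  by (rule finite_subset[of _ "{- int k..int k}"]) auto

lemma sym_ints_bound: "j \<in> sym_ints \<Longrightarrow> 2 * \<bar>j\<bar> + 1 \<le> int p"
  using k by auto

text \<open>
  On the two arcs that meet at \<open>1\<close> the term \<open>j = 0\<close> is missing, because \<open>\<chi>(0) = 0\<close>, and neither monotonicity nor convexity
  on \<open>(0,1)\<close> is available.  On \<open>(-1,1)\<close> the terms \<open>j = \<plusminus>1\<close> dominate instead.  If their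
  signs agree, the sum is monotone; if they are opposite, its second derivative has no zero.
\<close>
lemma central_zeros:
  assumes "\<delta> (-1) = \<delta> 1 \<or> \<delta> (-1) = - \<delta> 1"
  defines "Z \<equiv> {x. -1 < x \<and> x < 1 \<and> cot_sum p sym_ints \<delta> x = 0}"
  shows "finite Z \<and> card Z \<le> 2"
proof -
  have nz: "x + of_int j \<noteq> 0" if "-1 < x" "x < 1" "j \<in> sym_ints" for x :: real and j
  proof
    assume "x + of_int j = 0"
    moreover have "real_of_int j \<ge> 1 \<or> real_of_int j \<le> -1" using that(3) by auto
    ultimately show False using that by linarith
  qed
  have d1: "(cot_sum p sym_ints \<delta> has_real_derivative - cot_sum1 p sym_ints \<delta> x) (at x)" if "-1 < x" "x < 1" for x
    by (rule DERIV_cot_sum[OF p sym_ints_bound]) (use that nz in auto)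
  have d2: "((\<lambda>x. - cot_sum1 p sym_ints \<delta> x) has_real_derivative cot_sum2 p sym_ints \<delta> x) (at x)"
    if "-1 < x" "x < 1" for x
    using DERIV_minus[OF DERIV_cot_sum1[OF p sym_ints_bound, of sym_ints x \<delta>]] that nz by auto
  have ss: "\<delta> 1 * \<delta> 1 = 1" using \<delta>1 by (metis abs_mult_self_eq mult_1)
  show ?thesis
    using assms(1)
  proof
    assume eq: "\<delta> (-1) = \<delta> 1"
    have pos: "cot_sum1 p sym_ints \<delta> x \<noteq> 0" if x: "-1 < x" "x < 1" for x
    proof -
      define h where "h = 1 / (1 + x)\<^sup>2 + 1 / (1 - x)\<^sup>2"
      define S where "S = (\<Sum>j\<in>far_ints. \<delta> j * cot_kernel1 p (x + of_int j))"
      have "cot_sum1 p sym_ints \<delta> x = \<delta> 1 * cot_kernel1 p (x + 1) + \<delta> 1 * cot_kernel1 p (x - 1) + S"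
        unfolding cot_sum1_def sym_ints_split S_def using finite_far_ints eq by simp
      hence "\<delta> 1 * cot_sum1 p sym_ints \<delta> x = (\<delta> 1 * \<delta> 1) * (cot_kernel1 p (x + 1) + cot_kernel1 p (x - 1)) + \<delta> 1 * S"
        by (simp add: algebra_simps)
      hence 1: "\<delta> 1 * cot_sum1 p sym_ints \<delta> x = cot_kernel1 p (x + 1) + cot_kernel1 p (x - 1) + \<delta> 1 * S"
        by (simp add: ss)
      have "1 / (x + 1)\<^sup>2 \<le> cot_kernel1 p (x + 1)" using x p by (intro cot_kernel1_bounds(1)[OF p]) auto
      moreover have "1 / (x - 1)\<^sup>2 \<le> cot_kernel1 p (x - 1)" using x p by (intro cot_kernel1_bounds(1)[OF p]) auto
      moreover have "(x - 1)\<^sup>2 = (1 - x)\<^sup>2" by (simp add: power2_commute)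
      ultimately have 2: "h \<le> cot_kernel1 p (x + 1) + cot_kernel1 p (x - 1)" by (simp add: h_def add.commute)
      have h2: "h \<ge> 2"
      proof -
        have c: "1 / z\<^sup>2 \<ge> 3 - 2 * z" if "z > 0" for z :: real
        proof -
          have "0 \<le> (z - 1)\<^sup>2 * (2 * z + 1)" using that by (intro mult_nonneg_nonneg) auto
          hence "(3 - 2 * z) * z\<^sup>2 \<le> 1" by (simp add: power2_eq_square algebra_simps)
          thus ?thesis using that by (simp add: field_simps)
        qed
        show ?thesis using c[of "1 + x"] c[of "1 - x"] x by (simp add: h_def)
      qed
      have "\<bar>S\<bar> \<le> (\<Sum>j\<in>far_ints. 1 / (x + of_int j)\<^sup>2) + 10 / p"
        unfolding S_def by (rule sum_cot_kernel1_le[where B = sym_ints, OF p]) (use x nz \<delta> k in auto)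
      also have "(\<Sum>j\<in>far_ints. 1 / (x + of_int j)\<^sup>2) = (\<Sum>n=2..k. 1 / (real n + x)\<^sup>2 + 1 / (real n - x)\<^sup>2)"
        by (subst sum_symmetric_ints) (simp add: add.commute power2_commute)
      also have "\<dots> \<le> (\<Sum>n=2..k. 1 / (real n)\<^sup>2 * h)"
        unfolding h_def by (intro sum_mono pair_inverse_squares_le x) auto
      also have "\<dots> = (\<Sum>n=2..k. 1 / (real n)\<^sup>2) * h" by (simp add: sum_distrib_right)
      also have "(\<Sum>n=2..k. 1 / (real n)\<^sup>2) \<le> 11 / 12"
      proof (cases "k \<ge> 2")
        case True
        have "(\<Sum>n=2..k. 1 / (real n)\<^sup>2) = 1 / 4 + (\<Sum>n=3..k. 1 / (real n)\<^sup>2)"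
          using True by (simp add: sum.atLeast_Suc_atMost)
        thus ?thesis using sum_inverse_squares_le[of 3 k] by simp
      qed simp
      finally have 3: "\<bar>S\<bar> \<le> 11 / 12 * h + 10 / p"
        using h2 by (simp add: mult_right_mono)
      have "\<bar>\<delta> 1 * S\<bar> = \<bar>S\<bar>" using \<delta>1 by (simp add: abs_mult)
      moreover have "10 / real p \<le> 1 / 10" using p by simp
      moreover have "- \<bar>\<delta> 1 * S\<bar> \<le> \<delta> 1 * S" by simp
      ultimately have "\<delta> 1 * cot_sum1 p sym_ints \<delta> x > 0"
        unfolding 1 using 2 3 h2 by linarith
      thus ?thesis by auto
    qed
    show ?thesis unfolding Z_def
    proof (rule card_le_2I)
      fix x y z assume Z: "x \<in> {x. -1 < x \<and> x < 1 \<and> cot_sum p sym_ints \<delta> x = 0}"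
        "y \<in> {x. -1 < x \<and> x < 1 \<and> cot_sum p sym_ints \<delta> x = 0}" "x < y"
      show False
        by (rule at_most_one_zero[of "-1" 1 "cot_sum p sym_ints \<delta>" "\<lambda>x. - cot_sum1 p sym_ints \<delta> x" x y])
           (use Z d1 pos in auto)
    qed
  next
    assume eq: "\<delta> (-1) = - \<delta> 1"
    have pos: "cot_sum2 p sym_ints \<delta> x \<noteq> 0" if x: "-1 < x" "x < 1" for x
    proof -
      define h where "h = 1 / (1 + x) ^ 3 + 1 / (1 - x) ^ 3"
      define S where "S = (\<Sum>j\<in>far_ints. \<delta> j * cot_kernel2 p (x + of_int j))"
      have m: "cot_kernel2 p (x - 1) = - cot_kernel2 p (1 - x)" using cot_kernel_minus(3)[of p "1 - x"] by simp
      have "cot_sum2 p sym_ints \<delta> x = \<delta> 1 * cot_kernel2 p (1 + x) - \<delta> 1 * cot_kernel2 p (x - 1) + S"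
        unfolding cot_sum2_def sym_ints_split S_def using finite_far_ints eq by (simp add: add.commute)
      hence "\<delta> 1 * cot_sum2 p sym_ints \<delta> x = (\<delta> 1 * \<delta> 1) * (cot_kernel2 p (1 + x) + cot_kernel2 p (1 - x)) + \<delta> 1 * S"
        by (simp add: m algebra_simps)
      hence 1: "\<delta> 1 * cot_sum2 p sym_ints \<delta> x = cot_kernel2 p (1 + x) + cot_kernel2 p (1 - x) + \<delta> 1 * S"
        by (simp add: ss)
      have "9 / 5 / (1 + x) ^ 3 \<le> cot_kernel2 p (1 + x)" using x by (intro cot_kernel2_ge[OF p]) auto
      moreover have "9 / 5 / (1 - x) ^ 3 \<le> cot_kernel2 p (1 - x)" using x by (intro cot_kernel2_ge[OF p]) auto
      ultimately have 2: "9 / 5 * h \<le> cot_kernel2 p (1 + x) + cot_kernel2 p (1 - x)" by (simp add: h_def)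
      have ge1: "\<bar>x + of_int j\<bar> \<ge> 1" if "j \<in> far_ints" for j
      proof -
        have "real_of_int j \<ge> 2 \<or> real_of_int j \<le> -2" using that by auto
        thus ?thesis using x abs_ge_self[of "x + of_int j"] abs_ge_minus_self[of "x + of_int j"] by argo
      qed
      have h2: "h \<ge> 2"
      proof -
        have c: "1 / z ^ 3 \<ge> 4 - 3 * z" if "z > 0" for z :: real
        proof -
          have "0 \<le> (z - 1)\<^sup>2 * (3 * z\<^sup>2 + 2 * z + 1)" using that by (intro mult_nonneg_nonneg) auto
          hence "(4 - 3 * z) * z ^ 3 \<le> 1" by (simp add: power2_eq_square power3_eq_cube algebra_simps)
          thus ?thesis using that by (simp add: field_simps)
        qed
        show ?thesis using c[of "1 + x"] c[of "1 - x"] x by (simp add: h_def)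
      qed
      have "\<bar>S\<bar> \<le> 2 * (\<Sum>j\<in>far_ints. 1 / \<bar>x + of_int j\<bar> ^ 3) + 20 / p"
        unfolding S_def by (rule sum_cot_kernel2_le[where B = sym_ints, OF p]) (use x ge1 \<delta> k in auto)
      also have "(\<Sum>j\<in>far_ints. 1 / \<bar>x + of_int j\<bar> ^ 3) = (\<Sum>n=2..k. 1 / (real n + x) ^ 3 + 1 / (real n - x) ^ 3)"
      proof (subst sum_symmetric_ints, rule sum.cong)
        fix n assume "n \<in> {2..k}"
        hence "\<bar>x + real n\<bar> = real n + x" "\<bar>x - real n\<bar> = real n - x" using x by auto
        thus "1 / \<bar>x + real_of_int (int n)\<bar> ^ 3 + 1 / \<bar>x + real_of_int (- int n)\<bar> ^ 3
              = 1 / (real n + x) ^ 3 + 1 / (real n - x) ^ 3" by simp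
      qed simp
      also have "\<dots> \<le> (\<Sum>n=2..k. 1 / real n ^ 3 * h)"
        unfolding h_def by (intro sum_mono pair_inverse_cubes_le x) auto
      also have "\<dots> = (\<Sum>n=2..k. 1 / real n ^ 3) * h" by (simp add: sum_distrib_right)
      also have "(\<Sum>n=2..k. 1 / real n ^ 3) \<le> (\<Sum>n=2..k. 1 / (real n)\<^sup>2 / 2)"
        by (intro sum_mono) (auto simp: field_simps power2_eq_square power3_eq_cube)
      also have "\<dots> = (\<Sum>n=2..k. 1 / (real n)\<^sup>2) / 2" by (rule sum_divide_distrib[symmetric])
      also have "\<dots> \<le> 1 / 2" using sum_inverse_squares_le[of 2 k] by simp
      finally have "\<bar>S\<bar> \<le> 2 * (1 / 2 * h) + 20 / p" using h2 by (simp add: mult_right_mono)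
      hence 3: "\<bar>S\<bar> \<le> h + 20 / p" by simp
      have "\<bar>\<delta> 1 * S\<bar> = \<bar>S\<bar>" using \<delta>1 by (simp add: abs_mult)
      moreover have "20 / real p \<le> 1 / 5" using p by simp
      moreover have "- \<bar>\<delta> 1 * S\<bar> \<le> \<delta> 1 * S" by simp
      ultimately have "\<delta> 1 * cot_sum2 p sym_ints \<delta> x > 0"
        unfolding 1 using 2 3 h2 by linarith
      thus ?thesis by auto
    qed
    show ?thesis unfolding Z_def by (rule at_most_two_zeros[OF d1 d2 pos])
  qed
qed

end

section \<open>Interpolation of the Fekete polynomial at roots of unity\<close>

lemma sum_periodic_eq:
  fixes f :: "int \<Rightarrow> 'b::comm_monoid_add"
  assumes per: "\<And>k. f (k mod int p) = f k" and A: "finite A" "card A = p" "inj_on (\<lambda>k. k mod int p) A"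
    and "p > 0"
  shows "sum f A = sum f {0..<int p}"
proof -
  have "(\<lambda>k. k mod int p) ` A = {0..<int p}"
    by (rule card_subset_eq) (use assms in \<open>auto simp: card_image\<close>)
  hence "sum f {0..<int p} = (\<Sum>k\<in>A. f (k mod int p))"
    using sum.reindex[OF A(3), of f] by simp
  thus ?thesis by (simp add: per)
qed

lemma inj_on_mod:
  assumes "\<And>i j. i \<in> A \<Longrightarrow> j \<in> A \<Longrightarrow> \<bar>i - j\<bar> < int p"
  shows "inj_on (\<lambda>k. k mod int p) A"
proof (rule inj_onI)
  fix i j assume ij: "i \<in> A" "j \<in> A" "i mod int p = j mod int p"
  hence "int p dvd i - j" by (simp only: mod_eq_dvd_iff)
  thus "i = j" using assms[OF ij(1,2)] dvd_imp_le_int[of "i - j" "int p"] by linarith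
qed

lemma sin_diff_int: "sin (pi * (t - of_int k)) = (if even k then 1 else -1) * sin (pi * t)"
  and cis_diff_int: "cis (- (pi * (t - of_int k))) = (if even k then 1 else -1) * cis (- (pi * t))"
proof -
  have c: "cos (pi * of_int k) = (if even k then 1 else -1)" "sin (pi * of_int k) = 0"
    by (simp_all add: cos_npi_int sin_npi_int)
  show "sin (pi * (t - of_int k)) = (if even k then 1 else -1) * sin (pi * t)"
    using c by (simp add: right_diff_distrib sin_diff)
  show "cis (- (pi * (t - of_int k))) = (if even k then 1 else -1) * cis (- (pi * t))"
    using c by (simp add: right_diff_distrib complex_eq_iff cos_diff sin_diff)
qed

context
  fixes p :: nat
  assumes prime: "prime p" and odd: "odd p"
begin

lemma p_gt_2: "p > 2"
  using prime_gt_1_nat[OF prime] odd by (cases "p = 2") auto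

lemma Legendre_cong: "[a = b] (mod int p) \<Longrightarrow> Legendre a (int p) = Legendre b (int p)"
  by (simp add: Legendre_def QuadRes_def cong_def)

lemma Legendre_mod: "Legendre (a mod int p) (int p) = Legendre a (int p)"
  by (rule Legendre_cong) (simp add: cong_def)

lemma Legendre_eq_0_iff: "Legendre a (int p) = 0 \<longleftrightarrow> int p dvd a"
  by (auto simp: Legendre_def cong_0_iff)

lemma Legendre_values: "Legendre a (int p) \<in> {-1, 0, 1}"
  by (auto simp: Legendre_def)

lemma Legendre_square: "\<not> int p dvd a \<Longrightarrow> Legendre a (int p) * Legendre a (int p) = 1"
  using Legendre_eq_0_iff[of a] Legendre_values[of a] by auto

lemma Legendre_1: "Legendre 1 (int p) = 1"
proof -
  have "\<not> int p dvd 1" using p_gt_2 by (simp add: zdvd1_eq)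
  moreover have "QuadRes (int p) 1" unfolding QuadRes_def by (rule exI[of _ 1]) simp
  ultimately show ?thesis by (simp add: Legendre_def cong_0_iff)
qed

lemma Legendre_mult: "Legendre (a * b) (int p) = Legendre a (int p) * Legendre b (int p)"
proof -
  have "[Legendre a (int p) * Legendre b (int p) = a ^ ((p - 1) div 2) * b ^ ((p - 1) div 2)] (mod int p)"
    by (intro cong_mult euler_criterion prime p_gt_2)
  moreover have "[Legendre (a * b) (int p) = (a * b) ^ ((p - 1) div 2)] (mod int p)"
    by (intro euler_criterion prime p_gt_2)
  ultimately have "[Legendre (a * b) (int p) = Legendre a (int p) * Legendre b (int p)] (mod int p)"
    by (metis cong_sym cong_trans power_mult_distrib)
  hence dvd: "int p dvd Legendre (a * b) (int p) - Legendre a (int p) * Legendre b (int p)"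
    by (simp add: cong_iff_dvd_diff)
  have "\<bar>Legendre (a * b) (int p) - Legendre a (int p) * Legendre b (int p)\<bar> \<le> 2"
    using Legendre_values[of a] Legendre_values[of b] Legendre_values[of "a * b"] by auto
  hence "\<bar>Legendre (a * b) (int p) - Legendre a (int p) * Legendre b (int p)\<bar> < \<bar>int p\<bar>"
    using p_gt_2 by simp
  hence "Legendre (a * b) (int p) - Legendre a (int p) * Legendre b (int p) = 0"
    using dvd dvd_imp_le_int[of "Legendre (a * b) (int p) - Legendre a (int p) * Legendre b (int p)" "int p"]
    by linarith
  thus ?thesis by simp
qed

lemma sum_mod_mult:
  fixes f :: "int \<Rightarrow> 'b::comm_monoid_add"
  assumes "\<And>k. f (k mod int p) = f k" "\<not> int p dvd a"
  shows "(\<Sum>k\<in>{0..<int p}. f (a * k)) = sum f {0..<int p}"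
proof -
  have inj: "inj_on (\<lambda>k. (a * k) mod int p) {0..<int p}"
  proof (rule inj_onI)
    fix k l assume kl: "k \<in> {0..<int p}" "l \<in> {0..<int p}" "(a * k) mod int p = (a * l) mod int p"
    hence "int p dvd a * (k - l)" by (simp add: mod_eq_dvd_iff right_diff_distrib)
    hence "int p dvd k - l"
      using prime assms(2) by (simp add: prime_dvd_mult_iff)
    thus "k = l" using kl(1,2) zdvd_imp_le[of "int p" "\<bar>k - l\<bar>"] by (cases "k = l") auto
  qed
  have i1: "inj_on ((*) a) {0..<int p}"
    using assms(2) by (auto simp: inj_on_def)
  have "sum f ((*) a ` {0..<int p}) = sum f {0..<int p}"
  proof (rule sum_periodic_eq)
    show "inj_on (\<lambda>k. k mod int p) ((*) a ` {0..<int p})"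
      by (rule inj_on_imageI) (use inj in \<open>simp add: comp_def\<close>)
  qed (use assms p_gt_2 i1 in \<open>simp_all add: card_image\<close>)
  thus ?thesis by (simp add: sum.reindex[OF i1])
qed

text \<open>
  It suffices that some quadratic nonresidue exists.  Without one the correlation of \<open>\<chi>\<close> with a
  shift of itself could not be the negative number \<open>-1\<close>.
\<close>
lemma sum_Legendre: "(\<Sum>k\<in>{0..<int p}. Legendre k (int p)) = 0"
proof -
  have "\<exists>b. Legendre b (int p) = -1"
  proof (rule ccontr)
    assume "\<nexists>b. Legendre b (int p) = -1"
    hence nn: "Legendre b (int p) \<ge> 0" for b using Legendre_values[of b] by fastforce
    have "[0 \<noteq> 1] (mod int p)" using p_gt_2 by (simp add: cong_def)
    hence "(\<Sum>m<p. Legendre (int m - 0) (int p) * Legendre (int m - 1) (int p)) = -1"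
      using legendre_sums_small[OF prime odd] unfolding legendre_sums_small_def by blast
    moreover have "(\<Sum>m<p. Legendre (int m - 0) (int p) * Legendre (int m - 1) (int p)) \<ge> 0"
      by (intro sum_nonneg mult_nonneg_nonneg nn)
    ultimately show False by simp
  qed
  then obtain b where b: "Legendre b (int p) = -1" by blast
  hence "\<not> int p dvd b" using Legendre_eq_0_iff[of b] by simp
  hence "(\<Sum>k\<in>{0..<int p}. Legendre (b * k) (int p)) = (\<Sum>k\<in>{0..<int p}. Legendre k (int p))"
    by (intro sum_mod_mult) (simp_all add: Legendre_mod)
  thus ?thesis by (simp add: Legendre_mult b sum_negf)
qed

definition unit_char :: "int \<Rightarrow> complex" where
  "unit_char n = cis (2 * pi * n / p)"

lemma unit_char_add: "unit_char (a + b) = unit_char a * unit_char b"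
  by (simp add: unit_char_def cis_mult add_divide_distrib distrib_left)

lemma unit_char_multiple: "unit_char (int p * n) = 1"
  using p_gt_2 cis_multiple_2pi[of "of_int n"] by (simp add: unit_char_def mult.assoc)

lemma unit_char_mod: "unit_char (n mod int p) = unit_char n"
proof -
  have "unit_char n = unit_char (int p * (n div int p) + n mod int p)" by simp
  thus ?thesis unfolding unit_char_add unit_char_multiple by simp
qed

lemma unit_char_power: "unit_char n ^ a = unit_char (int a * n)"
  by (simp add: unit_char_def Complex.DeMoivre mult_ac)

definition gauss_sum :: complex where
  "gauss_sum = (\<Sum>k\<in>{0..<int p}. of_int (Legendre k (int p)) * unit_char k)"

lemma gauss_sum_twist:
  "(\<Sum>k\<in>{0..<int p}. of_int (Legendre k (int p)) * unit_char (a * k))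
     = of_int (Legendre a (int p)) * gauss_sum"
proof (cases "int p dvd a")
  case True
  then obtain c where c: "a = int p * c" by blast
  have "unit_char (a * k) = 1" for k using unit_char_multiple[of "c * k"] by (simp add: c mult.assoc)
  moreover have "(\<Sum>k\<in>{0..<int p}. complex_of_int (Legendre k (int p))) = 0"
    using sum_Legendre by (metis of_int_0 of_int_sum)
  ultimately show ?thesis using True by (simp add: Legendre_eq_0_iff[THEN iffD2])
next
  case False
  define f where "f = (\<lambda>k. of_int (Legendre k (int p)) * unit_char k)"
  have "gauss_sum = (\<Sum>k\<in>{0..<int p}. f (a * k))"
    unfolding gauss_sum_def
    by (subst sum_mod_mult[OF _ False]) (simp_all add: f_def Legendre_mod unit_char_mod)
  also have "\<dots> = of_int (Legendre a (int p))
      * (\<Sum>k\<in>{0..<int p}. of_int (Legendre k (int p)) * unit_char (a * k))"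
    by (simp add: f_def Legendre_mult sum_distrib_left mult.assoc)
  finally have "of_int (Legendre a (int p)) * gauss_sum =
     of_int (Legendre a (int p) * Legendre a (int p))
      * (\<Sum>k\<in>{0..<int p}. of_int (Legendre k (int p)) * unit_char (a * k))"
    by simp
  thus ?thesis by (simp add: Legendre_square[OF False])
qed

lemma poly_fekete: "poly (fekete_poly p) z = (\<Sum>a<p. of_int (Legendre (int a) (int p)) * z ^ a)"
  by (simp add: fekete_poly_def poly_sum poly_monom)

lemma sum_int_atLeast0: "sum f {0..<int p} = (\<Sum>a<p. f (int a))"
  by (rule sum.reindex_bij_witness[of _ int nat]) auto

lemma poly_fekete_unit_char:
  "poly (fekete_poly p) (unit_char a) = of_int (Legendre a (int p)) * gauss_sum"
  using gauss_sum_twist[of a]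
  by (simp add: poly_fekete unit_char_power sum_int_atLeast0 mult.commute)

text \<open>
  If the Gauss sum were zero, the Fekete polynomial would vanish at all \<open>p\<close>-th roots of unity, which
  are more than its degree allows.
\<close>
lemma gauss_sum_nz: "gauss_sum \<noteq> 0"
proof
  assume 0: "gauss_sum = 0"
  have c1: "poly.coeff (fekete_poly p) 1 = 1"
    using p_gt_2 Legendre_1 by (simp add: fekete_poly_def coeff_sum sum.delta)
  hence nz: "fekete_poly p \<noteq> 0" by auto
  have "{z :: complex. z ^ p = 1} \<subseteq> {z. poly (fekete_poly p) z = 0}"
  proof
    fix z :: complex assume "z \<in> {z. z ^ p = 1}"
    moreover have "(\<lambda>k. cis (2 * pi * real k / real p)) ` {..<p} = {z. z ^ p = 1}"
      using p_gt_2 by (intro bij_betw_imp_surj_on Complex.bij_betw_roots_unity) simp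
    ultimately obtain k where "z = cis (2 * pi * real k / real p)" by blast
    hence "z = unit_char (int k)" by (simp only: unit_char_def of_int_of_nat_eq)
    thus "z \<in> {z. poly (fekete_poly p) z = 0}" by (simp add: poly_fekete_unit_char 0)
  qed
  hence "card {z :: complex. z ^ p = 1} \<le> card {z. poly (fekete_poly p) z = 0}"
    by (intro card_mono poly_roots_finite nz)
  also have "\<dots> \<le> degree (fekete_poly p)" by (rule card_poly_roots_bound[OF nz])
  also have "\<dots> \<le> p - 1"
    unfolding fekete_poly_def
    by (intro degree_sum_le) (auto intro!: order_trans[OF degree_monom_le])
  finally show False using card_roots_unity_eq[of p] p_gt_2 by simp
qed

text \<open>
  The right side is the trigonometric sum over \<open>0, ..., p\<close> in which the two end terms
  have weight \<open>1/2\<close>.  This symmetric choice makes the kernel real, a cotangent rather than a geometric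
  series quotient; the end terms will not matter because \<open>\<chi>(0) = \<chi>(p) = 0\<close>.
\<close>
lemma sin_cot_kernel:
  fixes s :: real
  assumes "sin (pi * s / p) \<noteq> 0"
  defines "w \<equiv> cis (2 * pi * s / p)"
  shows "of_real (sin (pi * s) * cot (pi * s / p)) = cis (- (pi * s)) * (\<Sum>a<p. w ^ a + w ^ Suc a) / 2"
proof -
  define v where "v = cis (pi * s / p)"
  have p0: "real p \<noteq> 0" using p_gt_2 by simp
  have w: "w = v * v" by (simp add: w_def v_def cis_mult mult.assoc)
  have vv: "v * cnj v = 1" by (simp add: v_def cis_mult cis_cnj)
  have wp: "w ^ p = cis (pi * s) * cis (pi * s)"
    using p0 by (simp add: w_def Complex.DeMoivre cis_mult mult.assoc)
  have s: "v - cnj v = 2 * \<i> * sin (pi * s / p)" "v + cnj v = 2 * cos (pi * s / p)"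
    by (simp_all add: v_def complex_eq_iff)
  have S: "cis (pi * s) - cis (- (pi * s)) = 2 * \<i> * sin (pi * s)"
    by (simp add: complex_eq_iff)
  have w1: "w - 1 = v * (v - cnj v)" "1 + w = v * (v + cnj v)"
    using vv by (simp_all add: w algebra_simps)
  have v0: "v \<noteq> 0" by (simp add: v_def)
  have w0: "w \<noteq> 1" using w1(1) v0 s(1) assms(1) by auto
  have geo: "(\<Sum>a<p. w ^ a) = (w ^ p - 1) / (w - 1)" using geometric_sum[OF w0, of p] by simp
  have "cis (- (pi * s)) * (w ^ p - 1) = cis (pi * s) * (cis (pi * s) * cis (- (pi * s))) - cis (- (pi * s))"
    unfolding wp by (simp add: algebra_simps)
  also have "cis (pi * s) * cis (- (pi * s)) = 1" by (simp add: cis_mult)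
  finally have top: "cis (- (pi * s)) * (w ^ p - 1) = 2 * \<i> * sin (pi * s)"
    using S by simp
  have "(\<Sum>a<p. w ^ a + w ^ Suc a) = (\<Sum>a<p. w ^ a) * (1 + w)"
    by (simp add: sum.distrib sum_distrib_right sum_distrib_left algebra_simps)
  hence "cis (- (pi * s)) * (\<Sum>a<p. w ^ a + w ^ Suc a) / 2
      = (cis (- (pi * s)) * (w ^ p - 1)) * (1 + w) / (w - 1) / 2"
    by (simp add: geo)
  also have "\<dots> = 2 * \<i> * sin (pi * s) * (v * (v + cnj v)) / (v * (v - cnj v)) / 2"
    by (simp only: top w1)
  also have "\<dots> = of_real (sin (pi * s) * cot (pi * s / p))"
    using assms(1) v0 unfolding s by (simp add: cot_def field_simps)
  finally show ?thesis ..
qed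

theorem fekete_interpolation:
  fixes t :: real
  assumes t: "sin (pi * t) \<noteq> 0"
  shows "of_real (sin (pi * t) * (\<Sum>k\<in>{0..<int p}. Legendre k (int p) * cot (pi * (t - of_int k) / p)))
     = cis (- (pi * t)) * gauss_sum * of_int (Legendre (-1) (int p)) * poly (fekete_poly p) (cis (2 * pi * t / p))"
proof -
  define z where "z = cis (2 * pi * t / p)"
  have p0: "real p \<noteq> 0" using p_gt_2 by simp
  have kterm: "of_real (sin (pi * t) * cot (pi * (t - of_int k) / p))
       = cis (- (pi * t)) / 2 * (\<Sum>a<p. z ^ a * unit_char (- int a * k) + z ^ Suc a * unit_char (- int (Suc a) * k))"
    for k :: int
  proof -
    have nz: "sin (pi * (t - of_int k) / p) \<noteq> 0"
    proof
      assume "sin (pi * (t - of_int k) / p) = 0"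
      then obtain i :: int where "pi * (t - of_int k) / p = of_int i * pi"
        using sin_zero_iff_int2 by blast
      hence "pi * (t - of_int k) = pi * (of_int i * real p)" using p0 by (simp add: field_simps)
      hence "t - of_int k = of_int i * real p" by (simp only: mult_cancel_left) simp
      hence "t = of_int (k + i * int p)" by simp
      hence "pi * t = of_int (k + i * int p) * pi" by simp
      hence "sin (pi * t) = 0" by (metis sin_zero_iff_int2)
      thus False using t by contradiction
    qed
    define w where "w = cis (2 * pi * (t - of_int k) / p)"
    have w: "w ^ a = z ^ a * unit_char (- int a * k)" for a
      unfolding w_def z_def unit_char_def Complex.DeMoivre cis_mult
      by (rule arg_cong[of _ _ cis]) (simp add: diff_divide_distrib algebra_simps)
    have "of_real (sin (pi * (t - of_int k)) * cot (pi * (t - of_int k) / p))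
      = cis (- (pi * (t - of_int k))) * (\<Sum>a<p. w ^ a + w ^ Suc a) / 2"
      unfolding w_def by (rule sin_cot_kernel[OF nz])
    hence "of_real (sin (pi * t) * cot (pi * (t - of_int k) / p))
      = cis (- (pi * t)) / 2 * (\<Sum>a<p. w ^ a + w ^ Suc a)"
      unfolding sin_diff_int cis_diff_int by (cases "even k") simp_all
    thus ?thesis unfolding w .
  qed
  define L where "L = (\<lambda>k. complex_of_int (Legendre k (int p)))"
  have twist: "(\<Sum>k\<in>{0..<int p}. L k * unit_char (- int a * k)) = L (- int a) * gauss_sum" for a
    unfolding L_def by (rule gauss_sum_twist)
  have "of_real (sin (pi * t) * (\<Sum>k\<in>{0..<int p}. Legendre k (int p) * cot (pi * (t - of_int k) / p)))
     = (\<Sum>k\<in>{0..<int p}. L k * of_real (sin (pi * t) * cot (pi * (t - of_int k) / p)))"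
    by (simp add: L_def sum_distrib_left mult_ac)
  also have "\<dots> = (\<Sum>k\<in>{0..<int p}. \<Sum>a<p. cis (- (pi * t)) / 2 *
       (z ^ a * (L k * unit_char (- int a * k)) + z ^ Suc a * (L k * unit_char (- int (Suc a) * k))))"
    unfolding kterm sum_distrib_left by (intro sum.cong refl) (simp add: algebra_simps)
  also have "\<dots> = (\<Sum>a<p. \<Sum>k\<in>{0..<int p}. cis (- (pi * t)) / 2 *
       (z ^ a * (L k * unit_char (- int a * k)) + z ^ Suc a * (L k * unit_char (- int (Suc a) * k))))"
    by (rule sum.swap)
  also have "\<dots> = (\<Sum>a<p. cis (- (pi * t)) / 2 *
       (z ^ a * (\<Sum>k\<in>{0..<int p}. L k * unit_char (- int a * k))
        + z ^ Suc a * (\<Sum>k\<in>{0..<int p}. L k * unit_char (- int (Suc a) * k))))"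
    by (simp only: sum_distrib_left sum.distrib distrib_left)
  also have "\<dots> = cis (- (pi * t)) / 2 * gauss_sum * ((\<Sum>a<p. L (- int a) * z ^ a) + (\<Sum>a<p. L (- int (Suc a)) * z ^ Suc a))"
  proof -
    have "(\<Sum>a<p. cis (- (pi * t)) / 2 * (z ^ a * (L (- int a) * gauss_sum)
            + z ^ Suc a * (L (- int (Suc a)) * gauss_sum)))
        = (\<Sum>a<p. cis (- (pi * t)) / 2 * gauss_sum * (L (- int a) * z ^ a + L (- int (Suc a)) * z ^ Suc a))"
      by (rule sum.cong[OF refl]) (simp only: distrib_left mult_ac)
    also have "\<dots> = cis (- (pi * t)) / 2 * gauss_sum * (\<Sum>a<p. L (- int a) * z ^ a + L (- int (Suc a)) * z ^ Suc a)"
      by (rule sum_distrib_left[symmetric])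
    finally show ?thesis unfolding twist sum.distrib .
  qed
  also have "(\<Sum>a<p. L (- int (Suc a)) * z ^ Suc a) = (\<Sum>a<p. L (- int a) * z ^ a)"
  proof -
    have "L (- int 0) = 0" "L (- int p) = 0"
      using Legendre_eq_0_iff[of 0] Legendre_eq_0_iff[of "- int p"] by (auto simp: L_def)
    thus ?thesis
      using sum.lessThan_Suc_shift[of "\<lambda>a. L (- int a) * z ^ a" p] by simp
  qed
  also have "(\<Sum>a<p. L (- int a) * z ^ a) = of_int (Legendre (-1) (int p)) * poly (fekete_poly p) z"
  proof -
    have "L (- int a) = of_int (Legendre (-1) (int p)) * L (int a)" for a
      using Legendre_mult[of "-1" "int a"] by (simp add: L_def)
    thus ?thesis by (simp add: poly_fekete sum_distrib_left mult.assoc) (simp add: L_def)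
  qed
  finally show ?thesis by (simp add: z_def)
qed

lemma fekete_zero_iff_cot_sum:
  fixes x :: real and m :: int
  assumes x: "-1 < x" "x < 1" "x \<noteq> 0" and k: "p = 2 * k + 1"
  shows "poly (fekete_poly p) (cis (2 * pi * (of_int m + x) / p)) = 0 \<longleftrightarrow>
         cot_sum p {- int k..int k} (\<lambda>j. Legendre (m - j) (int p)) x = 0"
proof -
  define t where "t = of_int m + x"
  have p0: "real p > 0" using p_gt_2 by simp
  have st: "sin (pi * t) \<noteq> 0"
  proof
    assume "sin (pi * t) = 0"
    then obtain i :: int where "pi * t = of_int i * pi" using sin_zero_iff_int2 by blast
    hence "x = of_int (i - m)" by (simp add: t_def)
    hence "-1 < i - m" "i - m < 1" "i - m \<noteq> 0" using x by (auto simp del: of_int_diff)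
    thus False by simp
  qed
  define f where "f = (\<lambda>k. Legendre k (int p) * cot (pi * (t - of_int k) / p))"
  have per: "f (k mod int p) = f k" for k
  proof -
    have "t - of_int (k mod int p) = t - of_int k + of_int (k div int p) * p"
      by (simp add: minus_div_mult_eq_mod[symmetric])
    hence "pi * (t - of_int (k mod int p)) / p = pi * (t - of_int k) / p + of_int (k div int p) * pi"
      using p0 by (simp add: field_simps)
    hence "cot (pi * (t - of_int (k mod int p)) / p) = cot (pi * (t - of_int k) / p)"
      by (simp add: cot_altdef tan_periodic_int)
    thus ?thesis by (simp add: f_def Legendre_mod)
  qed
  have "sum f {0..<int p} = sum f ((\<lambda>j. m - j) ` {- int k..int k})"
  proof (rule sum_periodic_eq[where f = f, OF per, symmetric])
    show "card ((\<lambda>j. m - j) ` {- int k..int k}) = p" using k by (simp add: card_image inj_on_def)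
    show "inj_on (\<lambda>k. k mod int p) ((\<lambda>j. m - j) ` {- int k..int k})"
      by (rule inj_on_mod) (use k in auto)
  qed (use p_gt_2 in auto)
  also have "\<dots> = (\<Sum>j\<in>{- int k..int k}. f (m - j))" by (subst sum.reindex) (auto simp: inj_on_def)
  also have "\<dots> = p / pi * cot_sum p {- int k..int k} (\<lambda>j. Legendre (m - j) (int p)) x"
  proof -
    have "f (m - j) = p / pi * (Legendre (m - j) (int p) * cot_kernel p (x + of_int j))" for j
    proof -
      have eq: "pi * (t - of_int (m - j)) / p = pi / p * (x + of_int j)" by (simp add: t_def algebra_simps)
      show ?thesis unfolding f_def cot_kernel_def eq using p0 by simp
    qed
    thus ?thesis by (simp add: cot_sum_def sum_distrib_left)
  qed
  finally have sum_f: "sum f {0..<int p} = 0 \<longleftrightarrow> cot_sum p {- int k..int k} (\<lambda>j. Legendre (m - j) (int p)) x = 0"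
    using p0 by simp
  define c where "c = cis (- (pi * t)) * gauss_sum * of_int (Legendre (-1) (int p))"
  define P where "P = poly (fekete_poly p) (cis (2 * pi * (of_int m + x) / p))"
  have eq: "of_real (sin (pi * t) * sum f {0..<int p}) = c * P"
    unfolding c_def P_def f_def using fekete_interpolation[OF st] by (simp only: t_def)
  have "\<not> int p dvd -1" using p_gt_2 by (simp add: zdvd1_eq)
  hence "Legendre (-1) (int p) \<noteq> 0" using Legendre_eq_0_iff[of "-1"] by simp
  hence "c \<noteq> 0" using gauss_sum_nz by (simp add: c_def)
  hence "P = 0 \<longleftrightarrow> c * P = 0" by simp
  also have "\<dots> \<longleftrightarrow> sum f {0..<int p} = 0"
    unfolding eq[symmetric] of_real_eq_0_iff mult_eq_0_iff using st by blast
  finally show ?thesis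
    unfolding P_def[symmetric] by (simp only: sum_f)
qed

end

section \<open>The rational functions with random signs\<close>

definition sign_patterns :: "nat \<Rightarrow> (int \<Rightarrow> real) set" where
  "sign_patterns J = F_indices J \<rightarrow>\<^sub>E {1, -1}"

definition low_patterns :: "nat \<Rightarrow> real \<Rightarrow> (int \<Rightarrow> real) set" where
  "low_patterns J c = {\<delta> \<in> sign_patterns J. \<exists>x. 0 < x \<and> x < 1 \<and> F_fun J \<delta> x \<le> c}"

lemma sign_patterns_values: "\<delta> \<in> sign_patterns J \<Longrightarrow> j \<in> F_indices J \<Longrightarrow> \<delta> j = 1 \<or> \<delta> j = -1"
  by (auto simp: sign_patterns_def PiE_def Pi_def)

lemma finite_sign_patterns: "finite (sign_patterns J)"
  by (auto simp: sign_patterns_def intro!: finite_PiE finite_F_indices)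

lemma card_sign_patterns: "card (sign_patterns J) = 2 ^ card (F_indices J)"
  by (simp add: sign_patterns_def card_PiE finite_F_indices numeral_2_eq_2)

lemma finite_low_patterns: "finite (low_patterns J c)"
  using finite_sign_patterns by (simp add: low_patterns_def)

lemma continuous_F_fun: "continuous_on {0<..<1} (F_fun J \<delta>)"
  unfolding F_fun_def[abs_def]
  by (intro continuous_intros) (auto simp: shift_nz)

lemma F_fun_pos_near_0:
  assumes "\<delta> \<in> sign_patterns J" "0 < x" "x * (1 + real (card (F_indices J))) \<le> 1" "x \<le> 1 / 2"
  shows "F_fun J \<delta> x > 0"
proof -
  have "\<bar>\<Sum>j\<in>F_indices J. \<delta> j / (x + of_int j)\<bar> \<le> (\<Sum>j\<in>F_indices J. 1)"
  proof (rule order_trans[OF sum_abs sum_mono])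
    fix j assume j: "j \<in> F_indices J"
    have g: "1 \<le> gap j" using j by (intro gap_ge_1) (auto simp: F_indices_def)
    have "1 / \<bar>x + of_int j\<bar> ^ 1 \<le> 1 / of_int (gap j) ^ 1"
      by (rule abs_inverse_shift_le) (use assms g in auto)
    also have "\<dots> \<le> 1" using g by simp
    finally show "\<bar>\<delta> j / (x + of_int j)\<bar> \<le> 1"
      using sign_patterns_values[OF assms(1) j] by auto
  qed
  hence "\<bar>\<Sum>j\<in>F_indices J. \<delta> j / (x + of_int j)\<bar> \<le> real (card (F_indices J))" by simp
  moreover have "1 / x \<ge> 1 + real (card (F_indices J))" using assms by (simp add: field_simps)
  moreover have "1 / (1 - x) > 0" using assms by simp
  ultimately show ?thesis unfolding F_fun_def by linarith
qed

lemma F_fun_zero_iff: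
  assumes "\<delta> \<in> sign_patterns J"
  shows "(\<exists>x. 0 < x \<and> x < 1 \<and> F_fun J \<delta> x = 0) \<longleftrightarrow> \<delta> \<in> low_patterns J 0"
proof
  assume "\<delta> \<in> low_patterns J 0"
  then obtain y where y: "0 < y" "y < 1" "F_fun J \<delta> y \<le> 0" by (auto simp: low_patterns_def)
  show "\<exists>x. 0 < x \<and> x < 1 \<and> F_fun J \<delta> x = 0"
  proof (cases "F_fun J \<delta> y = 0")
    case False
    define e where "e = min (y / 2) (1 / (2 + real (card (F_indices J))))"
    have e: "0 < e" "e < y" "e < 1" using y by (auto simp: e_def min_def)
    have "e \<le> 1 / (2 + real (card (F_indices J)))" by (simp add: e_def)
    hence "e * (2 + real (card (F_indices J))) \<le> 1" by (simp add: field_simps)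
    moreover have "e * (1 + real (card (F_indices J))) \<le> e * (2 + real (card (F_indices J)))"
      using e by (intro mult_left_mono) auto
    moreover have "e \<le> y / 2" by (simp add: e_def)
    ultimately have "e * (1 + real (card (F_indices J))) \<le> 1" "e \<le> 1 / 2" using y by linarith+
    hence "F_fun J \<delta> e > 0" using e by (intro F_fun_pos_near_0[OF assms])
    hence "\<exists>z>e. z < y \<and> F_fun J \<delta> z = 0"
      using e y False by (intro zero_between[OF continuous_F_fun]) (auto simp: mult_less_0_iff)
    thus ?thesis using e y by (meson less_trans)
  qed (use y in blast)
qed (use assms in \<open>force simp: low_patterns_def\<close>)

text \<open>
  Near \<open>-i\<close> the difference of two members behaves like \<open>(\<delta>\<^sub>i - \<delta>'\<^sub>i)/(x + i)\<close>, so the signs are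
  determined by the function.
\<close>
lemma inj_on_F_fun: "inj_on (F_fun J) (sign_patterns J)"
proof (rule inj_onI)
  fix \<delta> \<delta>' assume mem: "\<delta> \<in> sign_patterns J" "\<delta>' \<in> sign_patterns J" and eq: "F_fun J \<delta> = F_fun J \<delta>'"
  have "\<delta> i = \<delta>' i" if i: "i \<in> F_indices J" for i
  proof -
    define I where "I = F_indices J - {i}"
    define R where "R = (\<lambda>x :: real. \<Sum>j\<in>I. (\<delta> j - \<delta>' j) / (x + of_int j))"
    have fin: "finite I" by (simp add: I_def finite_F_indices)
    have z: "(\<delta> i - \<delta>' i) + (x + of_int i) * R x = 0" if x: "x + real_of_int i \<noteq> 0" for x
    proof -
      have "0 = F_fun J \<delta> x - F_fun J \<delta>' x" using eq by simp
      also have "\<dots> = (\<Sum>j\<in>F_indices J. (\<delta> j - \<delta>' j) / (x + of_int j))"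
        by (simp add: F_fun_def sum_subtractf diff_divide_distrib)
      also have "\<dots> = (\<delta> i - \<delta>' i) / (x + of_int i) + R x"
        unfolding R_def I_def by (rule sum.remove[OF finite_F_indices i])
      finally have "0 = (x + of_int i) * ((\<delta> i - \<delta>' i) / (x + of_int i) + R x)" by simp
      thus ?thesis using x by (simp add: distrib_left)
    qed
    have "((\<lambda>x. (\<delta> i - \<delta>' i) + (x + of_int i) * R x) \<longlongrightarrow>
             (\<delta> i - \<delta>' i) + (- of_int i + of_int i) * R (- of_int i)) (at (- of_int i))"
      unfolding R_def by (intro tendsto_intros) (auto simp: I_def)
    moreover have "eventually (\<lambda>x. (\<delta> i - \<delta>' i) + (x + of_int i) * R x = 0) (at (- of_int i))"
      unfolding eventually_at_filter by (rule always_eventually) (auto intro!: z)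
    hence "((\<lambda>x. (\<delta> i - \<delta>' i) + (x + of_int i) * R x) \<longlongrightarrow> 0) (at (- of_int i))"
      by (rule tendsto_eventually)
    ultimately have "(\<delta> i - \<delta>' i) + (- of_int i + of_int i) * R (- of_int i) = 0"
      by (rule tendsto_unique[OF at_neq_bot])
    thus ?thesis by simp
  qed
  thus "\<delta> = \<delta>'" using mem unfolding sign_patterns_def by (rule PiE_ext[rotated 2])
qed

lemma F_set_eq: "F_set J = F_fun J ` sign_patterns J"
proof (intro equalityI subsetI)
  fix g assume "g \<in> F_set J"
  then obtain \<delta> where g: "g = F_fun J \<delta>" and \<delta>: "\<forall>j\<in>F_indices J. \<delta> j \<in> {1, -1}"
    by (auto simp: F_set_def)
  have "g = F_fun J (restrict \<delta> (F_indices J))" unfolding g F_fun_def by simp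
  moreover have "restrict \<delta> (F_indices J) \<in> sign_patterns J"
    using \<delta> by (auto simp: sign_patterns_def)
  ultimately show "g \<in> F_fun J ` sign_patterns J" by (rule image_eqI)
qed (auto simp: F_set_def sign_patterns_def PiE_def Pi_def)

lemma zero_ratio_eq:
  "real (card {g \<in> F_set J. \<exists>x. 0 < x \<and> x < 1 \<and> g x = 0}) / real (card (F_set J))
     = real (card (low_patterns J 0)) / real (card (sign_patterns J))"
proof -
  have "{g \<in> F_set J. \<exists>x. 0 < x \<and> x < 1 \<and> g x = 0} = F_fun J ` low_patterns J 0"
  proof -
    have "{g \<in> F_set J. \<exists>x. 0 < x \<and> x < 1 \<and> g x = 0}
        = F_fun J ` {\<delta> \<in> sign_patterns J. \<exists>x. 0 < x \<and> x < 1 \<and> F_fun J \<delta> x = 0}"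
      unfolding F_set_eq by blast
    also have "{\<delta> \<in> sign_patterns J. \<exists>x. 0 < x \<and> x < 1 \<and> F_fun J \<delta> x = 0} = low_patterns J 0"
      using F_fun_zero_iff[of _ J] by (auto simp: low_patterns_def)
    finally show ?thesis .
  qed
  moreover have "low_patterns J 0 \<subseteq> sign_patterns J" by (auto simp: low_patterns_def)
  ultimately show ?thesis
    by (simp add: F_set_eq card_image inj_on_F_fun inj_on_subset[OF inj_on_F_fun])
qed

lemma sum_inverse_powers_4: "(\<Sum>l\<in>{i<..n}. 1 / 4 ^ l) \<le> (1 / 3 / 4 ^ i :: real)"
proof (cases "i \<le> n")
  case True
  have "(\<Sum>l\<in>{i<..n}. 1 / 4 ^ l) = (1 / 4 ^ i - 1 / 4 ^ n) / (3 :: real)"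
    using True
  proof (induction n rule: dec_induct)
    case (step m)
    have "{i<..Suc m} = insert (Suc m) {i<..m}" using step by auto
    hence "(\<Sum>l\<in>{i<..Suc m}. 1 / 4 ^ l) = 1 / 4 ^ Suc m + (\<Sum>l\<in>{i<..m}. 1 / 4 ^ l :: real)" by simp
    moreover have "(1 / 4 ^ Suc m :: real) = 1 / 4 ^ m / 4" by simp
    moreover have "b / 4 + (a - b) / 3 = (a - b / 4) / 3" for a b :: real by argo
    ultimately show ?case using step.IH by (simp only:)
  qed simp
  also have "\<dots> \<le> 1 / 4 ^ i / 3" by (intro divide_right_mono) auto
  also have "\<dots> = 1 / 3 / 4 ^ i" by simp
  finally show ?thesis .
qed simp

text \<open>
  Only the signs at the positions \<open>4\<^sup>1, ..., 4\<^sup>n\<close> are varied.  Raising the sign at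
  \<open>4\<^sup>i\<close> from \<open>-1\<close> to \<open>1\<close> raises the function on \<open>(0,1)\<close> by at least \<open>2/(4\<^sup>i + 1)\<close>, which outweighs all
  changes at the later positions.  So the \<open>2\<^sup>n\<close> choices order the infima lexicographically with gaps greater than
  \<open>2\<epsilon>\<close>, and at most one of them has its infimum in the window of width \<open>2\<epsilon>\<close> around \<open>0\<close>.
\<close>
theorem anticoncentration:
  assumes J: "4 ^ n < J" and \<epsilon>: "\<epsilon> * 4 ^ (n + 1) \<le> 1"
  shows "card (low_patterns J \<epsilon> - low_patterns J (- \<epsilon>)) * 2 ^ n \<le> card (sign_patterns J)"
proof -
  define E where "E = low_patterns J \<epsilon> - low_patterns J (- \<epsilon>)"
  define K where "K = (\<lambda>i. 4 ^ i :: int) ` {1..n}"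
  have inj4: "inj_on (\<lambda>i. 4 ^ i :: int) A" for A by (auto simp: inj_on_def)
  have cK: "card K = n" using card_image[OF inj4] by (simp add: K_def)
  have KF: "K \<subseteq> F_indices J"
  proof
    fix j assume "j \<in> K"
    then obtain i where i: "j = 4 ^ i" "1 \<le> i" "i \<le> n" by (auto simp: K_def)
    have "(4 :: int) ^ i \<le> 4 ^ n" using i by (intro power_increasing) auto
    also have "\<dots> < int J" using J by (metis of_nat_less_iff of_nat_numeral of_nat_power)
    finally have "4 ^ i < int J" .
    moreover have "(4 :: int) ^ i > 0" by simp
    ultimately show "j \<in> F_indices J" unfolding F_indices_def i(1) by (simp del: zero_less_power)
  qed
  have key: False
    if mem: "\<delta> \<in> E" "\<delta>' \<in> E" and i: "i \<in> {1..n}" "\<delta> (4 ^ i) = -1" "\<delta>' (4 ^ i) = 1"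
      and below: "\<And>l. l \<in> {1..n} \<Longrightarrow> l < i \<Longrightarrow> \<delta> (4 ^ l) = \<delta>' (4 ^ l)"
      and outside: "\<And>j. j \<in> F_indices J - K \<Longrightarrow> \<delta> j = \<delta>' j" for \<delta> \<delta>' i
  proof -
    have pat: "\<delta> \<in> sign_patterns J" "\<delta>' \<in> sign_patterns J" using mem by (auto simp: E_def low_patterns_def)
    obtain x where x: "0 < x" "x < 1" "F_fun J \<delta>' x \<le> \<epsilon>"
      using mem by (auto simp: E_def low_patterns_def)
    have "F_fun J \<delta> x > - \<epsilon>" using mem(1) x pat by (force simp: E_def low_patterns_def not_le)
    hence up: "F_fun J \<delta>' x - F_fun J \<delta> x < 2 * \<epsilon>" using x by simp
    define d where "d = (\<lambda>l. (\<delta>' (4 ^ l) - \<delta> (4 ^ l)) / (x + 4 ^ l))"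
    have "F_fun J \<delta>' x - F_fun J \<delta> x = (\<Sum>j\<in>F_indices J. (\<delta>' j - \<delta> j) / (x + of_int j))"
      by (simp add: F_fun_def sum_subtractf diff_divide_distrib)
    also have "\<dots> = (\<Sum>j\<in>K. (\<delta>' j - \<delta> j) / (x + of_int j))"
      by (rule sum.mono_neutral_right) (use finite_F_indices KF outside in auto)
    also have "\<dots> = (\<Sum>l\<in>{1..n}. d l)"
      unfolding K_def d_def by (subst sum.reindex[OF inj4]) simp
    also have "\<dots> = (\<Sum>l\<in>insert i {i<..n}. d l)"
    proof (rule sum.mono_neutral_right)
      show "\<forall>l\<in>{1..n} - insert i {i<..n}. d l = 0" using below by (auto simp: d_def)
    qed (use i in auto)
    also have "\<dots> = 2 / (x + 4 ^ i) + (\<Sum>l\<in>{i<..n}. d l)" using i by (simp add: d_def)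
    finally have eq: "F_fun J \<delta>' x - F_fun J \<delta> x = 2 / (x + 4 ^ i) + (\<Sum>l\<in>{i<..n}. d l)" .
    have "\<bar>\<Sum>l\<in>{i<..n}. d l\<bar> \<le> (\<Sum>l\<in>{i<..n}. 2 * (1 / 4 ^ l))"
    proof (rule order_trans[OF sum_abs sum_mono])
      fix l assume "l \<in> {i<..n}"
      hence "4 ^ l \<in> F_indices J" using i KF by (auto simp: K_def)
      hence "\<bar>\<delta>' (4 ^ l) - \<delta> (4 ^ l)\<bar> \<le> 2"
        using sign_patterns_values[OF pat(1)] sign_patterns_values[OF pat(2)] by fastforce
      moreover have "\<bar>x + 4 ^ l\<bar> \<ge> 4 ^ l" using x by simp
      ultimately have "\<bar>\<delta>' (4 ^ l) - \<delta> (4 ^ l)\<bar> / \<bar>x + 4 ^ l\<bar> \<le> 2 / 4 ^ l"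
        by (intro frac_le) auto
      thus "\<bar>d l\<bar> \<le> 2 * (1 / 4 ^ l)" by (simp add: d_def)
    qed
    also have "\<dots> \<le> 2 * (1 / 3 / 4 ^ i)"
      unfolding sum_distrib_left[symmetric] by (intro mult_left_mono sum_inverse_powers_4) simp
    finally have tail: "(\<Sum>l\<in>{i<..n}. d l) \<ge> - (2 / 3 * (1 / 4 ^ i))" by (simp add: abs_le_iff)
    have "(4 :: real) ^ 1 \<le> 4 ^ i" using i by (intro power_increasing) auto
    hence "x + 4 ^ i \<le> 5 / 4 * 4 ^ i" using x by simp
    hence "2 / (5 / 4 * 4 ^ i) \<le> 2 / (x + 4 ^ i)" using x by (intro divide_left_mono mult_pos_pos) (auto intro: add_pos_pos)
    \<comment> \<open>the jump exceeds the tail because \<open>8/5 - 2/3 > 1/2\<close>\<close>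
    hence main: "2 / (x + 4 ^ i) \<ge> 8 / 5 * (1 / 4 ^ i)" by simp
    have "(4 :: real) ^ i \<le> 4 ^ n" using i by (intro power_increasing) auto
    hence "1 / 4 ^ n \<le> (1 / 4 ^ i :: real)" by (simp add: field_simps)
    moreover have "2 * \<epsilon> \<le> 1 / 2 * (1 / 4 ^ n)" using \<epsilon> by (simp add: field_simps)
    moreover have "(0 :: real) < 1 / 4 ^ i" by simp
    ultimately show False using up eq tail main by linarith
  qed
  have inj: "inj_on (\<lambda>\<delta>. restrict \<delta> (F_indices J - K)) E"
  proof (rule inj_onI, rule ccontr)
    fix \<delta> \<delta>' assume mem: "\<delta> \<in> E" "\<delta>' \<in> E"
      and eq: "restrict \<delta> (F_indices J - K) = restrict \<delta>' (F_indices J - K)" and neq: "\<delta> \<noteq> \<delta>'"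
    have outside: "\<delta> j = \<delta>' j" if "j \<in> F_indices J - K" for j
      using fun_cong[OF eq, of j] that by simp
    have pat: "\<delta> \<in> sign_patterns J" "\<delta>' \<in> sign_patterns J" using mem by (auto simp: E_def low_patterns_def)
    have "\<exists>j\<in>F_indices J. \<delta> j \<noteq> \<delta>' j"
      using neq pat unfolding sign_patterns_def by (meson PiE_ext)
    then obtain j where j: "j \<in> F_indices J" "\<delta> j \<noteq> \<delta>' j" by blast
    hence "j \<in> K" using outside by blast
    hence ex: "\<exists>l. l \<in> {1..n} \<and> \<delta> (4 ^ l) \<noteq> \<delta>' (4 ^ l)"
      using j(2) by (auto simp: K_def)
    define i where "i = (LEAST l. l \<in> {1..n} \<and> \<delta> (4 ^ l) \<noteq> \<delta>' (4 ^ l))"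
    have i: "i \<in> {1..n}" "\<delta> (4 ^ i) \<noteq> \<delta>' (4 ^ i)"
      using LeastI_ex[OF ex] by (auto simp: i_def)
    have below: "\<delta> (4 ^ l) = \<delta>' (4 ^ l)" if "l \<in> {1..n}" "l < i" for l
      using not_less_Least[of l "\<lambda>l. l \<in> {1..n} \<and> \<delta> (4 ^ l) \<noteq> \<delta>' (4 ^ l)"] that by (auto simp: i_def)
    have "4 ^ i \<in> F_indices J" using i KF by (auto simp: K_def)
    from sign_patterns_values[OF pat(1) this] sign_patterns_values[OF pat(2) this] i(2)
    show False
      using key[OF mem i(1) _ _ below outside] key[OF mem(2,1) i(1) _ _ below[symmetric] outside[symmetric]]
      by auto
  qed
  have "card E \<le> card (PiE (F_indices J - K) (\<lambda>_. {1, -1 :: real}))"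
  proof (rule card_inj_on_le[OF inj])
    show "(\<lambda>\<delta>. restrict \<delta> (F_indices J - K)) ` E \<subseteq> (F_indices J - K) \<rightarrow>\<^sub>E {1, -1}"
    proof (rule image_subsetI)
      fix \<delta> assume "\<delta> \<in> E"
      hence "\<delta> \<in> sign_patterns J" by (auto simp: E_def low_patterns_def)
      from sign_patterns_values[OF this]
      show "restrict \<delta> (F_indices J - K) \<in> (F_indices J - K) \<rightarrow>\<^sub>E {1, -1}"
        by (intro restrict_PiE_iff[THEN iffD2]) auto
    qed
  qed (auto intro!: finite_PiE simp: finite_F_indices)
  also have "\<dots> = 2 ^ (card (F_indices J) - n)"
    using KF cK by (simp add: card_PiE finite_F_indices card_Diff_subset finite_subset[OF KF] numeral_2_eq_2)
  finally have "card E * 2 ^ n \<le> 2 ^ (card (F_indices J) - n) * 2 ^ n" by simp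
  also have "\<dots> = 2 ^ card (F_indices J)"
    using card_mono[OF finite_F_indices KF] cK by (simp flip: power_add)
  finally show ?thesis by (simp add: E_def card_sign_patterns)
qed

section \<open>Equidistribution of sign patterns of the Legendre symbol\<close>

lemma eventually_odd_primes:
  "eventually P odd_primes_at_top \<longleftrightarrow> (\<exists>N. \<forall>p\<ge>N. prime p \<and> odd p \<longrightarrow> P p)"
  by (simp add: odd_primes_at_top_def eventually_inf_principal eventually_at_top_linorder)

lemma odd_primes_at_top_neq_bot: "odd_primes_at_top \<noteq> bot"
proof
  assume "odd_primes_at_top = bot"
  hence "eventually (\<lambda>_. False) odd_primes_at_top" by simp
  then obtain N :: nat where N: "\<And>p. p \<ge> N \<Longrightarrow> prime p \<Longrightarrow> even p" by (auto simp: eventually_odd_primes)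
  obtain p :: nat where p: "prime p" "p > N + 2" using bigger_prime by blast
  show False using N[of p] p prime_odd_nat[of p] by auto
qed

lemma odd_primes_at_top_le: "odd_primes_at_top \<le> at_top"
  by (simp add: odd_primes_at_top_def)

lemma eventually_odd_primes_ge: "eventually (\<lambda>p. prime p \<and> odd p \<and> p \<ge> N) odd_primes_at_top"
  unfolding eventually_odd_primes by blast

lemma sum_Legendre_square:
  assumes "prime p" "odd p"
  shows "(\<Sum>m<p. Legendre (int m - i) (int p) * Legendre (int m - i) (int p)) = int p - 1"
proof -
  note L = Legendre_mod[OF assms] Legendre_eq_0_iff[OF assms] Legendre_square[OF assms]
  have p2: "p > 2" by (rule p_gt_2[OF assms])
  define f where "f = (\<lambda>k. Legendre k (int p) * Legendre k (int p))"
  have "(\<Sum>m<p. f (int m - i)) = (\<Sum>k\<in>(\<lambda>m. int m - i) ` {..<p}. f k)"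
    by (subst sum.reindex) (auto simp: inj_on_def)
  also have "\<dots> = sum f {0..<int p}"
  proof (rule sum_periodic_eq[where f = f])
    show "f (k mod int p) = f k" for k by (simp add: f_def L)
    show "inj_on (\<lambda>k. k mod int p) ((\<lambda>m. int m - i) ` {..<p})"
      by (rule inj_on_mod) auto
  qed (use p2 in \<open>auto simp: card_image inj_on_def\<close>)
  also have "\<dots> = f 0 + sum f ({0..<int p} - {0})" using p2 by (subst sum.remove[of _ 0]) auto
  also have "sum f ({0..<int p} - {0}) = (\<Sum>k\<in>{0..<int p} - {0}. 1)"
    by (intro sum.cong refl) (auto simp: f_def intro!: L(3) dest: zdvd_imp_le)
  also have "f 0 = 0" by (simp add: f_def L)
  finally show ?thesis using p2 by (simp add: f_def)
qed

text \<open>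
  The shifts of the Legendre symbol are almost orthogonal: their Gram matrix is \<open>p\<close> times the identity minus the
  matrix of ones, and the latter is positive semidefinite.
\<close>
lemma Legendre_second_moment:
  fixes a :: "int \<Rightarrow> real"
  assumes p: "prime p" "odd p" and B: "finite B" "inj_on (\<lambda>j. j mod int p) B"
  shows "(\<Sum>m<p. (\<Sum>j\<in>B. Legendre (int m - j) (int p) * a j)\<^sup>2) \<le> p * (\<Sum>j\<in>B. (a j)\<^sup>2)"
proof -
  define c where "c = (\<lambda>i j. \<Sum>m<p. Legendre (int m - i) (int p) * Legendre (int m - j) (int p))"
  have c: "c i j = (if i = j then int p else 0) - 1" if "i \<in> B" "j \<in> B" for i j
  proof (cases "i = j")
    case True
    thus ?thesis using sum_Legendre_square[OF p] by (simp add: c_def)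
  next
    case False
    hence "[i \<noteq> j] (mod int p)" using B(2) that by (auto simp: inj_on_def cong_def)
    thus ?thesis using False legendre_sums_small[OF p] by (simp add: c_def legendre_sums_small_def)
  qed
  have "(\<Sum>m<p. (\<Sum>j\<in>B. Legendre (int m - j) (int p) * a j)\<^sup>2)
      = (\<Sum>m<p. \<Sum>i\<in>B. \<Sum>j\<in>B. a i * a j * real_of_int (Legendre (int m - i) (int p) * Legendre (int m - j) (int p)))"
    by (simp add: power2_eq_square sum_product mult_ac)
  also have "\<dots> = (\<Sum>i\<in>B. \<Sum>m<p. \<Sum>j\<in>B. a i * a j * real_of_int (Legendre (int m - i) (int p) * Legendre (int m - j) (int p)))"
    by (rule sum.swap)
  also have "\<dots> = (\<Sum>i\<in>B. \<Sum>j\<in>B. \<Sum>m<p. a i * a j * real_of_int (Legendre (int m - i) (int p) * Legendre (int m - j) (int p)))"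
    by (intro sum.cong refl sum.swap)
  also have "\<dots> = (\<Sum>i\<in>B. \<Sum>j\<in>B. a i * a j * real_of_int (c i j))"
    by (simp add: c_def sum_distrib_left)
  also have "\<dots> = (\<Sum>i\<in>B. \<Sum>j\<in>B. (if i = j then p * (a i * a j) else 0) - a i * a j)"
    by (intro sum.cong refl) (simp add: c algebra_simps)
  also have "\<dots> = (\<Sum>i\<in>B. p * (a i)\<^sup>2) - (\<Sum>i\<in>B. \<Sum>j\<in>B. a i * a j)"
    using B(1) by (simp add: sum_subtractf power2_eq_square)
  also have "(\<Sum>i\<in>B. \<Sum>j\<in>B. a i * a j) = (\<Sum>j\<in>B. a j)\<^sup>2"
    by (simp add: power2_eq_square sum_product)
  finally show ?thesis by (simp add: sum_distrib_left)
qed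

lemma Legendre_large_deviation:
  fixes a :: "int \<Rightarrow> real" and c :: real
  assumes p: "prime p" "odd p" and B: "finite B" "inj_on (\<lambda>j. j mod int p) B" and c: "c > 0"
  shows "card {m. m < p \<and> \<bar>\<Sum>j\<in>B. Legendre (int m - j) (int p) * a j\<bar> > c} * c\<^sup>2 \<le> p * (\<Sum>j\<in>B. (a j)\<^sup>2)"
proof -
  define T where "T = (\<lambda>m. \<Sum>j\<in>B. Legendre (int m - j) (int p) * a j)"
  define X where "X = {m. m < p \<and> \<bar>T m\<bar> > c}"
  have "card X * c\<^sup>2 = (\<Sum>m\<in>X. c\<^sup>2)" by simp
  also have "\<dots> \<le> (\<Sum>m\<in>X. (T m)\<^sup>2)"
  proof (rule sum_mono)
    fix m assume "m \<in> X"
    hence "\<bar>c\<bar> \<le> \<bar>T m\<bar>" using c by (simp add: X_def)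
    thus "c\<^sup>2 \<le> (T m)\<^sup>2" by (simp add: abs_le_square_iff)
  qed
  also have "\<dots> \<le> (\<Sum>m<p. (T m)\<^sup>2)" by (rule sum_mono2) (auto simp: X_def)
  also have "\<dots> \<le> p * (\<Sum>j\<in>B. (a j)\<^sup>2)" unfolding T_def by (rule Legendre_second_moment[OF p B])
  finally show ?thesis by (simp add: X_def T_def)
qed

lemma card_vanishing_le:
  assumes p: "prime p" "odd p" and "finite S"
  shows "card {m. m < p \<and> (\<exists>j\<in>S. Legendre (int m - j) (int p) = 0)} \<le> card S"
proof -
  have "{m. m < p \<and> (\<exists>j\<in>S. Legendre (int m - j) (int p) = 0)} \<subseteq> (\<lambda>j. nat (j mod int p)) ` S"
  proof
    fix m assume "m \<in> {m. m < p \<and> (\<exists>j\<in>S. Legendre (int m - j) (int p) = 0)}"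
    then obtain j where j: "m < p" "j \<in> S" "int p dvd int m - j"
      using Legendre_eq_0_iff[OF p] by auto
    hence "int m mod int p = j mod int p" by (simp only: mod_eq_dvd_iff)
    hence "m = nat (j mod int p)" using j(1) by simp
    thus "m \<in> (\<lambda>j. nat (j mod int p)) ` S" using j(2) by blast
  qed
  hence "card {m. m < p \<and> (\<exists>j\<in>S. Legendre (int m - j) (int p) = 0)} \<le> card ((\<lambda>j. nat (j mod int p)) ` S)"
    by (rule card_mono[rotated]) (use assms in auto)
  also have "\<dots> \<le> card S" by (rule card_image_le[OF assms(3)])
  finally show ?thesis .
qed

definition pattern_class :: "nat \<Rightarrow> int set \<Rightarrow> (int \<Rightarrow> int) \<Rightarrow> nat set" where
  "pattern_class p S \<eta> = {m. m < p \<and> (\<forall>j\<in>S. Legendre (int m - j) (int p) = \<eta> j)}"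

text \<open>
  Up to the few \<open>m\<close> with a vanishing symbol, \<open>\<Prod>\<^sub>j (1 + \<eta>\<^sub>j \<chi>(m-j))\<close> is \<open>2\<^sup>n\<close> times the
  indicator of the pattern.  Expanding the product, the empty subset of \<open>S\<close> gives the main term \<open>p\<close> and every
  other subset a small character sum.
\<close>
lemma pattern_class_card_bound:
  fixes \<mu> :: nat
  assumes p: "prime p" "odd p" and S: "finite S" "inj_on (\<lambda>j. j mod int p) S"
    and \<eta>: "\<And>j. j \<in> S \<Longrightarrow> \<eta> j = 1 \<or> \<eta> j = -1" and \<mu>: "\<mu> > 0"
    and large: "\<mu> * (2 * \<mu> * card S + \<mu> + 1) + card S < p div 2"
  shows "\<bar>real (card (pattern_class p S \<eta>)) / p - 1 / 2 ^ card S\<bar>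
           \<le> (1 + 4 * card S) / p + card S / \<mu>"
proof -
  define n where "n = card S"
  define L where "L = (\<lambda>m j. Legendre (int m - j) (int p))"
  define V where "V = {m. m < p \<and> (\<exists>j\<in>S. L m j = 0)}"
  define P where "P = (\<lambda>m. \<Prod>j\<in>S. 1 + \<eta> j * L m j)"
  define N where "N = pattern_class p S \<eta>"
  have Lval: "L m j \<in> {-1, 0, 1}" for m j unfolding L_def by (rule Legendre_values[OF p])
  have fac: "0 \<le> 1 + \<eta> j * L m j" "1 + \<eta> j * L m j \<le> 2" if "j \<in> S" for m j
    using \<eta>[OF that] Lval[of m j] by auto
  have P0: "0 \<le> P m" "P m \<le> 2 ^ n" for m
  proof -
    show "0 \<le> P m" unfolding P_def using fac by (intro prod_nonneg) auto
    have "P m \<le> (\<Prod>j\<in>S. 2)" unfolding P_def using fac by (intro prod_mono) auto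
    thus "P m \<le> 2 ^ n" by (simp add: n_def)
  qed
  have PN: "P m = (if m \<in> N then 2 ^ n else 0)" if mp: "m < p" "m \<notin> V" for m
  proof (cases "m \<in> N")
    case True
    hence "P m = (\<Prod>j\<in>S. 2)" unfolding P_def
      by (intro prod.cong refl) (use \<eta> in \<open>force simp: N_def pattern_class_def L_def\<close>)
    thus ?thesis using True by (simp add: n_def)
  next
    case False
    then obtain j where j: "j \<in> S" "L m j \<noteq> \<eta> j" using mp by (auto simp: N_def pattern_class_def L_def)
    moreover have "L m j \<noteq> 0" using mp j by (auto simp: V_def)
    ultimately have "1 + \<eta> j * L m j = 0" using \<eta>[OF j(1)] Lval[of m j] by auto
    hence "P m = 0" unfolding P_def using j S by (auto intro: prod_zero)
    thus ?thesis using False by simp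
  qed
  have NV: "N \<inter> V = {}" using \<eta> by (force simp: N_def V_def pattern_class_def L_def)
  have Nsub: "N \<subseteq> {..<p}" "V \<subseteq> {..<p}" by (auto simp: N_def V_def pattern_class_def)
  have cV: "card V \<le> n" unfolding V_def L_def n_def by (rule card_vanishing_le[OF p S(1)])
  have "(\<Sum>m<p. P m) = (\<Sum>m\<in>{..<p} - V. P m) + (\<Sum>m\<in>V. P m)"
    using Nsub by (intro sum.subset_diff) auto
  also have "(\<Sum>m\<in>{..<p} - V. P m) = (\<Sum>m\<in>{..<p} - V. if m \<in> N then 2 ^ n else 0)"
    by (intro sum.cong refl PN) auto
  also have "\<dots> = (\<Sum>m\<in>N. 2 ^ n)"
  proof -
    have "({..<p} - V) \<inter> N = N" using NV Nsub by auto
    thus ?thesis by (simp add: sum.inter_restrict[symmetric])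
  qed
  also have "\<dots> = card N * 2 ^ n" by simp
  finally have tot: "(\<Sum>m<p. P m) = card N * 2 ^ n + (\<Sum>m\<in>V. P m)" .
  have Vb: "0 \<le> (\<Sum>m\<in>V. P m)" "(\<Sum>m\<in>V. P m) \<le> card V * 2 ^ n"
    using P0 by (auto intro: sum_nonneg sum_bounded_above)
  define Z where "Z = (\<lambda>T. \<Sum>m<p. \<Prod>j\<in>T. L m j)"
  have "P m = (\<Sum>T\<in>Pow S. (\<Prod>j\<in>T. \<eta> j) * (\<Prod>j\<in>T. L m j))" for m
    unfolding P_def using prod_add[OF S(1), of "\<lambda>j. \<eta> j * L m j" "\<lambda>_. 1"]
    by (simp add: add.commute prod.distrib)
  hence "(\<Sum>m<p. P m) = (\<Sum>m<p. \<Sum>T\<in>Pow S. (\<Prod>j\<in>T. \<eta> j) * (\<Prod>j\<in>T. L m j))" by simp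
  also have "\<dots> = (\<Sum>T\<in>Pow S. (\<Prod>j\<in>T. \<eta> j) * Z T)"
    by (subst sum.swap) (simp add: Z_def sum_distrib_left)
  also have "\<dots> = (\<Prod>j\<in>{}. \<eta> j) * Z {} + (\<Sum>T\<in>Pow S - {{}}. (\<Prod>j\<in>T. \<eta> j) * Z T)"
    using S by (intro sum.remove) auto
  also have "(\<Prod>j\<in>{}. \<eta> j) * Z {} = int p" by (simp add: Z_def)
  finally have main: "(\<Sum>m<p. P m) = int p + (\<Sum>T\<in>Pow S - {{}}. (\<Prod>j\<in>T. \<eta> j) * Z T)" .
  define b :: real where "b = 1 + 3 * n + n * p / \<mu>"
  have Zb: "\<bar>real_of_int ((\<Prod>j\<in>T. \<eta> j) * Z T)\<bar> \<le> b" if T: "T \<in> Pow S - {{}}" for T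
  proof -
    have fT: "finite T" "T \<noteq> {}" "card T \<le> n" using T S finite_subset card_mono by (auto simp: n_def)
    have "\<mu> * (2 * \<mu> * card T + \<mu> + 1) + card T \<le> \<mu> * (2 * \<mu> * n + \<mu> + 1) + n"
      using fT by (intro add_mono mult_left_mono) auto
    hence l: "\<mu> * (2 * \<mu> * card T + \<mu> + 1) + card T < p div 2" using large by (simp add: n_def)
    have "inj_on (\<lambda>j. j mod int p) T" using S(2) T inj_on_subset by blast
    hence "\<bar>Z T\<bar> * int \<mu> \<le> int \<mu> * (1 + 3 * card T) + card T * p"
      using legendre_sums_small[OF p] fT \<mu> l unfolding legendre_sums_small_def Z_def L_def by blast
    also have "\<dots> \<le> int \<mu> * (1 + 3 * n) + int n * p"
    proof -
      have "int (card T) * int p \<le> int n * int p" by (rule mult_right_mono) (use fT in auto)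
      moreover have "int \<mu> * (1 + 3 * int (card T)) \<le> int \<mu> * (1 + 3 * int n)"
        by (rule mult_left_mono) (use fT in auto)
      ultimately show ?thesis by simp
    qed
    finally have "real_of_int (\<bar>Z T\<bar> * int \<mu>) \<le> real_of_int (int \<mu> * (1 + 3 * n) + int n * p)"
      by (simp only: of_int_le_iff)
    moreover have "b * \<mu> = \<mu> * (1 + 3 * n) + n * p" using \<mu> by (simp add: b_def distrib_right)
    ultimately have "\<bar>real_of_int (Z T)\<bar> * \<mu> \<le> b * \<mu>" by (simp add: algebra_simps)
    hence zb: "\<bar>real_of_int (Z T)\<bar> \<le> b" using \<mu> by simp
    have "\<bar>\<Prod>j\<in>T. \<eta> j\<bar> = (\<Prod>j\<in>T. \<bar>\<eta> j\<bar>)" by (rule abs_prod)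
    also have "\<dots> = (\<Prod>j\<in>T. 1)" by (intro prod.cong refl) (use \<eta> T in force)
    finally have "\<bar>\<Prod>j\<in>T. \<eta> j\<bar> = 1" by simp
    hence "\<bar>real_of_int (\<Prod>j\<in>T. \<eta> j)\<bar> = 1" by (simp only: of_int_abs[symmetric])
    thus ?thesis unfolding of_int_mult abs_mult using zb by simp
  qed
  have b0: "b \<ge> 0" by (simp add: b_def)
  have "\<bar>real_of_int (\<Sum>m<p. P m) - p\<bar> = \<bar>\<Sum>T\<in>Pow S - {{}}. real_of_int ((\<Prod>j\<in>T. \<eta> j) * Z T)\<bar>"
    unfolding main by simp
  also have "\<dots> \<le> (\<Sum>T\<in>Pow S - {{}}. b)"
    by (rule order_trans[OF sum_abs]) (intro sum_mono Zb)
  also have "\<dots> \<le> (\<Sum>T\<in>Pow S. b)" by (rule sum_mono2) (use S b0 in auto)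
  also have "\<dots> = 2 ^ n * b" using S by (simp add: card_Pow n_def)
  finally have 1: "\<bar>real_of_int (\<Sum>m<p. P m) - p\<bar> \<le> 2 ^ n * b" .
  have 2: "\<bar>real (card N) * 2 ^ n - real_of_int (\<Sum>m<p. P m)\<bar> \<le> 2 ^ n * n"
  proof -
    have "real_of_int (\<Sum>m<p. P m) = real (card N) * 2 ^ n + real_of_int (\<Sum>m\<in>V. P m)"
      unfolding tot by simp
    moreover have "real_of_int (\<Sum>m\<in>V. P m) \<ge> 0" using Vb(1) by (simp only: of_int_0_le_iff)
    moreover have "(\<Sum>m\<in>V. P m) \<le> int n * 2 ^ n"
    proof -
      have "(\<Sum>m\<in>V. P m) \<le> int (card V) * 2 ^ n" using Vb(2) by simp
      also have "\<dots> \<le> int n * 2 ^ n" by (rule mult_right_mono) (use cV in auto)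
      finally show ?thesis .
    qed
    hence "real_of_int (\<Sum>m\<in>V. P m) \<le> real_of_int (int n * 2 ^ n)" by (simp only: of_int_le_iff)
    ultimately show ?thesis by (simp add: mult.commute)
  qed
  have p0: "real p > 0" using p_gt_2[OF p] by simp
  have "\<bar>real (card N) * 2 ^ n - p\<bar> \<le> 2 ^ n * (b + n)" using 1 2 by (simp add: distrib_left)
  hence "\<bar>real (card N) * 2 ^ n - p\<bar> / (2 ^ n * p) \<le> 2 ^ n * (b + n) / (2 ^ n * p)"
    using p0 by (intro divide_right_mono) auto
  also have "\<bar>real (card N) * 2 ^ n - p\<bar> / (2 ^ n * p) = \<bar>(real (card N) * 2 ^ n - p) / (2 ^ n * p)\<bar>"
    using p0 by simp
  also have "(real (card N) * 2 ^ n - p) / (2 ^ n * p) = real (card N) / p - 1 / 2 ^ n"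
    using p0 by (simp add: field_simps)
  also have "2 ^ n * (b + n) / (2 ^ n * p) = (b + n) / p" by simp
  also have "\<dots> = (1 + 4 * n) / p + n / \<mu>" using p0 \<mu> by (simp add: b_def field_simps)
  finally show ?thesis by (simp add: N_def n_def)
qed

theorem pattern_class_density:
  assumes S: "finite S" and \<eta>: "\<And>j. j \<in> S \<Longrightarrow> \<eta> j = 1 \<or> \<eta> j = -1"
  shows "((\<lambda>p. real (card (pattern_class p S \<eta>)) / p) \<longlongrightarrow> 1 / 2 ^ card S) odd_primes_at_top"
proof (rule tendstoI)
  fix \<epsilon> :: real assume "\<epsilon> > 0"
  define n where "n = card S"
  obtain \<mu>0 :: nat where \<mu>0: "2 * n / \<epsilon> < \<mu>0" using reals_Archimedean2 by blast
  define \<mu> where "\<mu> = Suc \<mu>0"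
  have \<mu>: "\<mu> > 0" "n / \<mu> < \<epsilon> / 2"
  proof -
    have "2 * n / \<epsilon> < \<mu>" using \<mu>0 by (simp add: \<mu>_def)
    hence "2 * n < \<mu> * \<epsilon>" using \<open>\<epsilon> > 0\<close> by (simp add: pos_divide_less_eq)
    thus "n / \<mu> < \<epsilon> / 2" by (simp add: \<mu>_def pos_divide_less_eq mult.commute)
  qed (simp add: \<mu>_def)
  obtain N1 :: nat where N1: "2 * (1 + 4 * n) / \<epsilon> < N1" using reals_Archimedean2 by blast
  define M where "M = (if S = {} then 0 else Max (abs ` S))"
  have M: "\<bar>j\<bar> \<le> M" if "j \<in> S" for j
    using that S by (auto simp: M_def)
  define W where "W = \<mu> * (2 * \<mu> * n + \<mu> + 1) + n"
  define N where "N = N1 + 2 * W + 2 + nat (2 * M + 1) + 1"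
  show "eventually (\<lambda>p. dist (real (card (pattern_class p S \<eta>)) / p) (1 / 2 ^ card S) < \<epsilon>) odd_primes_at_top"
    using eventually_odd_primes_ge[of N]
  proof eventually_elim
    case (elim p)
    have "N \<le> p" using elim by blast
    hence pN: "N1 + 2 * W + 2 + nat (2 * M + 1) + 1 \<le> p" unfolding N_def .
    have inj: "inj_on (\<lambda>j. j mod int p) S"
    proof (rule inj_on_mod)
      fix i j assume ij: "i \<in> S" "j \<in> S"
      have "nat (2 * M + 1) \<le> p" by (rule le_trans[OF _ pN]) simp
      hence "2 * M + 1 \<le> int p" by (simp only: nat_le_iff)
      thus "\<bar>i - j\<bar> < int p" using M[OF ij(1)] M[OF ij(2)] by linarith
    qed
    have "2 * W + 2 \<le> p" "N1 \<le> p" by (rule le_trans[OF _ pN], simp)+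
    hence "W < p div 2" by linarith
    hence l: "\<mu> * (2 * \<mu> * card S + \<mu> + 1) + card S < p div 2" by (simp only: W_def n_def)
    have p0: "real p > 0" "real p \<ge> N1" using \<open>2 * W + 2 \<le> p\<close> \<open>N1 \<le> p\<close> by linarith+
    have pp: "prime p" "odd p" using elim by blast+
    have "\<bar>real (card (pattern_class p S \<eta>)) / p - 1 / 2 ^ card S\<bar> \<le> (1 + 4 * n) / p + n / \<mu>"
      unfolding n_def using pattern_class_card_bound[OF pp S inj \<eta> \<mu>(1) l] by simp
    moreover have "(1 + 4 * n) / p < \<epsilon> / 2"
    proof -
      have "2 * (1 + 4 * n) / \<epsilon> < p" using N1 p0 by linarith
      hence "2 * (1 + 4 * n) < p * \<epsilon>" using \<open>\<epsilon> > 0\<close> by (simp add: pos_divide_less_eq)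
      thus ?thesis using p0 by (simp add: pos_divide_less_eq mult.commute)
    qed
    ultimately show ?case unfolding dist_real_def using \<mu>(2) by linarith
  qed
qed

section \<open>Counting the zeros arc by arc\<close>

definition window :: "nat \<Rightarrow> int set" where
  "window p = {- int (p div 2)..int (p div 2)}"

definition rel_sign :: "nat \<Rightarrow> nat \<Rightarrow> int \<Rightarrow> real" where
  "rel_sign p m j = real_of_int (Legendre (int m) (int p) * Legendre (int m - j) (int p))"

definition block_zeros :: "nat \<Rightarrow> nat \<Rightarrow> real set" where
  "block_zeros p m = {x. 0 < x \<and> x < 1 \<and> poly (fekete_poly p) (cis (2 * pi * (real m + x) / p)) = 0}"

definition circle_zeros :: "nat \<Rightarrow> complex set" where
  "circle_zeros p = {z. norm z = 1 \<and> poly (fekete_poly p) z = 0}"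

lemma cis_eq_close:
  assumes "cis a = cis b" "\<bar>a - b\<bar> < 2 * pi"
  shows "a = b"
proof -
  have "cis (a - b) = 1" using assms(1) by (simp flip: cis_divide)
  hence "cos (a - b) = 1" by (simp add: complex_eq_iff)
  then obtain n :: int where n: "a - b = of_int n * 2 * pi" using cos_one_2pi_int by blast
  hence "\<bar>real_of_int n\<bar> * (2 * pi) < 1 * (2 * pi)" using assms(2) by (simp add: abs_mult)
  hence "\<bar>real_of_int n\<bar> < 1" by (rule mult_right_less_imp_less) simp
  hence "n = 0" by linarith
  thus ?thesis using n by simp
qed

lemma cot_sum_scale: "cot_sum q B (\<lambda>j. c * \<delta> j) x = c * cot_sum q B \<delta> x"
  by (simp add: cot_sum_def sum_distrib_left mult.assoc)

context
  fixes p :: nat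
  assumes prime: "prime p" and odd: "odd p" and big: "p \<ge> 100"
begin

lemma p_eq: "p = 2 * (p div 2) + 1"
  using odd by simp

lemma window_bound: "j \<in> window p \<Longrightarrow> 2 * \<bar>j\<bar> + 1 \<le> int p"
  using p_eq by (auto simp: window_def)

lemma zero_in_window: "0 \<in> window p" "-1 \<in> window p"
  using big by (auto simp: window_def)

lemma rel_sign_abs_le: "\<bar>rel_sign p m j\<bar> \<le> 1"
  using Legendre_values[OF prime odd, of "int m"] Legendre_values[OF prime odd, of "int m - j"]
  by (auto simp: rel_sign_def)

lemma Legendre_nz: "1 \<le> m \<Longrightarrow> m < p \<Longrightarrow> Legendre (int m) (int p) \<noteq> 0"
  using Legendre_eq_0_iff[OF prime odd, of "int m"] by (auto dest: zdvd_imp_le)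

lemma block_zeros_eq:
  assumes "1 \<le> m" "m < p"
  shows "block_zeros p m = {x. 0 < x \<and> x < 1 \<and> cot_sum p (window p) (rel_sign p m) x = 0}"
proof -
  have "poly (fekete_poly p) (cis (2 * pi * (real m + x) / p)) = 0 \<longleftrightarrow>
        cot_sum p (window p) (rel_sign p m) x = 0" if "0 < x" "x < 1" for x
  proof -
    have "cot_sum p (window p) (rel_sign p m) x
        = Legendre (int m) (int p) * cot_sum p (window p) (\<lambda>j. Legendre (int m - j) (int p)) x"
      unfolding cot_sum_scale[symmetric] by (simp add: rel_sign_def[abs_def])
    moreover have "poly (fekete_poly p) (cis (2 * pi * (real_of_int (int m) + x) / p)) = 0 \<longleftrightarrow>
         cot_sum p (window p) (\<lambda>j. Legendre (int m - j) (int p)) x = 0"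
      unfolding window_def by (rule fekete_zero_iff_cot_sum[OF prime odd _ _ _ p_eq]) (use that in auto)
    ultimately show ?thesis using Legendre_nz[OF assms] by simp
  qed
  thus ?thesis by (auto simp: block_zeros_def)
qed

lemma rel_sign_0: "1 \<le> m \<Longrightarrow> m < p \<Longrightarrow> rel_sign p m 0 = 1"
  using Legendre_square[OF prime odd, of "int m"] Legendre_eq_0_iff[OF prime odd, of "int m"] Legendre_nz[of m]
  by (simp add: rel_sign_def flip: of_int_mult)

lemma card_block_zeros_same:
  assumes "1 \<le> m" "m < p" "rel_sign p m (-1) = 1"
  shows "card (block_zeros p m) = 1"
  unfolding block_zeros_eq[OF assms(1,2)]
  by (rule cot_sum_zeros_same_sign[OF big window_bound])
     (use zero_in_window rel_sign_0 assms rel_sign_abs_le in auto)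

lemma card_block_zeros_opposite:
  assumes "1 \<le> m" "m < p" "rel_sign p m (-1) = -1"
  shows "finite (block_zeros p m) \<and> card (block_zeros p m) \<le> 2"
    and "0 < y \<Longrightarrow> y < 1 \<Longrightarrow> cot_sum p (window p) (rel_sign p m) y < 0 \<Longrightarrow> card (block_zeros p m) = 2"
  unfolding block_zeros_eq[OF assms(1,2)]
  by (rule cot_sum_zeros_opposite_sign[OF big window_bound];
      use zero_in_window rel_sign_0 assms rel_sign_abs_le in auto)
     (rule cot_sum_zeros_opposite_sign_eq_2[OF big window_bound];
      use zero_in_window rel_sign_0 assms rel_sign_abs_le in auto)

lemma central_zeros_bound:
  defines "T \<equiv> {t. -1 < t \<and> t < 1 \<and> poly (fekete_poly p) (cis (2 * pi * t / p)) = 0}"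
  shows "finite T \<and> card T \<le> 3"
proof -
  define \<delta> where "\<delta> = (\<lambda>j. real_of_int (Legendre (- j) (int p)))"
  define k where "k = p div 2"
  define Z where "Z = {x. -1 < x \<and> x < 1 \<and> cot_sum p {j. j \<noteq> 0 \<and> \<bar>j\<bar> \<le> int k} \<delta> x = 0}"
  have k: "k \<ge> 1" "2 * k + 1 \<le> p" using big p_eq by (auto simp: k_def)
  have L: "Legendre j (int p) \<in> {-1, 0, 1}" for j by (rule Legendre_values[OF prime odd])
  have nz: "Legendre (-1) (int p) \<noteq> 0" "Legendre 1 (int p) = 1"
    using Legendre_eq_0_iff[OF prime odd, of "-1"] Legendre_1[OF prime odd] big by (auto simp: zdvd1_eq)
  have "finite Z \<and> card Z \<le> 2"
    unfolding Z_def
  proof (rule central_zeros[OF big k])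
    show "\<bar>\<delta> 1\<bar> = 1" using L[of "-1"] nz by (auto simp: \<delta>_def)
    show "\<bar>\<delta> j\<bar> \<le> 1" for j using L[of "- j"] by (auto simp: \<delta>_def)
    show "\<delta> (-1) = \<delta> 1 \<or> \<delta> (-1) = - \<delta> 1" using L[of "-1"] nz by (auto simp: \<delta>_def)
  qed
  moreover have "T \<subseteq> insert 0 Z"
  proof
    fix t assume t: "t \<in> T"
    show "t \<in> insert 0 Z"
    proof (cases "t = 0")
      case False
      have w: "{- int k..int k} = insert 0 {j. j \<noteq> 0 \<and> \<bar>j\<bar> \<le> int k}" by auto
      have f: "finite {j. j \<noteq> 0 \<and> \<bar>j\<bar> \<le> int k}" by (rule finite_subset[of _ "{- int k..int k}"]) auto
      have "poly (fekete_poly p) (cis (2 * pi * (of_int 0 + t) / p)) = 0" using t by (simp add: T_def)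
      hence "cot_sum p {- int k..int k} (\<lambda>j. Legendre (0 - j) (int p)) t = 0"
        using t False fekete_zero_iff_cot_sum[OF prime odd _ _ False, of k 0] p_eq by (simp add: T_def k_def)
      moreover have "cot_sum p {- int k..int k} (\<lambda>j. Legendre (0 - j) (int p)) t
          = cot_sum p {j. j \<noteq> 0 \<and> \<bar>j\<bar> \<le> int k} \<delta> t"
        unfolding cot_sum_def w using Legendre_eq_0_iff[OF prime odd, of 0]
        by (subst sum.insert[OF f]) (simp_all add: \<delta>_def)
      ultimately have "cot_sum p {j. j \<noteq> 0 \<and> \<bar>j\<bar> \<le> int k} \<delta> t = 0" by simp
      thus ?thesis using t by (simp add: Z_def T_def)
    qed simp
  qed
  ultimately have "finite T" "card T \<le> card (insert 0 Z)"
    by (auto intro: finite_subset card_mono)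
  moreover have "card (insert 0 Z) \<le> 3"
    using \<open>finite Z \<and> card Z \<le> 2\<close> card_insert_le_m1[of 3 Z 0] by simp
  ultimately show ?thesis by simp
qed

text \<open>
  The circle is parametrised by \<open>-1 \<le> t < p - 1\<close> rather than \<open>0 \<le> t < p\<close>, so that both exceptional arcs, on
  which one of the two dominant terms vanishes, make up the single interval \<open>(-1,1)\<close>.
\<close>
lemma card_circle_zeros:
  "\<exists>c \<le> 3. card (circle_zeros p) = c + (\<Sum>m\<in>{1..p - 2}. card (block_zeros p m))"
proof -
  define e where "e = (\<lambda>t. cis (2 * pi * t / p))"
  have p0: "real p > 0" using big by simp
  define zero where "zero = (\<lambda>t. poly (fekete_poly p) (e t) = 0)"
  define Tc where "Tc = {t. -1 < t \<and> t < 1 \<and> zero t}"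
  define Tm where "Tm = (\<lambda>m::nat. {t. real m < t \<and> t < real m + 1 \<and> zero t})"
  define T where "T = {t. -1 \<le> t \<and> t < real p - 1 \<and> zero t}"
  have inj: "inj_on e T"
  proof (rule inj_onI)
    fix s t assume st: "s \<in> T" "t \<in> T" "e s = e t"
    have "\<bar>2 * pi * s / p - 2 * pi * t / p\<bar> = 2 * pi * (\<bar>s - t\<bar> / p)"
      using p0 by (simp add: abs_mult abs_divide flip: right_diff_distrib diff_divide_distrib)
    also have "\<dots> < 2 * pi * 1"
      using st p0 by (intro mult_strict_left_mono) (auto simp: T_def abs_if)
    finally have "2 * pi * s / p = 2 * pi * t / p"
      using st(3) by (intro cis_eq_close) (auto simp: e_def)
    thus "s = t" using p0 by simp
  qed
  have img: "e ` T = circle_zeros p"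
  proof (intro equalityI subsetI)
    fix z assume z: "z \<in> circle_zeros p"
    hence "cis (Arg z) = z" using rcis_cmod_Arg[of z] by (simp add: circle_zeros_def rcis_def)
    define t0 where "t0 = Arg z * p / (2 * pi)"
    define n where "n = \<lfloor>(t0 + 1) / p\<rfloor>"
    define t where "t = t0 - p * n"
    have "e t0 = z" using p0 \<open>cis (Arg z) = z\<close> by (simp add: e_def t0_def)
    have "2 * pi * t / p = 2 * pi * t0 / p + 2 * pi * of_int (- n)"
      using p0 by (simp add: t_def field_simps)
    hence "e t = e t0 * cis (2 * pi * of_int (- n))" by (simp add: e_def cis_mult)
    hence et: "e t = z" using \<open>e t0 = z\<close> cis_multiple_2pi[of "of_int (- n)"] by simp
    have "of_int n \<le> (t0 + 1) / p" "(t0 + 1) / p < of_int n + 1" unfolding n_def by linarith+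
    hence "-1 \<le> t" "t < real p - 1" using p0 by (auto simp: t_def field_simps)
    hence "t \<in> T" using z et by (simp add: T_def zero_def circle_zeros_def)
    thus "z \<in> e ` T" using et by blast
  qed (auto simp: T_def zero_def circle_zeros_def e_def)
  have int_nz: "\<not> zero (of_int i)" if "\<not> int p dvd i" for i
  proof -
    have "e (of_int i) = unit_char p i" by (simp add: e_def unit_char_def[OF prime odd])
    hence "poly (fekete_poly p) (e (of_int i)) = of_int (Legendre i (int p)) * gauss_sum p"
      using poly_fekete_unit_char[OF prime odd, of i] by simp
    moreover have "Legendre i (int p) \<noteq> 0" using Legendre_eq_0_iff[OF prime odd, of i] that by simp
    ultimately show ?thesis using gauss_sum_nz[OF prime odd] by (simp add: zero_def)
  qed
  have split: "T = Tc \<union> (\<Union>m\<in>{1..p - 2}. Tm m)"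
  proof (intro equalityI subsetI)
    fix t assume t: "t \<in> T"
    show "t \<in> Tc \<union> (\<Union>m\<in>{1..p - 2}. Tm m)"
    proof (cases "-1 < t \<and> t < 1")
      case False
      have "t \<noteq> -1"
        using int_nz[of "-1"] big t by (auto simp: T_def zdvd1_eq)
      hence t1: "t \<ge> 1" using False t by (auto simp: T_def)
      define m where "m = nat \<lfloor>t\<rfloor>"
      have m: "real m \<le> t" "t < real m + 1" "m \<ge> 1" using t1 unfolding m_def by linarith+
      have "real m < real p - 1" using m t by (auto simp: T_def)
      hence mp: "m \<le> p - 2" using big by linarith
      have "\<not> int p dvd int m" using m mp big by (auto dest!: dvd_imp_le)
      hence "t \<noteq> real m" using int_nz[of "int m"] t by (auto simp: T_def)
      thus ?thesis using m mp t by (auto simp: Tm_def T_def)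
    qed (use t in \<open>auto simp: T_def Tc_def\<close>)
  next
    fix t assume "t \<in> Tc \<union> (\<Union>m\<in>{1..p - 2}. Tm m)"
    thus "t \<in> T"
    proof
      assume "t \<in> (\<Union>m\<in>{1..p - 2}. Tm m)"
      then obtain m where m: "m \<in> {1..p - 2}" "t \<in> Tm m" by blast
      hence "real m + 1 \<le> real p - 1" using big by auto
      thus ?thesis using m by (auto simp: T_def Tm_def)
    qed (use big in \<open>auto simp: T_def Tc_def\<close>)
  qed
  have Tm_eq: "Tm m = (\<lambda>x. real m + x) ` block_zeros p m" for m
  proof (intro equalityI subsetI)
    fix t assume "t \<in> Tm m"
    hence "t - real m \<in> block_zeros p m" by (auto simp: Tm_def block_zeros_def zero_def e_def)
    thus "t \<in> (\<lambda>x. real m + x) ` block_zeros p m" by (intro image_eqI[of _ _ "t - real m"]) auto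
  qed (auto simp: Tm_def block_zeros_def zero_def e_def)
  have fT: "finite T"
  proof -
    have "fekete_poly p \<noteq> 0"
    proof
      assume "fekete_poly p = 0"
      hence "zero (of_int 1)" by (simp add: zero_def)
      thus False using int_nz[of 1] big by (auto simp: zdvd1_eq)
    qed
    hence "finite {z. poly (fekete_poly p) z = 0}" by (rule poly_roots_finite)
    hence "finite (circle_zeros p)" by (rule finite_subset[rotated]) (auto simp: circle_zeros_def)
    thus ?thesis using finite_image_iff[OF inj] img by simp
  qed
  have fin: "finite Tc" "finite (Tm m)" if "m \<in> {1..p - 2}" for m
    using fT that unfolding split by (auto intro: finite_subset)
  have "card (circle_zeros p) = card T" using card_image[OF inj] img by simp
  also have "\<dots> = card Tc + card (\<Union>m\<in>{1..p - 2}. Tm m)"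
    unfolding split
  proof (rule card_Un_disjoint)
    show "finite Tc" "finite (\<Union>m\<in>{1..p - 2}. Tm m)" using fT by (simp_all add: split)
    show "Tc \<inter> (\<Union>m\<in>{1..p - 2}. Tm m) = {}" by (auto simp: Tc_def Tm_def)
  qed
  also have "card (\<Union>m\<in>{1..p - 2}. Tm m) = (\<Sum>m\<in>{1..p - 2}. card (Tm m))"
  proof (rule card_UN_disjoint)
    show "\<forall>i\<in>{1..p - 2}. \<forall>j\<in>{1..p - 2}. i \<noteq> j \<longrightarrow> Tm i \<inter> Tm j = {}"
    proof (intro ballI impI)
      fix i j :: nat assume "i \<noteq> j"
      hence "real i + 1 \<le> real j \<or> real j + 1 \<le> real i" by linarith
      thus "Tm i \<inter> Tm j = {}" by (auto simp: Tm_def)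
    qed
  qed (use fin in auto)
  also have "\<dots> = (\<Sum>m\<in>{1..p - 2}. card (block_zeros p m))"
    unfolding Tm_eq by (intro sum.cong refl card_image) (auto simp: inj_on_def)
  finally show ?thesis
    using central_zeros_bound by (intro exI[of _ "card Tc"]) (simp add: Tc_def zero_def e_def)
qed

end

section \<open>Comparison with the truncated rational function\<close>

text \<open>
  The coefficient at \<open>j\<close> in the difference between the cotangent sum and the truncated rational
  function, both evaluated at \<open>x = 1/2\<close>.
\<close>
definition tail_coeff :: "nat \<Rightarrow> nat \<Rightarrow> int \<Rightarrow> real" where
  "tail_coeff p J j = cot_kernel p (1 / 2 + of_int j) - (if \<bar>j\<bar> < int J then 1 / (1 / 2 + of_int j) else 0)"

context
  fixes p J :: nat
  assumes prime: "prime p" and odd: "odd p" and big: "p \<ge> 100" and J: "J \<ge> 2" "2 * J \<le> p"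
begin

lemma J_le: "int J \<le> int (p div 2)"
  using J by linarith

lemma inner_subset: "{j. \<bar>j\<bar> < int J} \<subseteq> window p"
  using J_le by (auto simp: window_def)

lemma inner_eq: "{j. \<bar>j\<bar> < int J} = insert 0 (insert (-1) (F_indices J))"
  using J by (auto simp: F_indices_def)

lemma outer_gap: "j \<in> window p - {j. \<bar>j\<bar> < int J} \<Longrightarrow> gap j \<ge> int (J - 1)"
  using J by (auto simp: gap_def)

lemma finite_window: "finite (window p)"
  by (simp add: window_def)

lemma card_window: "card (window p) = p"
  using p_eq[OF prime odd big] by (simp add: window_def)

lemma half_in_range: "j \<in> window p \<Longrightarrow> \<bar>1 / 2 + real_of_int j\<bar> \<le> (real p + 1) / 2"
  by (rule shift_in_range[OF big window_bound[OF prime odd big]]) auto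

lemma sum_tail_coeff_squares:
  "(\<Sum>j\<in>window p. (tail_coeff p J j)\<^sup>2) \<le> 100 / p + 4 / real (J - 1)"
proof -
  have nz: "1 / 2 + real_of_int j \<noteq> 0" for j by (rule shift_nz) auto
  have "(\<Sum>j\<in>window p. (tail_coeff p J j)\<^sup>2)
      = (\<Sum>j\<in>window p - {j. \<bar>j\<bar> < int J}. (tail_coeff p J j)\<^sup>2) + (\<Sum>j | \<bar>j\<bar> < int J. (tail_coeff p J j)\<^sup>2)"
    by (rule sum.subset_diff[OF inner_subset finite_window])
  also have "(\<Sum>j\<in>window p - {j. \<bar>j\<bar> < int J}. (tail_coeff p J j)\<^sup>2)
      \<le> (\<Sum>j\<in>window p - {j. \<bar>j\<bar> < int J}. 1 / (1 / 2 + of_int j)\<^sup>2)"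
  proof (rule sum_mono)
    fix j assume j: "j \<in> window p - {j. \<bar>j\<bar> < int J}"
    hence "\<bar>cot_kernel p (1 / 2 + of_int j)\<bar> \<le> 1 / \<bar>1 / 2 + of_int j\<bar>"
      by (intro cot_kernel_bounds(1)[OF big] nz half_in_range) auto
    hence "\<bar>tail_coeff p J j\<bar>\<^sup>2 \<le> (1 / \<bar>1 / 2 + of_int j\<bar>)\<^sup>2"
      using j by (intro power_mono) (auto simp: tail_coeff_def)
    thus "(tail_coeff p J j)\<^sup>2 \<le> 1 / (1 / 2 + of_int j)\<^sup>2" by (simp add: power_divide)
  qed
  also have "\<dots> \<le> 4 / real (J - 1)"
    by (rule sum_inverse_shift_squares_le) (use finite_window outer_gap J in auto)
  also have "(\<Sum>j | \<bar>j\<bar> < int J. (tail_coeff p J j)\<^sup>2) \<le> (\<Sum>j | \<bar>j\<bar> < int J. (10 / p)\<^sup>2)"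
  proof (rule sum_mono)
    fix j assume j: "j \<in> {j. \<bar>j\<bar> < int J}"
    have jJ: "\<bar>real_of_int j\<bar> + 1 \<le> real J"
    proof -
      have "\<bar>j\<bar> + 1 \<le> int J" using j by simp
      hence "real_of_int (\<bar>j\<bar> + 1) \<le> real_of_int (int J)" by (simp only: of_int_le_iff)
      thus ?thesis by simp
    qed
    have r: "\<bar>1 / 2 + real_of_int j\<bar> \<le> p / 2"
    proof -
      have "\<bar>1 / 2 + real_of_int j\<bar> \<le> \<bar>1 / 2\<bar> + \<bar>real_of_int j\<bar>" by (rule abs_triangle_ineq)
      also have "\<dots> \<le> real J" using jJ by simp
      also have "\<dots> \<le> p / 2" using J by linarith
      finally show ?thesis .
    qed
    have "\<bar>tail_coeff p J j\<bar> = \<bar>cot_kernel p (1 / 2 + of_int j) - 1 / (1 / 2 + of_int j)\<bar>"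
      using j by (simp add: tail_coeff_def)
    also have "\<dots> \<le> 10 / (real p)\<^sup>2 * \<bar>1 / 2 + of_int j\<bar>"
      using r nz by (intro cot_kernel_bounds(2)[OF big]) auto
    also have "\<dots> \<le> 10 / (real p)\<^sup>2 * p" using r by (intro mult_left_mono) auto
    also have "\<dots> = 10 / p" using big by (simp add: power2_eq_square)
    finally have "\<bar>tail_coeff p J j\<bar>\<^sup>2 \<le> (10 / p)\<^sup>2" by (intro power_mono) auto
    thus "(tail_coeff p J j)\<^sup>2 \<le> (10 / p)\<^sup>2" by simp
  qed
  also have "\<dots> \<le> p * (10 / p)\<^sup>2"
    using card_mono[OF finite_window inner_subset] card_window by (simp add: mult_right_mono)
  also have "\<dots> = 100 / p" using big by (simp add: power2_eq_square)
  finally show ?thesis by simp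
qed

text \<open>
  The difference of the two functions has a derivative bounded by \<open>4/(J-1) + 20/p\<close> whatever the
  signs are, so it is controlled by its value at the single point \<open>1/2\<close>.  Only there
  the randomness of the signs is needed.
\<close>
lemma cot_sum_F_fun_close:
  assumes \<delta>: "\<delta> 0 = 1" "\<delta> (-1) = -1" "\<And>j. \<bar>\<delta> j\<bar> \<le> 1" and x: "0 < x" "x < 1"
  shows "\<bar>cot_sum p (window p) \<delta> x - F_fun J \<delta> x\<bar>
           \<le> \<bar>\<Sum>j\<in>window p. \<delta> j * tail_coeff p J j\<bar> + 4 / real (J - 1) + 20 / p"
proof -
  define I where "I = {j. \<bar>j\<bar> < int J}"
  define C where "C = window p - I"
  have fin: "finite I" "finite C" using inner_subset finite_window finite_subset by (auto simp: I_def C_def)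
  define g where "g = (\<lambda>y. \<Sum>j\<in>I. \<delta> j / (y + of_int j))"
  define g1 where "g1 = (\<lambda>y. \<Sum>j\<in>I. \<delta> j / (y + of_int j)\<^sup>2)"
  define D where "D = (\<lambda>y. cot_sum p (window p) \<delta> y - g y)"
  define B where "B = 4 / real (J - 1) + 20 / p"
  have nz: "y + real_of_int j \<noteq> 0" if "0 < y" "y < 1" for y j
    using that by (rule shift_nz)
  have Fg: "F_fun J \<delta> y = g y" if "0 < y" "y < 1" for y
  proof -
    have "0 \<notin> insert (-1) (F_indices J)" "-1 \<notin> F_indices J" by (auto simp: F_indices_def)
    hence "g y = \<delta> 0 / (y + of_int 0) + (\<delta> (-1) / (y + of_int (-1)) + (\<Sum>j\<in>F_indices J. \<delta> j / (y + of_int j)))"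
      unfolding g_def I_def inner_eq using finite_F_indices[of J] by simp
    also have "\<delta> (-1) / (y + of_int (-1)) = 1 / (1 - y)"
      using \<delta>(2) that by (simp add: divide_simps)
    finally show ?thesis by (simp add: F_fun_def \<delta>(1))
  qed
  have dD: "(D has_real_derivative - cot_sum1 p (window p) \<delta> y + g1 y) (at y)" if y: "0 < y" "y < 1" for y
  proof -
    have a: "(cot_sum p (window p) \<delta> has_real_derivative - cot_sum1 p (window p) \<delta> y) (at y)"
      by (rule DERIV_cot_sum[OF big window_bound[OF prime odd big]]) (use y nz[OF y] in auto)
    have "((\<lambda>y. \<delta> j / (y + of_int j)) has_real_derivative - (\<delta> j / (y + of_int j)\<^sup>2)) (at y)" for j
      using nz[OF y, of j] by (auto intro!: derivative_eq_intros simp: power2_eq_square)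
    hence "(g has_real_derivative (\<Sum>j\<in>I. - (\<delta> j / (y + of_int j)\<^sup>2))) (at y)"
      unfolding g_def by (intro DERIV_sum)
    hence "(g has_real_derivative - g1 y) (at y)" by (simp add: g1_def sum_negf)
    from DERIV_diff[OF a this] show ?thesis by (simp add: D_def)
  qed
  have bD: "\<bar>- cot_sum1 p (window p) \<delta> y + g1 y\<bar> \<le> B" if y: "0 < y" "y < 1" for y
  proof -
    have "cot_sum1 p (window p) \<delta> y = (\<Sum>j\<in>C. \<delta> j * cot_kernel1 p (y + of_int j)) + (\<Sum>j\<in>I. \<delta> j * cot_kernel1 p (y + of_int j))"
      unfolding cot_sum1_def C_def I_def by (rule sum.subset_diff[OF inner_subset finite_window])
    hence eq: "- cot_sum1 p (window p) \<delta> y + g1 y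
        = - (\<Sum>j\<in>C. \<delta> j * cot_kernel1 p (y + of_int j)) - (\<Sum>j\<in>I. \<delta> j * (cot_kernel1 p (y + of_int j) - 1 / (y + of_int j)\<^sup>2))"
      by (simp add: g1_def sum_subtractf right_diff_distrib)
    have "\<bar>- cot_sum1 p (window p) \<delta> y + g1 y\<bar> \<le> \<bar>\<Sum>j\<in>C. \<delta> j * cot_kernel1 p (y + of_int j)\<bar>
        + \<bar>\<Sum>j\<in>I. \<delta> j * (cot_kernel1 p (y + of_int j) - 1 / (y + of_int j)\<^sup>2)\<bar>"
      unfolding eq by (rule order_trans[OF abs_triangle_ineq4]) simp
    moreover have "\<bar>\<Sum>j\<in>C. \<delta> j * cot_kernel1 p (y + of_int j)\<bar> \<le> 4 / real (J - 1) + 10 / p"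
      by (rule sum_cot_kernel1_gap_le[where B = "window p", OF big])
         (use window_bound[OF prime odd big] \<delta>(3) J outer_gap y in \<open>auto simp: C_def I_def\<close>)
    moreover have "\<bar>\<Sum>j\<in>I. \<delta> j * (cot_kernel1 p (y + of_int j) - 1 / (y + of_int j)\<^sup>2)\<bar> \<le> 10 / p"
    proof -
      have "\<bar>\<Sum>j\<in>I. \<delta> j * (cot_kernel1 p (y + of_int j) - 1 / (y + of_int j)\<^sup>2)\<bar> \<le> (\<Sum>j\<in>I. 10 / (real p)\<^sup>2)"
      proof (rule order_trans[OF sum_abs sum_mono])
        fix j assume j: "j \<in> I"
        have r: "\<bar>y + of_int j\<bar> \<le> (real p + 1) / 2"
          by (rule shift_in_range[OF big window_bound[OF prime odd big]])
             (use y j inner_subset in \<open>auto simp: I_def\<close>)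
        have "\<bar>cot_kernel1 p (y + of_int j) - 1 / (y + of_int j)\<^sup>2\<bar> \<le> 10 / (real p)\<^sup>2"
          using cot_kernel1_bounds[OF big nz[OF y] r] by simp
        hence "\<bar>\<delta> j\<bar> * \<bar>cot_kernel1 p (y + of_int j) - 1 / (y + of_int j)\<^sup>2\<bar> \<le> 1 * (10 / (real p)\<^sup>2)"
          using \<delta>(3) by (intro mult_mono) auto
        thus "\<bar>\<delta> j * (cot_kernel1 p (y + of_int j) - 1 / (y + of_int j)\<^sup>2)\<bar> \<le> 10 / (real p)\<^sup>2"
          by (simp add: abs_mult)
      qed
      also have "\<dots> \<le> p * (10 / (real p)\<^sup>2)"
        using card_mono[OF finite_window inner_subset] card_window by (simp add: I_def mult_right_mono divide_right_mono)
      also have "\<dots> = 10 / p" using big by (simp add: power2_eq_square)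
      finally show ?thesis .
    qed
    moreover have "20 / real p = 10 / real p + 10 / real p" by simp
    ultimately show ?thesis unfolding B_def by argo
  qed
  have B0: "0 \<le> B" by (rule order_trans[OF abs_ge_zero bD[OF x]])
  have "norm (D x - D (1 / 2)) \<le> B * norm (x - 1 / 2)"
  proof (rule field_differentiable_bound[where S = "{0<..<1}"
        and f' = "\<lambda>y. - cot_sum1 p (window p) \<delta> y + g1 y"])
    show "(D has_field_derivative - cot_sum1 p (window p) \<delta> z + g1 z) (at z within {0<..<1})"
      if "z \<in> {0<..<1}" for z
      by (rule has_field_derivative_at_within, rule dD) (use that in simp_all)
    show "norm (- cot_sum1 p (window p) \<delta> z + g1 z) \<le> B" if "z \<in> {0<..<1}" for z
      unfolding real_norm_def by (rule bD) (use that in simp_all)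
    show "convex {0<..<1 :: real}" by (rule convex_real_interval)
    show "x \<in> {0<..<1}" "1 / 2 \<in> {0<..<1 :: real}" using x by simp_all
  qed
  also have "\<dots> \<le> B * 1"
  proof (rule mult_left_mono[OF _ B0])
    show "norm (x - 1 / 2) \<le> 1" unfolding real_norm_def using x by linarith
  qed
  finally have "\<bar>D x - D (1 / 2)\<bar> \<le> B" by (simp only: real_norm_def mult_1_right)
  hence Dx: "\<bar>D x\<bar> \<le> \<bar>D (1 / 2)\<bar> + B" using abs_triangle_ineq2[of "D x" "D (1 / 2)"] by linarith
  have D2: "D (1 / 2) = (\<Sum>j\<in>window p. \<delta> j * tail_coeff p J j)"
  proof -
    have "g (1 / 2) = (\<Sum>j\<in>window p. \<delta> j * (if \<bar>j\<bar> < int J then 1 / (1 / 2 + of_int j) else 0))"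
      unfolding g_def by (rule sum.mono_neutral_cong_left[OF finite_window])
        (use inner_subset in \<open>auto simp: I_def\<close>)
    thus ?thesis unfolding D_def cot_sum_def tail_coeff_def right_diff_distrib sum_subtractf by (simp only:)
  qed
  have "D x = cot_sum p (window p) \<delta> x - F_fun J \<delta> x" using Fg[OF x] by (simp only: D_def)
  thus ?thesis using Dx unfolding D2 B_def by (simp only: add.assoc)
qed

definition bad_shifts :: "real \<Rightarrow> nat set" where
  "bad_shifts c = {m. m < p \<and> \<bar>\<Sum>j\<in>window p. Legendre (int m - j) (int p) * tail_coeff p J j\<bar> > c}"

lemma card_bad_shifts:
  fixes c :: real
  assumes "c > 0"
  shows "card (bad_shifts c) * c\<^sup>2 \<le> p * (100 / p + 4 / real (J - 1))"
proof -
  have inj: "inj_on (\<lambda>j. j mod int p) (window p)"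
  proof (rule inj_on_mod)
    fix i j assume ij: "i \<in> window p" "j \<in> window p"
    show "\<bar>i - j\<bar> < int p"
      using window_bound[OF prime odd big ij(1)] window_bound[OF prime odd big ij(2)] by linarith
  qed
  have "card (bad_shifts c) * c\<^sup>2 \<le> p * (\<Sum>j\<in>window p. (tail_coeff p J j)\<^sup>2)"
    unfolding bad_shifts_def
    by (rule Legendre_large_deviation[OF prime odd finite_window inj assms])
  also have "\<dots> \<le> p * (100 / p + 4 / real (J - 1))"
    by (intro mult_left_mono sum_tail_coeff_squares) auto
  finally show ?thesis .
qed

lemma rel_sign_close:
  fixes c x :: real
  assumes m: "1 \<le> m" "m < p" "rel_sign p m (-1) = -1" "m \<notin> bad_shifts c" and x: "0 < x" "x < 1"
  shows "\<bar>cot_sum p (window p) (rel_sign p m) x - F_fun J (rel_sign p m) x\<bar> \<le> c + 4 / real (J - 1) + 20 / p"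
proof -
  have "(\<Sum>j\<in>window p. rel_sign p m j * tail_coeff p J j)
      = Legendre (int m) (int p) * (\<Sum>j\<in>window p. Legendre (int m - j) (int p) * tail_coeff p J j)"
    by (simp add: rel_sign_def sum_distrib_left mult.assoc)
  moreover have "\<bar>real_of_int (Legendre (int m) (int p))\<bar> = 1"
    using Legendre_values[OF prime odd, of "int m"] Legendre_nz[OF prime odd big m(1,2)] by auto
  ultimately have "\<bar>\<Sum>j\<in>window p. rel_sign p m j * tail_coeff p J j\<bar> \<le> c"
    using m by (simp add: bad_shifts_def abs_mult)
  thus ?thesis
    using cot_sum_F_fun_close[OF rel_sign_0[OF prime odd big m(1,2)] m(3) rel_sign_abs_le[OF prime odd big] x]
    by argo
qed

end

section \<open>Zero counts in terms of sign patterns\<close>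

definition realizing :: "nat \<Rightarrow> nat \<Rightarrow> (int \<Rightarrow> real) set \<Rightarrow> nat set" where
  "realizing p J D = {m. 1 \<le> m \<and> m < p \<and> rel_sign p m (-1) = -1 \<and> restrict (rel_sign p m) (F_indices J) \<in> D}"

text \<open>
  The values of \<open>\<chi>(m - j)\<close> for \<open>|j| < J\<close> when \<open>\<chi>(m) = s\<close>, \<open>\<chi>(m + 1) = -s\<close> and the remaining signs relative to
  \<open>\<chi>(m)\<close> are \<open>\<delta>\<close>.
\<close>
definition target :: "int \<Rightarrow> (int \<Rightarrow> real) \<Rightarrow> int \<Rightarrow> int" where
  "target s \<delta> j = (if j = 0 then s else if j = -1 then - s else if \<delta> j = 1 then s else - s)"

lemma real_of_int_eq_simps:
  "real_of_int a = 1 \<longleftrightarrow> a = 1" "real_of_int a = -1 \<longleftrightarrow> a = -1"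
  by linarith+

lemma realizing_eq:
  assumes p: "prime p" "odd p" "p \<ge> 100" and J: "J \<ge> 2" and D: "D \<subseteq> sign_patterns J"
  shows "realizing p J D = (\<Union>(s, \<delta>)\<in>{1, -1} \<times> D. pattern_class p {j. \<bar>j\<bar> < int J} (target s \<delta>))"
proof (intro equalityI subsetI)
  note L = Legendre_values[OF p(1,2)]
  fix m assume m: "m \<in> realizing p J D"
  define s where "s = Legendre (int m) (int p)"
  define \<delta> where "\<delta> = restrict (rel_sign p m) (F_indices J)"
  have D': "\<delta> \<in> D" using m by (simp add: realizing_def \<delta>_def)
  have s: "s = 1 \<or> s = -1"
    using Legendre_nz[OF p, of m] L[of "int m"] m by (auto simp: s_def realizing_def)
  have "Legendre (int m - j) (int p) = target s \<delta> j" if j: "\<bar>j\<bar> < int J" for j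
  proof -
    consider "j = 0" | "j = -1" | "j \<in> F_indices J" using j by (auto simp: F_indices_def)
    thus ?thesis
    proof cases
      case 2
      have "rel_sign p m (-1) = -1" using m by (simp add: realizing_def)
      hence "s * Legendre (int m - j) (int p) = -1"
        unfolding rel_sign_def using 2 by (simp only: real_of_int_eq_simps s_def)
      thus ?thesis using s 2 by (auto simp: target_def)
    next
      case 3
      hence "\<delta> j = 1 \<or> \<delta> j = -1" using sign_patterns_values D' D by blast
      moreover have "\<delta> j = real_of_int (s * Legendre (int m - j) (int p))"
        using 3 by (simp only: \<delta>_def restrict_apply' rel_sign_def s_def)
      ultimately have "\<delta> j = 1 \<and> s * Legendre (int m - j) (int p) = 1 \<or>
          \<delta> j = -1 \<and> s * Legendre (int m - j) (int p) = -1"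
        by (metis real_of_int_eq_simps)
      moreover have "j \<noteq> 0" "j \<noteq> -1" using 3 by (auto simp: F_indices_def)
      ultimately show ?thesis using s by (auto simp: target_def)
    qed (simp add: target_def s_def)
  qed
  hence "m \<in> pattern_class p {j. \<bar>j\<bar> < int J} (target s \<delta>)"
    using m by (simp add: pattern_class_def realizing_def)
  thus "m \<in> (\<Union>(s, \<delta>)\<in>{1, -1} \<times> D. pattern_class p {j. \<bar>j\<bar> < int J} (target s \<delta>))"
    using s D' by (intro UN_I[of "(s, \<delta>)"]) auto
next
  fix m assume "m \<in> (\<Union>(s, \<delta>)\<in>{1, -1} \<times> D. pattern_class p {j. \<bar>j\<bar> < int J} (target s \<delta>))"
  then obtain s \<delta> where s: "s = 1 \<or> s = -1" and \<delta>: "\<delta> \<in> D"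
    and m: "m \<in> pattern_class p {j. \<bar>j\<bar> < int J} (target s \<delta>)" by blast
  hence L: "Legendre (int m - j) (int p) = target s \<delta> j" if "\<bar>j\<bar> < int J" for j
    using that by (auto simp: pattern_class_def)
  have L0: "Legendre (int m) (int p) = s" using L[of 0] J by (simp add: target_def)
  have "m \<noteq> 0" using L0 s Legendre_eq_0_iff[OF p(1,2), of 0] by (intro notI) auto
  moreover have "m < p" using m by (simp add: pattern_class_def)
  moreover have "rel_sign p m (-1) = -1"
    using L[of "-1"] L0 J s by (auto simp: rel_sign_def target_def)
  moreover have "restrict (rel_sign p m) (F_indices J) = \<delta>"
  proof (rule PiE_ext[where s = "\<lambda>_. UNIV"])
    show "\<delta> \<in> F_indices J \<rightarrow>\<^sub>E UNIV" using \<delta> D by (auto simp: sign_patterns_def PiE_def)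
    show "restrict (rel_sign p m) (F_indices J) \<in> F_indices J \<rightarrow>\<^sub>E UNIV" by auto
    fix j assume j: "j \<in> F_indices J"
    have "\<delta> j = 1 \<or> \<delta> j = -1" using sign_patterns_values j \<delta> D by blast
    thus "restrict (rel_sign p m) (F_indices J) j = \<delta> j"
      using L[of j] L0 j s by (auto simp: rel_sign_def target_def F_indices_def)
  qed
  ultimately show "m \<in> realizing p J D" using \<delta> by (simp add: realizing_def)
qed

lemma target_values: "s = 1 \<or> s = -1 \<Longrightarrow> target s \<delta> j = 1 \<or> target s \<delta> j = -1"
  by (auto simp: target_def)

lemma pattern_classes_disjoint:
  assumes J: "J \<ge> 2" and mem: "\<delta> \<in> sign_patterns J" "\<delta>' \<in> sign_patterns J" "(s, \<delta>) \<noteq> (s', \<delta>')"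
    and s: "s = 1 \<or> s = -1" "s' = 1 \<or> s' = -1"
  shows "pattern_class p {j. \<bar>j\<bar> < int J} (target s \<delta>) \<inter> pattern_class p {j. \<bar>j\<bar> < int J} (target s' \<delta>') = {}"
proof (rule ccontr)
  assume "\<not> ?thesis"
  then obtain m where m: "\<And>j. \<bar>j\<bar> < int J \<Longrightarrow> target s \<delta> j = target s' \<delta>' j"
    by (auto simp: pattern_class_def)
  have ss: "s = s'" using m[of 0] J by (simp add: target_def)
  have "\<delta> = \<delta>'"
  proof (rule PiE_ext)
    show "\<delta> \<in> F_indices J \<rightarrow>\<^sub>E {1, -1}" "\<delta>' \<in> F_indices J \<rightarrow>\<^sub>E {1, -1}"
      using mem by (auto simp: sign_patterns_def)
    fix j assume j: "j \<in> F_indices J"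
    show "\<delta> j = \<delta>' j"
      using m[of j] j s ss sign_patterns_values[OF mem(1) j] sign_patterns_values[OF mem(2) j]
      by (auto simp: target_def F_indices_def split: if_splits)
  qed
  thus False using ss mem(3) by simp
qed

text \<open>
  The factor \<open>2\<close> in the denominator accounts for the condition \<open>\<chi>(m+1) = -\<chi>(m)\<close>; given this, the relative signs are
  uniformly distributed.
\<close>
theorem realizing_density:
  assumes J: "J \<ge> 2" and D: "D \<subseteq> sign_patterns J"
  shows "((\<lambda>p. real (card (realizing p J D)) / p) \<longlongrightarrow> card D / (2 * card (sign_patterns J))) odd_primes_at_top"
proof -
  define I where "I = {j. \<bar>j\<bar> < int J}"
  have I: "finite I" "card I = card (F_indices J) + 2"
  proof -
    have eq: "I = insert 0 (insert (-1) (F_indices J))" using J by (auto simp: I_def F_indices_def)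
    have "0 \<notin> insert (-1) (F_indices J)" "-1 \<notin> F_indices J" by (auto simp: F_indices_def)
    thus "finite I" "card I = card (F_indices J) + 2" using finite_F_indices[of J] by (simp_all add: eq)
  qed
  have fD: "finite D" using D finite_sign_patterns finite_subset by blast
  have "((\<lambda>p. \<Sum>(s, \<delta>)\<in>{1, -1} \<times> D. real (card (pattern_class p I (target s \<delta>))) / p)
          \<longlongrightarrow> (\<Sum>(s, \<delta>)\<in>{1 :: int, -1} \<times> D. 1 / 2 ^ card I)) odd_primes_at_top"
    unfolding case_prod_beta
    by (intro tendsto_sum pattern_class_density I(1) target_values) auto
  also have "(\<Sum>(s, \<delta>)\<in>{1 :: int, -1} \<times> D. 1 / 2 ^ card I :: real) = card D / (2 * card (sign_patterns J))"
    by (simp add: card_cartesian_product I(2) card_sign_patterns)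
  finally have lim: "((\<lambda>p. \<Sum>(s, \<delta>)\<in>{1, -1} \<times> D. real (card (pattern_class p I (target s \<delta>))) / p)
          \<longlongrightarrow> card D / (2 * card (sign_patterns J))) odd_primes_at_top" .
  show ?thesis
  proof (rule Lim_transform_eventually[OF lim])
    show "eventually (\<lambda>p. (\<Sum>(s, \<delta>)\<in>{1, -1} \<times> D. real (card (pattern_class p I (target s \<delta>))) / p)
        = real (card (realizing p J D)) / p) odd_primes_at_top"
      using eventually_odd_primes_ge[of 100]
    proof eventually_elim
      case (elim p)
      have "realizing p J D = (\<Union>x\<in>{1, -1} \<times> D. pattern_class p I (target (fst x) (snd x)))"
      proof -
        have "prime p" "odd p" "p \<ge> 100" using elim by blast+
        show ?thesis
          unfolding realizing_eq[OF \<open>prime p\<close> \<open>odd p\<close> \<open>p \<ge> 100\<close> J D] I_def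
          by (rule SUP_cong[OF refl]) (simp add: split_beta)
      qed
      also have "card \<dots> = (\<Sum>x\<in>{1, -1} \<times> D. card (pattern_class p I (target (fst x) (snd x))))"
      proof (rule card_UN_disjoint)
        show "\<forall>i\<in>{1, -1} \<times> D. \<forall>j\<in>{1, -1} \<times> D. i \<noteq> j \<longrightarrow>
          pattern_class p I (target (fst i) (snd i)) \<inter> pattern_class p I (target (fst j) (snd j)) = {}"
        proof (intro ballI impI)
          fix i j :: "int \<times> (int \<Rightarrow> real)" assume ij: "i \<in> {1, -1} \<times> D" "j \<in> {1, -1} \<times> D" "i \<noteq> j"
          show "pattern_class p I (target (fst i) (snd i)) \<inter> pattern_class p I (target (fst j) (snd j)) = {}"
            unfolding I_def by (rule pattern_classes_disjoint[OF J]) (use ij D in auto)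
        qed
        show "\<forall>i\<in>{1, -1} \<times> D. finite (pattern_class p I (target (fst i) (snd i)))"
          by (auto simp: pattern_class_def)
      qed (use fD in auto)
      finally show ?case by (simp add: case_prod_beta sum_divide_distrib)
    qed
  qed
qed

definition same_sign :: "nat \<Rightarrow> nat set" where
  "same_sign p = {m. 1 \<le> m \<and> m < p \<and> rel_sign p m (-1) = 1}"

lemma same_sign_density:
  "((\<lambda>p. real (card (same_sign p)) / p) \<longlongrightarrow> 1 / 2) odd_primes_at_top"
proof -
  have "((\<lambda>p. real (card (pattern_class p {0, -1} (\<lambda>_. 1))) / p + real (card (pattern_class p {0, -1} (\<lambda>_. -1))) / p)
     \<longlongrightarrow> 1 / 2 ^ card {0, -1 :: int} + 1 / 2 ^ card {0, -1 :: int}) odd_primes_at_top"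
    by (intro tendsto_add pattern_class_density) auto
  hence lim: "((\<lambda>p. real (card (pattern_class p {0, -1} (\<lambda>_. 1))) / p + real (card (pattern_class p {0, -1} (\<lambda>_. -1))) / p)
     \<longlongrightarrow> 1 / 2) odd_primes_at_top" by (simp add: power2_eq_square)
  show ?thesis
  proof (rule Lim_transform_eventually[OF lim])
    show "eventually (\<lambda>p. real (card (pattern_class p {0, -1} (\<lambda>_. 1))) / p + real (card (pattern_class p {0, -1} (\<lambda>_. -1))) / p
       = real (card (same_sign p)) / p) odd_primes_at_top"
      using eventually_odd_primes_ge[of 100]
    proof eventually_elim
      case (elim p)
      hence p: "prime p" "odd p" "p \<ge> 100" by auto
      have L0: "Legendre 0 (int p) = 0" using Legendre_eq_0_iff[OF p(1,2), of 0] by simp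
      have "same_sign p = pattern_class p {0, -1} (\<lambda>_. 1) \<union> pattern_class p {0, -1} (\<lambda>_. -1)"
      proof (intro equalityI subsetI)
        fix m assume m: "m \<in> same_sign p"
        hence "Legendre (int m) (int p) * Legendre (int m - -1) (int p) = 1"
          unfolding same_sign_def rel_sign_def by (simp only: mem_Collect_eq real_of_int_eq_simps)
        thus "m \<in> pattern_class p {0, -1} (\<lambda>_. 1) \<union> pattern_class p {0, -1} (\<lambda>_. -1)"
          using m by (auto simp: pattern_class_def same_sign_def zmult_eq_1_iff)
      next
        fix m assume m: "m \<in> pattern_class p {0, -1} (\<lambda>_. 1) \<union> pattern_class p {0, -1} (\<lambda>_. -1)"
        have "m \<noteq> 0" using m L0 by (intro notI) (auto simp: pattern_class_def)
        thus "m \<in> same_sign p" using m by (auto simp: pattern_class_def same_sign_def rel_sign_def)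
      qed
      moreover have "card (pattern_class p {0, -1} (\<lambda>_. 1) \<union> pattern_class p {0, -1} (\<lambda>_. -1))
          = card (pattern_class p {0, -1} (\<lambda>_. 1)) + card (pattern_class p {0, -1} (\<lambda>_. -1))"
        by (rule card_Un_disjoint) (auto simp: pattern_class_def)
      ultimately show ?case by (simp add: add_divide_distrib)
    qed
  qed
qed

lemma F_fun_restrict: "F_fun J (restrict \<delta> (F_indices J)) x = F_fun J \<delta> x"
  by (simp add: F_fun_def)

text \<open>
  Unless \<open>m\<close> is bad, the cotangent sum is within \<open>\<epsilon>\<close> of the rational function.  So there are two zeros if the latter reaches
  \<open>-\<epsilon>\<close> and none if it stays above \<open>\<epsilon>\<close>; in all other cases at most two zeros are possible.
\<close>
lemma circle_zeros_bounds:
  fixes \<epsilon> :: real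
  assumes p: "prime p" "odd p" "p \<ge> 100" and J: "J \<ge> 2" "2 * J \<le> p"
    and \<epsilon>: "\<epsilon> > 0" "\<epsilon> / 4 + 4 / real (J - 1) + 20 / p < \<epsilon>"
  defines "bad \<equiv> card (bad_shifts p J (\<epsilon> / 4))"
  shows "card (same_sign p) + 2 * card (realizing p J (low_patterns J (- \<epsilon>)))
           \<le> card (circle_zeros p) + 2 * bad" (is ?lower)
    and "card (circle_zeros p) \<le> 3 + card (same_sign p)
           + 2 * (card (realizing p J (low_patterns J \<epsilon>)) + bad + 2 * J)" (is ?upper)
proof -
  define opp where "opp = {m. 1 \<le> m \<and> m < p \<and> rel_sign p m (-1) = -1}"
  define Bd where "Bd = bad_shifts p J (\<epsilon> / 4)"
  define V where "V = {m. m < p \<and> (\<exists>j\<in>{j. \<bar>j\<bar> < int J}. Legendre (int m - j) (int p) = 0)}"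
  define lo where "lo = realizing p J (low_patterns J (- \<epsilon>))"
  define hi where "hi = realizing p J (low_patterns J \<epsilon>)"
  have fin: "finite opp" "finite (same_sign p)" "finite Bd" "finite V" "finite lo" "finite hi"
    by (auto simp: opp_def same_sign_def Bd_def bad_shifts_def[OF p J] V_def lo_def hi_def realizing_def)
  have pm1: "rel_sign p m (-1) = 1 \<or> rel_sign p m (-1) = -1" if m: "m \<in> {1..p - 2}" for m
  proof -
    have "Legendre (int (m + 1)) (int p) \<noteq> 0" by (rule Legendre_nz[OF p]) (use m p in auto)
    hence "Legendre (int m + 1) (int p) \<noteq> 0" by (simp add: add.commute)
    moreover have "Legendre (int m) (int p) \<noteq> 0" by (rule Legendre_nz[OF p]) (use m p in auto)
    ultimately show ?thesis
      using Legendre_values[OF p(1,2), of "int m"] Legendre_values[OF p(1,2), of "int m + 1"]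
      by (auto simp: rel_sign_def)
  qed
  have le: "m \<le> p - 2" if "m < p" "rel_sign p m (-1) \<noteq> 0" for m
  proof -
    have "m \<noteq> p - 1"
      using that Legendre_eq_0_iff[OF p(1,2), of "int m + 1"] p by (auto simp: rel_sign_def of_nat_diff)
    thus ?thesis using that by linarith
  qed
  have split: "{1..p - 2} = same_sign p \<union> opp"
  proof (intro equalityI subsetI)
    fix m assume m: "m \<in> {1..p - 2}"
    hence "1 \<le> m" "m < p" using p(3) by auto
    thus "m \<in> same_sign p \<union> opp" using pm1[OF m] by (auto simp: same_sign_def opp_def)
  next
    fix m assume "m \<in> same_sign p \<union> opp"
    thus "m \<in> {1..p - 2}" using le[of m] by (auto simp: same_sign_def opp_def)
  qed
  have "(\<Sum>m\<in>{1..p - 2}. card (block_zeros p m)) = (\<Sum>m\<in>same_sign p. card (block_zeros p m)) + (\<Sum>m\<in>opp. card (block_zeros p m))"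
    unfolding split by (rule sum.union_disjoint) (use fin in \<open>auto simp: same_sign_def opp_def\<close>)
  also have "(\<Sum>m\<in>same_sign p. card (block_zeros p m)) = (\<Sum>m\<in>same_sign p. 1)"
    by (intro sum.cong refl card_block_zeros_same[OF p]) (auto simp: same_sign_def)
  finally have total: "(\<Sum>m\<in>{1..p - 2}. card (block_zeros p m)) = card (same_sign p) + (\<Sum>m\<in>opp. card (block_zeros p m))"
    by simp
  obtain c where c: "c \<le> 3" "card (circle_zeros p) = c + (\<Sum>m\<in>{1..p - 2}. card (block_zeros p m))"
    using card_circle_zeros[OF p] by blast
  have close: "\<bar>cot_sum p (window p) (rel_sign p m) x - F_fun J (rel_sign p m) x\<bar> < \<epsilon>"
    if "m \<in> opp" "m \<notin> Bd" "0 < x" "x < 1" for m x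
  proof -
    have "1 \<le> m" "m < p" "rel_sign p m (-1) = -1" "m \<notin> bad_shifts p J (\<epsilon> / 4)"
      using that by (simp_all add: opp_def Bd_def)
    from le_less_trans[OF rel_sign_close[OF p J this that(3,4)] \<epsilon>(2)] show ?thesis .
  qed
  have lo_sub: "lo \<subseteq> opp" by (auto simp: lo_def realizing_def opp_def)
  have two: "card (block_zeros p m) = 2" if m: "m \<in> lo - Bd" for m
  proof -
    have mo: "m \<in> opp" using m lo_sub by blast
    obtain x where x: "0 < x" "x < 1" "F_fun J (rel_sign p m) x \<le> - \<epsilon>"
      using m by (auto simp: lo_def realizing_def low_patterns_def F_fun_restrict)
    have "cot_sum p (window p) (rel_sign p m) x < 0"
      using close[OF mo _ x(1,2)] m x(3) by (auto simp: abs_less_iff)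
    thus ?thesis
      using card_block_zeros_opposite(2)[OF p, of m x] mo x by (auto simp: opp_def)
  qed
  have "2 * card (lo - Bd) = (\<Sum>m\<in>lo - Bd. card (block_zeros p m))"
    using two by simp
  also have "\<dots> \<le> (\<Sum>m\<in>opp. card (block_zeros p m))"
    by (rule sum_mono2) (use fin lo_sub in auto)
  finally have "2 * card (lo - Bd) \<le> (\<Sum>m\<in>opp. card (block_zeros p m))" .
  moreover have "card lo \<le> card (lo - Bd) + card Bd"
    using diff_card_le_card_Diff[OF fin(3), of lo] by simp
  ultimately show ?lower using c(2) total by (simp add: lo_def bad_def Bd_def)
  have zero: "card (block_zeros p m) = 0" if m: "m \<in> opp - (hi \<union> Bd \<union> V)" for m
  proof -
    have pm: "1 \<le> m" "m < p" using m by (auto simp: opp_def)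
    have "restrict (rel_sign p m) (F_indices J) \<in> sign_patterns J"
      unfolding sign_patterns_def restrict_PiE_iff
    proof
      fix j assume j: "j \<in> F_indices J"
      hence "Legendre (int m - j) (int p) \<noteq> 0" using m pm by (auto simp: V_def F_indices_def)
      thus "rel_sign p m j \<in> {1, -1}"
        using Legendre_nz[OF p pm] Legendre_values[OF p(1,2), of "int m"] Legendre_values[OF p(1,2), of "int m - j"]
        by (auto simp: rel_sign_def)
    qed
    hence F: "F_fun J (rel_sign p m) x > \<epsilon>" if "0 < x" "x < 1" for x
      using m that by (force simp: hi_def realizing_def opp_def low_patterns_def F_fun_restrict not_le)
    have "cot_sum p (window p) (rel_sign p m) x \<noteq> 0" if "0 < x" "x < 1" for x
      using close[of m x] F[OF that] m that by (auto simp: abs_less_iff)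
    hence "block_zeros p m = {}" unfolding block_zeros_eq[OF p pm] by blast
    thus ?thesis by simp
  qed
  have "(\<Sum>m\<in>opp. card (block_zeros p m)) = (\<Sum>m\<in>opp \<inter> (hi \<union> Bd \<union> V). card (block_zeros p m))"
    by (rule sum.mono_neutral_right) (use fin zero in auto)
  also have "\<dots> \<le> (\<Sum>m\<in>opp \<inter> (hi \<union> Bd \<union> V). 2)"
    using card_block_zeros_opposite(1)[OF p] by (intro sum_mono) (auto simp: opp_def)
  also have "\<dots> \<le> 2 * card (hi \<union> Bd \<union> V)"
    using fin by (simp add: card_mono)
  also have "card (hi \<union> Bd \<union> V) \<le> card hi + card Bd + card V"
    by (rule order_trans[OF card_Un_le]) (simp add: card_Un_le)
  also have "card V \<le> card {j. \<bar>j\<bar> < int J}"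
    unfolding V_def by (rule card_vanishing_le[OF p(1,2)]) (rule finite_subset[of _ "{- int J..int J}"], auto)
  also have "card {j. \<bar>j\<bar> < int J} \<le> 2 * J"
  proof -
    have "{j. \<bar>j\<bar> < int J} = {- (int J - 1)..int J - 1}" by auto
    thus ?thesis by simp
  qed
  finally have "(\<Sum>m\<in>opp. card (block_zeros p m)) \<le> 2 * (card hi + card Bd + 2 * J)" by simp
  thus ?upper using c total by (simp add: hi_def bad_def Bd_def)
qed

definition zero_ratio :: "nat \<Rightarrow> real" where
  "zero_ratio J = real (card (low_patterns J 0)) / real (card (sign_patterns J))"

lemma low_patterns_mono: "c \<le> c' \<Longrightarrow> low_patterns J c \<subseteq> low_patterns J c'"
  by (force simp: low_patterns_def)

lemma low_ratio_close:
  assumes "4 ^ n < J" "\<epsilon> > 0" "\<epsilon> * 4 ^ (n + 1) \<le> 1"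
  shows "card (low_patterns J \<epsilon>) / card (sign_patterns J) \<le> zero_ratio J + 1 / 2 ^ n"
    and "card (low_patterns J (- \<epsilon>)) / card (sign_patterns J) \<ge> zero_ratio J - 1 / 2 ^ n"
proof -
  define W where "W = real (card (sign_patterns J))"
  have W: "W > 0" by (simp add: W_def card_sign_patterns)
  have sub: "low_patterns J (- \<epsilon>) \<subseteq> low_patterns J 0" "low_patterns J 0 \<subseteq> low_patterns J \<epsilon>"
    using assms by (intro low_patterns_mono; simp)+
  have "real (card (low_patterns J \<epsilon> - low_patterns J (- \<epsilon>)) * 2 ^ n) \<le> W"
    unfolding W_def of_nat_le_iff by (rule anticoncentration[OF assms(1,3)])
  moreover have "card (low_patterns J \<epsilon> - low_patterns J (- \<epsilon>)) = card (low_patterns J \<epsilon>) - card (low_patterns J (- \<epsilon>))"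
    using sub finite_low_patterns by (intro card_Diff_subset) auto
  moreover have le: "card (low_patterns J (- \<epsilon>)) \<le> card (low_patterns J 0)" "card (low_patterns J 0) \<le> card (low_patterns J \<epsilon>)"
    using sub finite_low_patterns by (auto intro: card_mono)
  ultimately have "(real (card (low_patterns J \<epsilon>)) - real (card (low_patterns J (- \<epsilon>)))) * 2 ^ n \<le> W"
    by (simp add: of_nat_diff)
  hence d: "real (card (low_patterns J \<epsilon>)) / W - real (card (low_patterns J (- \<epsilon>))) / W \<le> 1 / 2 ^ n"
    using W by (simp add: field_simps)
  have "real (card (low_patterns J (- \<epsilon>))) / W \<le> zero_ratio J" "zero_ratio J \<le> real (card (low_patterns J \<epsilon>)) / W"
    using le W by (simp_all add: zero_ratio_def W_def divide_right_mono)
  thus "card (low_patterns J \<epsilon>) / card (sign_patterns J) \<le> zero_ratio J + 1 / 2 ^ n"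
    and "card (low_patterns J (- \<epsilon>)) / card (sign_patterns J) \<ge> zero_ratio J - 1 / 2 ^ n"
    using d by (simp_all add: W_def)
qed

section \<open>The two limits\<close>

lemma fekete_density_near_zero_ratio:
  fixes \<eta> :: real
  assumes \<eta>: "\<eta> > 0"
  shows "\<exists>J0. \<forall>J\<ge>J0. eventually (\<lambda>p. \<bar>real (card (circle_zeros p)) / p - (1 / 2 + zero_ratio J)\<bar> \<le> \<eta>) odd_primes_at_top"
proof -
  obtain n where n: "(1 / 2) ^ n < \<eta> / 4" using real_arch_pow_inv[of "\<eta> / 4" "1 / 2"] \<eta> by auto
  define \<epsilon> :: real where "\<epsilon> = 1 / 4 ^ (n + 1)"
  have \<epsilon>: "\<epsilon> > 0" "\<epsilon> * 4 ^ (n + 1) \<le> 1" by (simp_all add: \<epsilon>_def)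
  obtain K :: nat where K: "16 / \<epsilon> + 512 / (\<epsilon>\<^sup>2 * \<eta>) < K" using reals_Archimedean2 by blast
  show ?thesis
  proof (intro exI[of _ "K + 4 ^ n + 3"] allI impI)
    fix J assume J: "J \<ge> K + 4 ^ n + 3"
    have J2: "J \<ge> 2" "4 ^ n < J" "real (J - 1) \<ge> K" using J by auto
    have pos: "16 / \<epsilon> > 0" "512 / (\<epsilon>\<^sup>2 * \<eta>) > 0" using \<epsilon> \<eta> by auto
    define Z where "Z = real (J - 1)"
    have Z: "Z > 0" "Z \<ge> K" using J J2(3) by (auto simp: Z_def)
    have "16 / \<epsilon> < Z" using K Z pos by linarith
    hence "16 < Z * \<epsilon>" using \<epsilon>(1) by (simp add: pos_divide_less_eq)
    hence s1: "4 / real (J - 1) < \<epsilon> / 4"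
      unfolding Z_def[symmetric] using Z by (simp add: pos_divide_less_eq mult.commute)
    have "512 / (\<epsilon>\<^sup>2 * \<eta>) < Z" using K Z pos by linarith
    hence "512 < Z * (\<epsilon>\<^sup>2 * \<eta>)" using \<epsilon>(1) \<eta> by (simp add: pos_divide_less_eq)
    hence s2: "2 * (16 / \<epsilon>\<^sup>2 * (4 / real (J - 1))) < \<eta> / 4"
      unfolding Z_def[symmetric] using Z \<epsilon>(1) by (simp add: field_simps)
    define W where "W = real (card (sign_patterns J))"
    define b where "b = (\<lambda>p::nat. 16 / \<epsilon>\<^sup>2 * (100 / p + 4 / real (J - 1)))"
    define low where "low = (\<lambda>p. real (card (same_sign p)) / p
        + 2 * (real (card (realizing p J (low_patterns J (- \<epsilon>)))) / p) - 2 * b p)"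
    define high where "high = (\<lambda>p. 3 / real p + real (card (same_sign p)) / p
        + 2 * (real (card (realizing p J (low_patterns J \<epsilon>))) / p) + 2 * b p + 4 * J / real p)"
    have inv0: "((\<lambda>p. c / real p) \<longlongrightarrow> 0) odd_primes_at_top" for c :: real
      by (rule filterlim_compose[OF _ odd_primes_at_top_le[THEN filterlim_ident[THEN filterlim_mono, OF order_refl]]])
         (rule lim_const_over_n)
    have limb: "(b \<longlongrightarrow> 16 / \<epsilon>\<^sup>2 * (0 + 4 / real (J - 1))) odd_primes_at_top"
      unfolding b_def by (intro tendsto_intros inv0)
    have sub: "low_patterns J c \<subseteq> sign_patterns J" for c by (auto simp: low_patterns_def)
    have limr: "((\<lambda>p. 2 * (real (card (realizing p J (low_patterns J c))) / p))
        \<longlongrightarrow> 2 * (card (low_patterns J c) / (2 * card (sign_patterns J)))) odd_primes_at_top" for c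
      by (intro tendsto_mult_left realizing_density J2 sub)
    have ratio: "2 * (card (low_patterns J c) / (2 * card (sign_patterns J))) = card (low_patterns J c) / W" for c
      by (simp add: W_def)
    have "(low \<longlongrightarrow> 1 / 2 + card (low_patterns J (- \<epsilon>)) / W - 2 * (16 / \<epsilon>\<^sup>2 * (0 + 4 / real (J - 1)))) odd_primes_at_top"
      unfolding low_def ratio[symmetric]
      by (intro tendsto_add tendsto_diff same_sign_density limr tendsto_mult_left limb)
    moreover have "1 / 2 + card (low_patterns J (- \<epsilon>)) / W - 2 * (16 / \<epsilon>\<^sup>2 * (0 + 4 / real (J - 1)))
        > 1 / 2 + zero_ratio J - \<eta>"
      using low_ratio_close(2)[OF J2(2) \<epsilon>] n s2 \<eta> unfolding W_def by (simp add: power_one_over)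
    ultimately have ev1: "eventually (\<lambda>p. low p > 1 / 2 + zero_ratio J - \<eta>) odd_primes_at_top"
      by (rule order_tendstoD)
    have "(high \<longlongrightarrow> 0 + 1 / 2 + card (low_patterns J \<epsilon>) / W + 2 * (16 / \<epsilon>\<^sup>2 * (0 + 4 / real (J - 1))) + 0) odd_primes_at_top"
      unfolding high_def ratio[symmetric]
      by (intro tendsto_add same_sign_density limr tendsto_mult_left limb inv0)
    moreover have "0 + 1 / 2 + card (low_patterns J \<epsilon>) / W + 2 * (16 / \<epsilon>\<^sup>2 * (0 + 4 / real (J - 1))) + 0
        < 1 / 2 + zero_ratio J + \<eta>"
      using low_ratio_close(1)[OF J2(2) \<epsilon>] n s2 \<eta> unfolding W_def by (simp add: power_one_over)
    ultimately have ev2: "eventually (\<lambda>p. high p < 1 / 2 + zero_ratio J + \<eta>) odd_primes_at_top"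
      by (rule order_tendstoD)
    have ev3: "eventually (\<lambda>p. 20 / real p < \<epsilon> / 4) odd_primes_at_top"
      by (rule order_tendstoD(2)[OF inv0]) (use \<epsilon> in simp)
    show "eventually (\<lambda>p. \<bar>real (card (circle_zeros p)) / p - (1 / 2 + zero_ratio J)\<bar> \<le> \<eta>) odd_primes_at_top"
      using ev1 ev2 ev3 eventually_odd_primes_ge[of "100 + 2 * J"]
    proof eventually_elim
      case (elim p)
      have p: "prime p" "odd p" "p \<ge> 100" "2 * J \<le> p" using elim(4) by auto
      have p0: "real p > 0" using p by simp
      define bad where "bad = card (bad_shifts p J (\<epsilon> / 4))"
      \<comment> \<open>the proportion of bad shifts, from the second moment bound with threshold \<open>\<epsilon>/4\<close>\<close>
      define R where "R = 100 / p + 4 / real (J - 1)"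
      have "real bad * (\<epsilon> / 4)\<^sup>2 \<le> p * R"
        unfolding bad_def R_def by (rule card_bad_shifts[OF p(1-3) J2(1) p(4)]) (use \<epsilon> in simp)
      hence "real bad / p \<le> 16 / \<epsilon>\<^sup>2 * R"
        using p0 \<epsilon>(1) by (simp add: field_simps power2_eq_square)
      hence bad: "real bad / p \<le> b p" by (simp only: b_def R_def)
      have s3: "\<epsilon> / 4 + 4 / real (J - 1) + 20 / p < \<epsilon>" using s1 elim(3) \<epsilon> by argo
      note B = circle_zeros_bounds[OF p(1-3) J2(1) p(4) \<epsilon>(1) s3, folded bad_def]
      have "real (card (same_sign p) + 2 * card (realizing p J (low_patterns J (- \<epsilon>))))
          \<le> real (card (circle_zeros p) + 2 * bad)"
        using B(1) by (simp only: of_nat_le_iff)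
      hence "(real (card (same_sign p)) + 2 * real (card (realizing p J (low_patterns J (- \<epsilon>))))) / p
          \<le> (real (card (circle_zeros p)) + 2 * real bad) / p"
        using p0 by (intro divide_right_mono) auto
      hence "low p \<le> real (card (circle_zeros p)) / p"
        using bad by (simp add: low_def add_divide_distrib)
      moreover have "real (card (circle_zeros p)) \<le> real (3 + card (same_sign p)
           + 2 * (card (realizing p J (low_patterns J \<epsilon>)) + bad + 2 * J))"
        using B(2) by (simp only: of_nat_le_iff)
      hence "real (card (circle_zeros p)) / p \<le> (3 + real (card (same_sign p))
           + 2 * (real (card (realizing p J (low_patterns J \<epsilon>))) + real bad + 2 * J)) / p"
        using p0 by (intro divide_right_mono) auto
      hence "real (card (circle_zeros p)) / p \<le> high p"
        using bad by (simp add: high_def add_divide_distrib)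
      ultimately show ?case using elim(1,2) by (simp add: abs_le_iff)
    qed
  qed
qed

text \<open>
  Comparing \<open>q J\<close> and \<open>q K\<close> through one and the same \<open>x p\<close> shows that \<open>q\<close> is a Cauchy sequence.
\<close>
lemma common_limit:
  fixes x :: "'a \<Rightarrow> real" and q :: "nat \<Rightarrow> real"
  assumes F: "F \<noteq> bot"
    and close: "\<And>\<eta>. \<eta> > 0 \<Longrightarrow> \<exists>J0. \<forall>J\<ge>J0. eventually (\<lambda>p. \<bar>x p - q J\<bar> \<le> \<eta>) F"
  shows "\<exists>L. (x \<longlongrightarrow> L) F \<and> q \<longlonglongrightarrow> L"
proof -
  have "Cauchy q"
  proof (rule metric_CauchyI)
    fix e :: real assume "e > 0"
    then obtain J0 where J0: "\<And>J. J \<ge> J0 \<Longrightarrow> eventually (\<lambda>p. \<bar>x p - q J\<bar> \<le> e / 3) F"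
      using close[of "e / 3"] by auto
    have "dist (q m) (q n) < e" if "m \<ge> J0" "n \<ge> J0" for m n
    proof -
      have "eventually (\<lambda>p. \<bar>x p - q m\<bar> \<le> e / 3 \<and> \<bar>x p - q n\<bar> \<le> e / 3) F"
        by (intro eventually_conj J0 that)
      then obtain p where "\<bar>x p - q m\<bar> \<le> e / 3" "\<bar>x p - q n\<bar> \<le> e / 3"
        using eventually_happens'[OF F] by blast
      thus ?thesis using \<open>e > 0\<close> unfolding dist_real_def by argo
    qed
    thus "\<exists>M. \<forall>m\<ge>M. \<forall>n\<ge>M. dist (q m) (q n) < e" by blast
  qed
  then obtain L where L: "q \<longlonglongrightarrow> L" using Cauchy_convergent convergent_def by blast
  have "(x \<longlongrightarrow> L) F"
  proof (rule tendstoI)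
    fix e :: real assume e: "e > 0"
    then obtain J0 where J0: "\<And>J. J \<ge> J0 \<Longrightarrow> eventually (\<lambda>p. \<bar>x p - q J\<bar> \<le> e / 3) F"
      using close[of "e / 3"] by auto
    have "eventually (\<lambda>J. dist (q J) L < e / 3) sequentially" by (rule tendstoD[OF L]) (use e in simp)
    then obtain J1 where J1: "\<And>J. J \<ge> J1 \<Longrightarrow> dist (q J) L < e / 3"
      by (auto simp: eventually_sequentially)
    have d: "\<bar>q (max J0 J1) - L\<bar> < e / 3" using J1[of "max J0 J1"] by (simp add: dist_real_def)
    have "eventually (\<lambda>p. \<bar>x p - q (max J0 J1)\<bar> \<le> e / 3) F" by (rule J0) simp
    thus "eventually (\<lambda>p. dist (x p) L < e) F"
    proof eventually_elim
      case (elim p)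
      thus ?case using d e unfolding dist_real_def by argo
    qed
  qed
  thus ?thesis using L by blast
qed

theorem mainTheorem3:
  shows "\<exists>\<kappa>0 \<kappa>1 :: real.
    ((\<lambda>p. real (card {z :: complex. norm z = 1 \<and> poly (fekete_poly p) z = 0}) / real p)
       \<longlongrightarrow> \<kappa>0) odd_primes_at_top \<and>
    (\<lambda>J. real (card {g \<in> F_set J. \<exists>x. 0 < x \<and> x < 1 \<and> g x = 0}) / real (card (F_set J)))
       \<longlonglongrightarrow> \<kappa>1 \<and>
    \<kappa>0 = 1 / 2 + \<kappa>1"
proof -
  have "\<exists>L. ((\<lambda>p. real (card (circle_zeros p)) / p) \<longlongrightarrow> L) odd_primes_at_top
      \<and> (\<lambda>J. 1 / 2 + zero_ratio J) \<longlonglongrightarrow> L"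
    by (rule common_limit[OF odd_primes_at_top_neq_bot fekete_density_near_zero_ratio])
  then obtain L where L: "((\<lambda>p. real (card (circle_zeros p)) / p) \<longlongrightarrow> L) odd_primes_at_top"
      "(\<lambda>J. 1 / 2 + zero_ratio J) \<longlonglongrightarrow> L" by blast
  have "(\<lambda>J. (1 / 2 + zero_ratio J) - 1 / 2) \<longlonglongrightarrow> L - 1 / 2"
    by (intro tendsto_diff L tendsto_const)
  hence "zero_ratio \<longlonglongrightarrow> L - 1 / 2" by simp
  thus ?thesis
    using L(1) unfolding zero_ratio_eq circle_zeros_def zero_ratio_def[abs_def]
    by (intro exI[of _ L] exI[of _ "L - 1 / 2"]) simp
qed

end
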